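(* Let $T\in(0,\infty)$ and $\mu\in\mathbb R$. Let $\Omega$ be the space of continuous functions from $[0,T)$ to $\mathbb R$ with coordinate process $X$, $\mathbf F=(\mathcal F_t)_{t\in[0,T)}$ the right-continuous augmentation of the natural filtration of $X$, $\mathcal F=\bigvee_{t\in[0,T)}\mathcal F_t$, and $\mathbb P$ the probability on $(\Omega,\mathcal F)$ under which $X$ is a Brownian motion (started at $0$) with drift $\mu$ and unit diffusion coefficient. Let $X^\uparrow_t:=\sup_{s\in[0,t]}X_s$. Let $F_\mu$, $f_\mu$ be the functions in the context, let $$L_t:=F_\mu(T-t,X^\uparrow_t-X_t)\exp\Big(\int_0^tf_\mu(T-s)\,dX^\uparrow_s\Big),\quad t\in[0,T),$$ and let $\mathbb Q$ be the probability on $(\Omega,\mathcal F)$ with $d\mathbb Q/d\mathbb P|_{\mathcal F_t}=L_t$ for all $t\in[0,T)$. Let $G_\mu:(0,\infty)\times\mathbb R_+\to\mathbb R$ be defined by $$G_\mu(\tau,z):=\mu+\frac{(2/\sqrt\tau)\,\phi(z/\sqrt\tau-\mu\sqrt\tau)-2\mu e^{2\mu z}\,\overline\Phi(z/\sqrt\tau+\mu\sqrt\tau)}{\overline\Phi(z/\sqrt\tau-\mu\sqrt\tau)+e^{2\mu z}\,\overline\Phi(z/\sqrt\tau+\mu\sqrt\tau)} .$$ Then $G_\mu$ is $\mathbb R_+$-valued and $$\liminf_{\tau\downarrow0}\Big(\inf_{z\in[w,\infty)}\big(\tau\,G_\mu(\tau,z)\big)\Big)\ge w\qquad\text{for all }w\in(0,\infty).$$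 In particular, $X$ is a local submartingale on $(\Omega,\mathbf F,\mathbb Q)$ and $\mathbb Q\big[\liminf_{t\to T}(X^\uparrow_t-X_t)=0\big]=1$.
   Context: $\phi(x)=\frac1{\sqrt{2\pi}}e^{-x^2/2}$ and $\overline\Phi(x)=\int_x^\infty\phi(y)\,dy$. For $(\tau,z)\in(0,\infty)\times\mathbb R_+$, $$F_\mu(\tau,z):=e^{2\mu z}\,\overline\Phi\Big(\frac{z+\mu\tau}{\sqrt\tau}\Big)+\overline\Phi\Big(\frac{z-\mu\tau}{\sqrt\tau}\Big),\qquad f_\mu(\tau):=-\frac{\partial F_\mu}{\partial z}(\tau,0)=\sqrt{\frac{2}{\pi\tau}}\,e^{-\mu^2\tau/2}-2\mu\,\overline\Phi(\mu\sqrt\tau).$$ The process $L$ is a nonnegative martingale on $(\Omega,\mathbf F,\mathbb P)$ with $L_0=1$, so that $\mathbb Q$ exists (by the Daniell–Kolmogorov extension theorem on this path space) and is unique. It is the local martingale component of the canonical pair associated with the time of maximum of $X$ over $[0,T)$. By Girsanov's theorem, under $\mathbb Q$ one has $dX_t=G_\mu(T-t,X^\uparrow_t-X_t)\,dt+dW^{\mathbb Q}_t$ for $t\in[0,T)$, with $W^{\mathbb Q}$ a standard Brownian motion on $(\Omega,\mathbf F,\mathbb Q)$. *)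

theory Defs
  imports "HOL-Probability.Probability"
begin

text \<open>Throughout, \<open>std_normal_density\<close> is the function \<open>\<phi>\<close>.\<close>

definition Phi_bar :: "real \<Rightarrow> real" where
  "Phi_bar x = (LINT y:{x..}|lborel. std_normal_density y)"

definition F_mu :: "real \<Rightarrow> real \<Rightarrow> real \<Rightarrow> real" where
  "F_mu \<mu> \<tau> z =
     exp (2 * \<mu> * z) * Phi_bar ((z + \<mu> * \<tau>) / sqrt \<tau>) + Phi_bar ((z - \<mu> * \<tau>) / sqrt \<tau>)"

text \<open>The second argument of \<open>F_mu\<close> ranges over the half-line, so the derivative at \<open>0\<close> is the
  right-hand one. The explicit formula is \<open>f_mu_eq\<close> below.\<close>

definition f_mu :: "real \<Rightarrow> real \<Rightarrow> real" where
  "f_mu \<mu> \<tau> = - vector_derivative (\<lambda>z. F_mu \<mu> \<tau> z) (at 0 within {0..})"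

definition G_mu :: "real \<Rightarrow> real \<Rightarrow> real \<Rightarrow> real" where
  "G_mu \<mu> \<tau> z = \<mu> +
     ((2 / sqrt \<tau>) * std_normal_density (z / sqrt \<tau> - \<mu> * sqrt \<tau>)
        - 2 * \<mu> * exp (2 * \<mu> * z) * Phi_bar (z / sqrt \<tau> + \<mu> * sqrt \<tau>))
     / (Phi_bar (z / sqrt \<tau> - \<mu> * sqrt \<tau>)
        + exp (2 * \<mu> * z) * Phi_bar (z / sqrt \<tau> + \<mu> * sqrt \<tau>))"

lemma Phi_bar_has_real_derivative:
  "(Phi_bar has_real_derivative - std_normal_density x) (at x within S)"
proof -
  have int: "set_integrable lborel A std_normal_density" if "A \<in> sets borel" for A
    unfolding set_integrable_def using that
    by (intro integrable_mult_indicator) (auto intro: integrable_normal_density)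
  have cont: "continuous_on A std_normal_density" for A
    unfolding std_normal_density_def by (intro continuous_intros) auto
  define a b where "a = x - 1" and "b = x + 1"
  have split: "Phi_bar y = Phi_bar a - integral {a..y} std_normal_density" if "y \<in> {a..b}" for y
  proof -
    have "Phi_bar a = (LINT u:{a..<y} \<union> {y..}|lborel. std_normal_density u)"
      unfolding Phi_bar_def using that by (intro arg_cong2[where f="set_lebesgue_integral lborel"]) auto
    also have "\<dots> = (LINT u:{a..<y}|lborel. std_normal_density u) + Phi_bar y"
      unfolding Phi_bar_def by (intro set_integral_Un int) auto
    also have "(LINT u:{a..<y}|lborel. std_normal_density u) =
        (LINT u:{a..y}|lborel. std_normal_density u)"
      unfolding set_lebesgue_integral_def
      by (intro integral_cong_AE) (use AE_lborel_singleton[of y] in \<open>auto simp: indicator_def\<close>)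
    also have "\<dots> = integral {a..y} std_normal_density"
      by (intro set_borel_integral_eq_integral(2) int) auto
    finally show ?thesis by simp
  qed
  have "((\<lambda>y. Phi_bar a - integral {a..y} std_normal_density) has_real_derivative
          0 - std_normal_density x) (at x within {a..b})"
    by (intro derivative_intros integral_has_real_derivative cont) (auto simp: a_def b_def)
  then have "(Phi_bar has_real_derivative - std_normal_density x) (at x within {a..b})"
    unfolding diff_0
    by (rule has_field_derivative_transform_within[where d=1, OF _ _ _ split[symmetric]])
       (auto simp: a_def b_def)
  moreover have "at x within {a..b} = at x"
    by (rule at_within_interior) (auto simp: a_def b_def)
  ultimately show ?thesis by (metis has_field_derivative_at_within)
qed

lemma f_mu_eq:
  assumes "0 < \<tau>"
  shows "f_mu \<mu> \<tau> =
    sqrt (2 / (pi * \<tau>)) * exp (- \<mu>\<^sup>2 * \<tau> / 2) - 2 * \<mu> * Phi_bar (\<mu> * sqrt \<tau>)"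
proof -
  define r where "r = sqrt \<tau>"
  have r: "0 < r" "\<tau> = r\<^sup>2" using assms by (auto simp: r_def)
  have even: "std_normal_density (- x) = std_normal_density x" for x
    by (simp add: std_normal_density_def)
  have F: "F_mu \<mu> \<tau> = (\<lambda>z. exp (2 * \<mu> * z) * Phi_bar (z / r + \<mu> * r) + Phi_bar (z / r - \<mu> * r))"
    using r by (simp add: fun_eq_iff F_mu_def r_def[symmetric] field_simps power2_eq_square)
  have nbot: "at (0::real) within {0..} \<noteq> bot"
    using at_le[of "{0<..}" "{0..}" "0::real"] trivial_limit_at_right_real[of "0::real"]
    by (auto simp: bot.extremum_unique subset_eq)
  have D: "((\<lambda>z. Phi_bar (z / r + c)) has_real_derivative - std_normal_density c / r)
      (at 0 within {0..})" for c
  proof -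
    have "((\<lambda>z. z / r + c) has_real_derivative 1 / r) (at 0 within {0..})"
      using r by (auto intro!: derivative_eq_intros)
    from DERIV_chain2[OF Phi_bar_has_real_derivative this] show ?thesis by simp
  qed
  have "(F_mu \<mu> \<tau> has_real_derivative
      2 * \<mu> * Phi_bar (\<mu> * r) - 2 * std_normal_density (\<mu> * r) / r) (at 0 within {0..})"
    unfolding F
    by (rule derivative_eq_intros D D[where c="- (\<mu> * r)", simplified] refl)+
       (simp add: even algebra_simps)
  then have "f_mu \<mu> \<tau> = - (2 * \<mu> * Phi_bar (\<mu> * r) - 2 * std_normal_density (\<mu> * r) / r)"
    unfolding f_mu_def
    by (intro arg_cong[where f=uminus] vector_derivative_within nbot)
       (simp add: has_real_derivative_iff_has_vector_derivative)
  moreover have "2 * std_normal_density (\<mu> * r) / r = sqrt (2 / (pi * \<tau>)) * exp (- \<mu>\<^sup>2 * \<tau> / 2)"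
    using r by (simp add: std_normal_density_def real_sqrt_mult real_sqrt_divide power_mult_distrib field_simps)
  ultimately show ?thesis by (simp add: r_def)
qed

definition path_space :: "real \<Rightarrow> (real \<Rightarrow> real) set" where
  "path_space T = {\<omega> \<in> extensional {0..<T}. continuous_on {0..<T} \<omega>}"

definition natural_filtration :: "real \<Rightarrow> real \<Rightarrow> (real \<Rightarrow> real) measure" where
  "natural_filtration T t =
     sigma (path_space T) {{\<omega> \<in> path_space T. \<omega> s \<in> B} | s B. s \<in> {0..t} \<and> B \<in> sets borel}"

definition right_augmentation :: "real \<Rightarrow> real \<Rightarrow> (real \<Rightarrow> real) measure" where
  "right_augmentation T t = sigma (path_space T) (\<Inter>s\<in>{t<..<T}. sets (natural_filtration T s))"

definition path_algebra :: "real \<Rightarrow> (real \<Rightarrow> real) measure" where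
  "path_algebra T = sigma (path_space T) (\<Union>t\<in>{0..<T}. sets (right_augmentation T t))"

text \<open>Only times in \<open>[0, T)\<close> matter; the filtration is continued by the full sigma-algebra because
  \<open>stopping_time\<close> quantifies over all real times. Stopping times take values in \<open>[0, T]\<close>.\<close>

definition path_filtration :: "real \<Rightarrow> real \<Rightarrow> (real \<Rightarrow> real) measure" where
  "path_filtration T t = (if t < T then right_augmentation T t else path_algebra T)"

definition running_max :: "real \<Rightarrow> (real \<Rightarrow> real) \<Rightarrow> real" where
  "running_max t \<omega> = (SUP s\<in>{0..t}. \<omega> s)"

definition drifted_brownian_law :: "real \<Rightarrow> real \<Rightarrow> (real \<Rightarrow> real) measure \<Rightarrow> bool" where
  "drifted_brownian_law T \<mu> P \<longleftrightarrow>
     prob_space P \<and> space P = path_space T \<and> sets P = sets (path_algebra T) \<and>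
     (AE \<omega> in P. \<omega> 0 = 0) \<and>
     (\<forall>s t. 0 \<le> s \<and> s < t \<and> t < T \<longrightarrow>
        distributed P lborel (\<lambda>\<omega>. \<omega> t - \<omega> s) (normal_density (\<mu> * (t - s)) (sqrt (t - s)))) \<and>
     (\<forall>(n::nat) u. 0 \<le> u 0 \<and> (\<forall>i<n. u i < u (Suc i)) \<and> u n < T \<longrightarrow>
        prob_space.indep_vars P (\<lambda>_. borel) (\<lambda>i \<omega>. \<omega> (u (Suc i)) - \<omega> (u i)) {..<n})"

text \<open>The Stieltjes integral over \<open>[0, t]\<close> is taken with respect to the measure generated by the
  running maximum, held constant outside \<open>[0, t]\<close>; in particular there is no atom at \<open>0\<close>.\<close>

definition L_proc :: "real \<Rightarrow> real \<Rightarrow> real \<Rightarrow> (real \<Rightarrow> real) \<Rightarrow> real" where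
  "L_proc T \<mu> t \<omega> =
     F_mu \<mu> (T - t) (running_max t \<omega> - \<omega> t) *
     exp (LINT s:{0..t}|interval_measure (\<lambda>s. running_max (max 0 (min s t)) \<omega>). f_mu \<mu> (T - s))"

definition submartingale_on ::
    "'a measure \<Rightarrow> (real \<Rightarrow> 'a measure) \<Rightarrow> real \<Rightarrow> (real \<Rightarrow> 'a \<Rightarrow> real) \<Rightarrow> bool" where
  "submartingale_on M F T Y \<longleftrightarrow>
     (\<forall>t\<in>{0..<T}. Y t \<in> borel_measurable (F t) \<and> integrable M (Y t)) \<and>
     (\<forall>s\<in>{0..<T}. \<forall>t\<in>{s..<T}. AE \<omega> in M. Y s \<omega> \<le> real_cond_exp M (F s) (Y t) \<omega>)"

definition local_submartingale_on ::
    "'a measure \<Rightarrow> (real \<Rightarrow> 'a measure) \<Rightarrow> real \<Rightarrow> (real \<Rightarrow> 'a \<Rightarrow> real) \<Rightarrow> bool" where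
  "local_submartingale_on M F T Y \<longleftrightarrow>
     (\<forall>t\<in>{0..<T}. Y t \<in> borel_measurable (F t)) \<and>
     (\<exists>\<sigma> :: nat \<Rightarrow> 'a \<Rightarrow> real.
        (\<forall>n. stopping_time F (\<sigma> n)) \<and>
        (\<forall>n. \<forall>\<omega>\<in>space M. 0 \<le> \<sigma> n \<omega> \<and> \<sigma> n \<omega> \<le> \<sigma> (Suc n) \<omega> \<and> \<sigma> n \<omega> \<le> T) \<and>
        (AE \<omega> in M. (\<lambda>n. \<sigma> n \<omega>) \<longlonglongrightarrow> T) \<and>
        (\<forall>n. submartingale_on M F T (\<lambda>t \<omega>. Y (min t (\<sigma> n \<omega>)) \<omega>)))"

end

theory Submission
  imports Defs "HOL-Real_Asymp.Real_Asymp"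
begin

text \<open>
  Girsanov's theorem is not needed. For the submartingale property, sample the path after time \<open>s\<close> on a
  grid of \<open>[s, t]\<close> and replace the density \<open>L_t\<close> by its analogue for the sampled path. After the exponential
  tilt that removes the drift, this discretised density is nondecreasing in every single increment, so that its
  product with an increment, which is a centred Gaussian independent of everything else, has nonnegative
  expectation. Summing over the grid and refining it yields \<open>E[L_t (X_t - X_s); A] \<ge> 0\<close>; passage to the limit
  is justified by exponential moments of the running maximum.

  For the behaviour at \<open>T\<close>: on the event that the drawdown stays above \<open>w > 0\<close> on \<open>[u, t]\<close> the running maximum is
  constant there, hence \<open>L_t\<close> is at most \<open>F_mu \<mu> (T - t) w\<close> times a factor that depends on the path up to \<open>u\<close>
  only, and \<open>F_mu \<mu> \<tau> w\<close> tends to \<open>0\<close> with \<open>\<tau>\<close>.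
\<close>

section \<open>Gaussian tails and the functions F, f and G\<close>

text \<open>The sign of the drift enters only through \<open>F_mu_dz_le\<close>: it makes
  \<open>exp (- \<mu> * z) * F_mu \<mu> \<tau> z\<close> nonincreasing in \<open>z\<close>, and its
  case \<open>z = 0\<close> gives \<open>0 \<le> f_mu \<mu> \<tau> + \<mu>\<close>. In this
  integrated form it can be tested on a sampled path by varying one increment. Nothing is claimed
  about the mean of the sampled density: only a sign is kept along the discretisation, and a sign
  survives the limit. Sampling begins at \<open>s\<close> and not at \<open>0\<close>, so that the
  conditioning event and the density accumulated up to \<open>s\<close> depend on the past alone and
  stay fixed while a later increment is varied. Independence of increments speaks about the natural
  filtration; its right-continuous augmentation is reached by letting the starting time decrease to
  \<open>s\<close>. Varying one increment in the middle of the path requires its independence of the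
  past and the future together, which is why the sigma-algebra of the path outside one cell is
  introduced.\<close>

lemma Phi_bar_tendsto_0: "(Phi_bar \<longlongrightarrow> 0) at_top"
proof -
  have int: "integrable lborel std_normal_density" by (rule integrable_normal_density) simp
  have "((\<lambda>x. LINT y|lborel. indicator {x..} y *\<^sub>R std_normal_density y) \<longlongrightarrow> (LINT (y::real)|lborel. (0::real))) at_top"
  proof (rule integral_dominated_convergence_at_top[where w="\<lambda>y. norm (std_normal_density y)"])
    show "AE y in lborel. ((\<lambda>x. indicator {x..} y *\<^sub>R std_normal_density y) \<longlongrightarrow> 0) at_top"
    proof (intro AE_I2)
      fix y :: real
      have "\<forall>\<^sub>F x in at_top. indicator {x..} y *\<^sub>R std_normal_density y = 0"
        using eventually_gt_at_top[of y] by eventually_elim auto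
      then show "((\<lambda>x. indicator {x..} y *\<^sub>R std_normal_density y) \<longlongrightarrow> 0) at_top"
        by (rule tendsto_eventually)
    qed
  qed (use int in \<open>auto simp: indicator_def\<close>)
  then show ?thesis unfolding Phi_bar_def set_lebesgue_integral_def by simp
qed

lemma Phi_bar_strict_antimono: "x < y \<Longrightarrow> Phi_bar y < Phi_bar x"
  by (rule DERIV_neg_imp_decreasing_open[where f=Phi_bar])
     (auto intro!: exI[of _ "- std_normal_density _"] Phi_bar_has_real_derivative normal_density_pos
       continuous_at_imp_continuous_on DERIV_isCont)

lemma Phi_bar_pos: "0 < Phi_bar x"
proof -
  have "0 \<le> Phi_bar (x + 1)"
    unfolding Phi_bar_def set_lebesgue_integral_def by (intro integral_nonneg_AE) auto
  then show ?thesis using Phi_bar_strict_antimono[of x "x + 1"] by simp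
qed

lemma Phi_bar_continuous: "isCont Phi_bar x"
  using Phi_bar_has_real_derivative DERIV_isCont by blast

lemma Phi_bar_measurable [measurable]: "Phi_bar \<in> borel_measurable borel"
  by (intro borel_measurable_continuous_onI continuous_at_imp_continuous_on ballI Phi_bar_continuous)

lemma std_normal_density_deriv:
  "(std_normal_density has_real_derivative - x * std_normal_density x) (at x)"
  unfolding std_normal_density_def
  by (rule derivative_eq_intros refl | simp)+

text \<open>For positive arguments the gap \<open>std_normal_density y / y - Phi_bar y\<close> has
  derivative \<open>- std_normal_density y / y^2\<close> and tends to \<open>0\<close> at infinity,
  so it is nonnegative. This Mills ratio bound is the source of all sign and growth estimates for
  \<open>G_mu\<close>.\<close>

lemma Phi_bar_mills: "x * Phi_bar x \<le> std_normal_density x"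
proof (cases "x \<le> 0")
  case True
  then have "x * Phi_bar x \<le> 0" using Phi_bar_pos[of x] by (simp add: mult_le_0_iff)
  then show ?thesis using normal_density_nonneg[of 0 1 x] by linarith
next
  case False
  define k where "k y = std_normal_density y / y - Phi_bar y" for y
  have "(k \<longlongrightarrow> 0) at_top"
  proof -
    have "((\<lambda>y. std_normal_density y / y) \<longlongrightarrow> 0) at_top"
    proof (rule Lim_null_comparison)
      show "((\<lambda>y::real. 1 / y) \<longlongrightarrow> 0) at_top" by real_asymp
      show "\<forall>\<^sub>F y in at_top. norm (std_normal_density y / y) \<le> 1 / y"
        using eventually_gt_at_top[of 0]
      proof eventually_elim
        case (elim y)
        have "exp (- y\<^sup>2 / 2) \<le> 1" "1 \<le> sqrt (2 * pi)" using pi_gt3 by auto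
        then have "exp (- y\<^sup>2 / 2) \<le> sqrt (2 * pi)" by linarith
        then have "std_normal_density y \<le> 1" unfolding std_normal_density_def
          by (simp add: divide_simps)
        then show ?case using elim by (auto simp: divide_right_mono)
      qed
    qed
    then show ?thesis unfolding k_def using tendsto_diff[OF _ Phi_bar_tendsto_0] by fastforce
  qed
  moreover have "k y \<le> k x" if "x \<le> y" for y
  proof (rule DERIV_nonpos_imp_nonincreasing[OF that])
    fix u assume u: "x \<le> u" "u \<le> y"
    have "(k has_real_derivative - std_normal_density u / u\<^sup>2) (at u)"
      unfolding k_def using u False
      by (auto intro!: derivative_eq_intros std_normal_density_deriv Phi_bar_has_real_derivative
        simp: field_simps power2_eq_square)
    then show "\<exists>d. (k has_real_derivative d) (at u) \<and> d \<le> 0" by (auto intro!: exI)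
  qed
  ultimately have "0 \<le> k x"
    by (intro tendsto_upperbound[of k 0 at_top]) (auto simp: eventually_at_top_linorder)
  then show ?thesis using False by (simp add: k_def field_simps)
qed

lemma std_normal_density_minus: "std_normal_density (- x) = std_normal_density x"
  by (simp add: std_normal_density_def)

text \<open>The sum has derivative \<open>0\<close> because the density is even, and its constant
  value is read off at infinity. It normalises \<open>F_mu \<mu> \<tau> 0\<close> to
  \<open>1\<close>.\<close>

lemma Phi_bar_add_reflect: "Phi_bar x + Phi_bar (- x) = 1"
proof -
  have D: "((\<lambda>x. Phi_bar x + Phi_bar (- x)) has_real_derivative 0) (at u)" for u
  proof -
    have "((\<lambda>x. Phi_bar (- x)) has_real_derivative - std_normal_density (- u) * (-1)) (at u)"
      by (rule DERIV_chain2[OF Phi_bar_has_real_derivative]) (auto intro!: derivative_eq_intros)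
    then show ?thesis
      using DERIV_add[OF Phi_bar_has_real_derivative[of u UNIV]] std_normal_density_minus[of u] by fastforce
  qed
  have "((\<lambda>x. Phi_bar (- x)) \<longlongrightarrow> 1) at_top"
  proof -
    have int: "integrable lborel std_normal_density" by (rule integrable_normal_density) simp
    have "((\<lambda>x. LINT y|lborel. indicator {-x..} y *\<^sub>R std_normal_density y) \<longlongrightarrow> (LINT y|lborel. std_normal_density y)) at_top"
    proof (rule integral_dominated_convergence_at_top[where w="\<lambda>y. norm (std_normal_density y)"])
      show "AE y in lborel. ((\<lambda>x. indicator {-x..} y *\<^sub>R std_normal_density y) \<longlongrightarrow> std_normal_density y) at_top"
      proof (intro AE_I2)
        fix y :: real
        have "\<forall>\<^sub>F x in at_top. indicator {-x..} y *\<^sub>R std_normal_density y = std_normal_density y"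
          using eventually_gt_at_top[of "-y"] by eventually_elim auto
        then show "((\<lambda>x. indicator {-x..} y *\<^sub>R std_normal_density y) \<longlongrightarrow> std_normal_density y) at_top"
          by (rule tendsto_eventually)
      qed
    qed (use int in \<open>auto simp: indicator_def\<close>)
    then show ?thesis unfolding Phi_bar_def set_lebesgue_integral_def by simp
  qed
  from tendsto_add[OF Phi_bar_tendsto_0 this]
  have "((\<lambda>x. Phi_bar x + Phi_bar (- x)) \<longlongrightarrow> 1) at_top" by simp
  moreover have "(\<lambda>y. Phi_bar y + Phi_bar (- y)) = (\<lambda>y. Phi_bar x + Phi_bar (- x))"
    using DERIV_isconst_all[of "\<lambda>x. Phi_bar x + Phi_bar (- x)"] D by blast
  ultimately show ?thesis by (simp add: tendsto_const_iff)
qed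

section \<open>The function F and its derivative in the space variable\<close>

lemma F_mu_alt:
  assumes "0 < \<tau>"
  shows "F_mu \<mu> \<tau> z = Phi_bar (z / sqrt \<tau> - \<mu> * sqrt \<tau>)
     + exp (2 * \<mu> * z) * Phi_bar (z / sqrt \<tau> + \<mu> * sqrt \<tau>)"
proof -
  have "(z + \<mu> * \<tau>) / sqrt \<tau> = z / sqrt \<tau> + \<mu> * sqrt \<tau>" "(z - \<mu> * \<tau>) / sqrt \<tau> = z / sqrt \<tau> - \<mu> * sqrt \<tau>"
    using assms by (auto simp: add_divide_distrib diff_divide_distrib real_div_sqrt mult.commute
      simp flip: times_divide_eq_right)
  then show ?thesis by (simp add: F_mu_def)
qed

lemma F_mu_pos: "0 < F_mu \<mu> \<tau> z"
  by (auto simp: F_mu_def intro!: add_pos_pos mult_pos_pos Phi_bar_pos)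

lemma F_mu_measurable [measurable]: "F_mu \<mu> \<tau> \<in> borel_measurable borel"
  unfolding F_mu_def by measurable

lemma F_mu_0: assumes "0 < \<tau>" shows "F_mu \<mu> \<tau> 0 = 1"
  using Phi_bar_add_reflect[of "\<mu> * sqrt \<tau>"] by (simp add: F_mu_alt[OF assms])

text \<open>The two squared arguments differ by \<open>4 * \<mu> * z\<close>. Because of this, both
  tails in \<open>F_mu\<close> contribute the same Gaussian term to the derivative, and the Mills
  bounds for the two tails share one common factor.\<close>

lemma exp_std_normal_density_shift:
  assumes "0 < \<tau>"
  shows "exp (2 * \<mu> * z) * std_normal_density (z / sqrt \<tau> + \<mu> * sqrt \<tau>) =
    std_normal_density (z / sqrt \<tau> - \<mu> * sqrt \<tau>)"
proof -
  define r where "r = sqrt \<tau>"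
  have r: "0 < r" using assms by (simp add: r_def)
  have "2 * \<mu> * z + - (z / r + \<mu> * r)\<^sup>2 / 2 = - (z / r - \<mu> * r)\<^sup>2 / 2"
    using r by (simp add: power2_eq_square field_simps)
  then show ?thesis unfolding r_def[symmetric] std_normal_density_def
    by (simp add: exp_add[symmetric])
qed

text \<open>Up to sign this is the numerator of the fraction in \<open>G_mu\<close>, and at
  \<open>z = 0\<close> it is \<open>f_mu\<close> up to sign, so that one estimate serves both
  functions.\<close>

definition F_mu_dz :: "real \<Rightarrow> real \<Rightarrow> real \<Rightarrow> real" where
  "F_mu_dz \<mu> \<tau> z = 2 * \<mu> * exp (2 * \<mu> * z) * Phi_bar (z / sqrt \<tau> + \<mu> * sqrt \<tau>)
      - (2 / sqrt \<tau>) * std_normal_density (z / sqrt \<tau> - \<mu> * sqrt \<tau>)"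

lemma F_mu_has_derivative:
  assumes "0 < \<tau>"
  shows "(F_mu \<mu> \<tau> has_real_derivative F_mu_dz \<mu> \<tau> z) (at z)"
proof -
  define r where "r = sqrt \<tau>"
  have r: "0 < r" using assms by (simp add: r_def)
  have D: "((\<lambda>z. Phi_bar (z / r + c)) has_real_derivative - std_normal_density (z / r + c) / r) (at z)" for c
  proof -
    have "((\<lambda>z. z / r + c) has_real_derivative 1 / r) (at z)"
      using r by (auto intro!: derivative_eq_intros)
    from DERIV_chain2[OF Phi_bar_has_real_derivative this] show ?thesis by simp
  qed
  have F: "F_mu \<mu> \<tau> = (\<lambda>z. exp (2 * \<mu> * z) * Phi_bar (z / r + \<mu> * r) + Phi_bar (z / r + - (\<mu> * r)))"
    by (auto simp: F_mu_alt[OF assms] r_def)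
  have E: "exp (2 * \<mu> * z) * (std_normal_density (z / r + \<mu> * r) / r) = std_normal_density (z / r - \<mu> * r) / r"
    using exp_std_normal_density_shift[OF assms, of \<mu> z] by (simp add: r_def)
  show ?thesis unfolding F
    by (rule derivative_eq_intros D refl)+
      (use E[symmetric] in \<open>simp add: F_mu_dz_def r_def[symmetric] algebra_simps\<close>)
qed

lemma G_mu_alt:
  assumes "0 < \<tau>"
  shows "G_mu \<mu> \<tau> z = \<mu> - F_mu_dz \<mu> \<tau> z / F_mu \<mu> \<tau> z"
  by (simp add: G_mu_def F_mu_dz_def F_mu_alt[OF assms] minus_divide_left)

text \<open>For \<open>\<mu> \<le> 0\<close> both terms have the right sign. For
  \<open>\<mu> > 0\<close>, the factor \<open>\<mu> * sqrt \<tau>\<close> is at most the argument of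
  the tail, so the Mills bound applies and the exponential shift turns it into the competing density
  term.\<close>

lemma F_mu_dz_nonpos:
  assumes "0 < \<tau>" "0 \<le> z"
  shows "F_mu_dz \<mu> \<tau> z \<le> 0"
proof (cases "\<mu> \<le> 0")
  case True
  have "2 * \<mu> * exp (2 * \<mu> * z) * Phi_bar (z / sqrt \<tau> + \<mu> * sqrt \<tau>) \<le> 0"
    using True Phi_bar_pos[of "z / sqrt \<tau> + \<mu> * sqrt \<tau>"]
    by (simp add: mult_le_0_iff zero_le_mult_iff)
  moreover have "0 \<le> (2 / sqrt \<tau>) * std_normal_density (z / sqrt \<tau> - \<mu> * sqrt \<tau>)" using assms by simp
  ultimately show ?thesis unfolding F_mu_dz_def by linarith
next
  case False
  define r a where "r = sqrt \<tau>" "a = z / r + \<mu> * r"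
  have r: "0 < r" using assms by (simp add: r_a_def)
  have "(\<mu> * r) * Phi_bar a \<le> a * Phi_bar a"
    using assms r Phi_bar_pos[of a] by (intro mult_right_mono) (auto simp: r_a_def)
  also have "\<dots> \<le> std_normal_density a" by (rule Phi_bar_mills)
  finally have "exp (2 * \<mu> * z) * (\<mu> * r * Phi_bar a) \<le> exp (2 * \<mu> * z) * std_normal_density a"
    by (intro mult_left_mono) auto
  also have "\<dots> = std_normal_density (z / r - \<mu> * r)"
    using exp_std_normal_density_shift[OF assms(1), of \<mu> z] by (simp add: r_a_def)
  finally show ?thesis unfolding F_mu_dz_def r_a_def(1)[symmetric]
    using r by (simp add: field_simps r_a_def(2))
qed

text \<open>Dividing by \<open>F_mu\<close> shows that this is the nonnegativity of
  \<open>G_mu\<close>. Only \<open>\<mu> < 0\<close> needs work: there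
  \<open>- \<mu> * sqrt \<tau>\<close> is at most \<open>b\<close>, and the Mills bound at
  \<open>b\<close> controls \<open>- \<mu> * Phi_bar b\<close>, with a factor 2 to spare.\<close>

lemma F_mu_dz_le:
  assumes "0 < \<tau>" "0 \<le> z"
  shows "F_mu_dz \<mu> \<tau> z \<le> \<mu> * F_mu \<mu> \<tau> z"
proof (cases "\<mu> \<ge> 0")
  case True
  then show ?thesis using F_mu_dz_nonpos[OF assms, of \<mu>] F_mu_pos[of \<mu> \<tau> z]
    by (smt (verit) mult_nonneg_nonneg)
next
  case False
  define r b a where "r = sqrt \<tau>" "b = z / r - \<mu> * r" "a = z / r + \<mu> * r"
  have r: "0 < r" using assms by (simp add: r_b_a_def)
  have "(- \<mu> * r) * Phi_bar b \<le> b * Phi_bar b"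
    using assms r Phi_bar_pos[of b] by (intro mult_right_mono) (auto simp: r_b_a_def)
  also have "\<dots> \<le> 2 * std_normal_density b"
    using Phi_bar_mills[of b] normal_density_nonneg[of 0 1 b] by linarith
  finally have 1: "- \<mu> * Phi_bar b \<le> (2 / r) * std_normal_density b"
    using r by (simp add: field_simps)
  have 2: "\<mu> * exp (2 * \<mu> * z) * Phi_bar a \<le> 0"
    using False Phi_bar_pos[of a] by (simp add: mult_le_0_iff zero_le_mult_iff)
  show ?thesis unfolding F_mu_dz_def F_mu_alt[OF assms(1)] r_b_a_def(1)[symmetric]
    r_b_a_def(2,3)[symmetric] using 1 2 by (simp add: algebra_simps)
qed

section \<open>Sign and growth of the drift G\<close>

lemma G_mu_nonneg:
  assumes "0 < \<tau>" "0 \<le> z"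
  shows "0 \<le> G_mu \<mu> \<tau> z"
  using F_mu_dz_le[OF assms, of \<mu>] F_mu_pos[of \<mu> \<tau> z]
  by (simp add: G_mu_alt[OF assms(1)] field_simps)

text \<open>The condition on \<open>z\<close> makes both tail arguments positive, so that both tails
  can be replaced by their Mills bounds. The density value \<open>p\<close> then cancels from
  numerator and denominator, leaving a rational function of \<open>z\<close> and
  \<open>\<tau>\<close>. The resulting bound increases with \<open>z\<close>, which makes it uniform
  over \<open>z \<ge> w\<close>.\<close>

lemma G_mu_lower_bound:
  assumes "0 < \<tau>" "\<bar>\<mu>\<bar> * \<tau> < z"
  shows "z - \<bar>\<mu>\<bar> * \<tau> - \<mu>\<^sup>2 * \<tau>\<^sup>2 / z \<le> \<tau> * G_mu \<mu> \<tau> z"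
proof -
  define r b a where "r = sqrt \<tau>" "b = z / r - \<mu> * r" "a = z / r + \<mu> * r"
  have r: "0 < r" "\<tau> = r\<^sup>2" using assms by (auto simp: r_b_a_def)
  have "0 \<le> \<bar>\<mu> * \<tau>\<bar>" "\<bar>\<mu> * \<tau>\<bar> < z" using assms by (auto simp: abs_mult)
  then have z: "0 < z" and "\<mu> * \<tau> < z" "- (\<mu> * \<tau>) < z" by linarith+
  then have ab: "0 < a" "0 < b" "a * r = z + \<mu> * \<tau>" "b * r = z - \<mu> * \<tau>"
    using r by (auto simp: r_b_a_def(2,3) field_simps power2_eq_square)
  define p where "p = std_normal_density b"
  have p: "0 < p" by (simp add: p_def normal_density_pos)
  have B: "Phi_bar b \<le> p / b"
    using Phi_bar_mills[of b] ab by (simp add: p_def field_simps)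
  have "exp (2 * \<mu> * z) * (a * Phi_bar a) \<le> exp (2 * \<mu> * z) * std_normal_density a"
    by (intro mult_left_mono Phi_bar_mills) auto
  also have "\<dots> = p"
    using exp_std_normal_density_shift[OF assms(1), of \<mu> z] by (simp add: r_b_a_def p_def)
  finally have A: "exp (2 * \<mu> * z) * Phi_bar a \<le> p / a" using ab by (simp add: field_simps)
  have F: "F_mu \<mu> \<tau> z \<le> p / b + p / a"
    unfolding F_mu_alt[OF assms(1)] r_b_a_def(1)[symmetric] r_b_a_def(2,3)[symmetric]
    using A B by simp
  \<comment> \<open>An upper bound on the tail yields a lower bound on the numerator only for a
    nonnegative coefficient, so \<open>\<mu>\<close> is first replaced by its positive part.\<close>
  define m where "m = max 0 \<mu>"
  have m: "0 \<le> m" "\<mu> \<le> m" "m \<le> \<bar>\<mu>\<bar>" by (auto simp: m_def)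
  have "\<mu> * (exp (2 * \<mu> * z) * Phi_bar a) \<le> m * (exp (2 * \<mu> * z) * Phi_bar a)"
    using m Phi_bar_pos[of a] by (intro mult_right_mono) auto
  also have "\<dots> \<le> m * (p / a)" using A m by (intro mult_left_mono) auto
  finally have "2 * (\<mu> * (exp (2 * \<mu> * z) * Phi_bar a)) \<le> 2 * (m * (p / a))" by linarith
  then have N: "2 * p / r - 2 * m * (p / a) \<le> - F_mu_dz \<mu> \<tau> z"
    unfolding F_mu_dz_def r_b_a_def(1)[symmetric] r_b_a_def(2,3)[symmetric]
    by (simp add: p_def algebra_simps)
  \<comment> \<open>Needed for the sign of the simplified numerator: enlarging the denominator
    decreases the quotient only if the numerator is nonnegative.\<close>
  have mr: "m * r \<le> a"
  proof -
    have "m * \<tau> \<le> z + \<mu> * \<tau>" using \<open>- (\<mu> * \<tau>) < z\<close> z by (auto simp: m_def max_def)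
    then show ?thesis using ab r by (metis mult.assoc mult_right_le_imp_le power2_eq_square)
  qed
  have num: "0 \<le> 2 * p / r - 2 * m * (p / a)"
  proof -
    have "2 * p / r - 2 * m * (p / a) = 2 * p * (a - m * r) / (a * r)"
      using r(1) ab(1) by (simp add: field_simps)
    then show ?thesis using mr p r ab(1) by simp
  qed
  have "(2 * p / r - 2 * m * (p / a)) / (p / b + p / a) \<le> - F_mu_dz \<mu> \<tau> z / F_mu \<mu> \<tau> z"
    using N F num F_mu_pos[of \<mu> \<tau> z] by (intro frac_le) auto
  also have "(2 * p / r - 2 * m * (p / a)) / (p / b + p / a) = 2 * b * (a - m * r) / (r * (a + b))"
  proof -
    have "2 * p / r - 2 * m * (p / a) = 2 * p * (a - m * r) / (a * r)"
      using r(1) ab(1) by (simp add: field_simps)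
    moreover have "p / b + p / a = p * (a + b) / (a * b)" using ab(1,2) by (simp add: field_simps)
    ultimately show ?thesis using p r(1) ab(1,2) by simp
  qed
  also have "\<dots> = (b * r) * (a * r - m * \<tau>) / (\<tau> * z)"
  proof -
    have "a + b = 2 * z / r" by (simp add: r_b_a_def(2,3))
    then have "r * (a + b) = 2 * z" using r by simp
    moreover have "(b * r) * (a * r - m * \<tau>) / (\<tau> * z) = b * (a - m * r) / z"
    proof -
      have "(b * r) * (a * r - m * \<tau>) = \<tau> * (b * (a - m * r))"
        by (simp add: r(2) power2_eq_square algebra_simps)
      then show ?thesis using assms(1) by (simp only: mult_divide_mult_cancel_left)
    qed
    ultimately show ?thesis by simp
  qed
  finally have "\<mu> + (z - \<mu> * \<tau>) * (z + \<mu> * \<tau> - m * \<tau>) / (\<tau> * z) \<le> G_mu \<mu> \<tau> z"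
    unfolding G_mu_alt[OF assms(1)] ab by simp
  then have "\<tau> * (\<mu> + (z - \<mu> * \<tau>) * (z + \<mu> * \<tau> - m * \<tau>) / (\<tau> * z)) \<le> \<tau> * G_mu \<mu> \<tau> z"
    using assms by (intro mult_left_mono) auto
  also have "\<tau> * (\<mu> + (z - \<mu> * \<tau>) * (z + \<mu> * \<tau> - m * \<tau>) / (\<tau> * z)) =
    \<mu> * \<tau> + (z - \<mu> * \<tau>) * (z + \<mu> * \<tau> - m * \<tau>) / z"
    using assms z by (simp add: field_simps)
  also have "\<dots> = \<mu> * \<tau> + z - m * \<tau> - \<mu>\<^sup>2 * \<tau>\<^sup>2 / z + \<mu> * m * \<tau>\<^sup>2 / z"
    using z by (simp add: field_simps power2_eq_square)
  finally have *: "\<mu> * \<tau> + z - m * \<tau> - \<mu>\<^sup>2 * \<tau>\<^sup>2 / z + \<mu> * m * \<tau>\<^sup>2 / z \<le> \<tau> * G_mu \<mu> \<tau> z" .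
  have "0 \<le> \<mu> * m" by (auto simp: m_def max_def)
  then have "0 \<le> \<mu> * m * \<tau>\<^sup>2 / z" using z by auto
  moreover have "- \<bar>\<mu>\<bar> * \<tau> \<le> (\<mu> - m) * \<tau>" using assms by (intro mult_right_mono) (auto simp: m_def max_def)
  ultimately show ?thesis using * by (simp add: algebra_simps)
qed

text \<open>The lower bound at \<open>z \<ge> w\<close> is at least its value
  \<open>k \<tau>\<close> at \<open>z = w\<close>, and \<open>k \<tau>\<close> tends to
  \<open>w\<close>.\<close>

lemma G_mu_Liminf:
  assumes "0 < w"
  shows "ereal w \<le> Liminf (at_right 0) (\<lambda>\<tau>. INF z\<in>{w..}. ereal (\<tau> * G_mu \<mu> \<tau> z))"
proof -
  define k where "k \<tau> = w - \<bar>\<mu>\<bar> * \<tau> - \<mu>\<^sup>2 * \<tau>\<^sup>2 / w" for \<tau>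
  have "(k \<longlongrightarrow> w - \<bar>\<mu>\<bar> * 0 - \<mu>\<^sup>2 * 0\<^sup>2 / w) (at_right 0)"
    unfolding k_def using assms by (intro tendsto_intros) auto
  then have "((\<lambda>\<tau>. ereal (k \<tau>)) \<longlongrightarrow> ereal w) (at_right 0)" by simp
  then have "ereal w = Liminf (at_right 0) (\<lambda>\<tau>. ereal (k \<tau>))"
    by (intro lim_imp_Liminf[symmetric]) auto
  also have "\<dots> \<le> Liminf (at_right 0) (\<lambda>\<tau>. INF z\<in>{w..}. ereal (\<tau> * G_mu \<mu> \<tau> z))"
  proof (rule Liminf_mono)
    have "((\<lambda>\<tau>. \<bar>\<mu>\<bar> * \<tau>) \<longlongrightarrow> \<bar>\<mu>\<bar> * 0) (at_right 0)" by (intro tendsto_intros)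
    then have "\<forall>\<^sub>F \<tau> in at_right 0. \<bar>\<mu>\<bar> * \<tau> < w" using assms by (auto dest: order_tendstoD)
    then show "\<forall>\<^sub>F \<tau> in at_right 0. ereal (k \<tau>) \<le> (INF z\<in>{w..}. ereal (\<tau> * G_mu \<mu> \<tau> z))"
      using eventually_at_right_less[of 0]
    proof eventually_elim
      case (elim \<tau>)
      show ?case
      proof (rule INF_greatest)
        fix z assume "z \<in> {w..}"
        then have z: "w \<le> z" by simp
        have "k \<tau> \<le> z - \<bar>\<mu>\<bar> * \<tau> - \<mu>\<^sup>2 * \<tau>\<^sup>2 / z"
          unfolding k_def using z assms by (intro diff_mono) (auto intro!: divide_left_mono)
        also have "\<dots> \<le> \<tau> * G_mu \<mu> \<tau> z"
          using elim z by (intro G_mu_lower_bound) auto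
        finally show "ereal (k \<tau>) \<le> ereal (\<tau> * G_mu \<mu> \<tau> z)" by simp
      qed
    qed
  qed
  finally show ?thesis .
qed

section \<open>Monotonicity and limits of F and f\<close>

lemma F_mu_antimono:
  assumes "0 < \<tau>" "0 \<le> x" "x \<le> y"
  shows "F_mu \<mu> \<tau> y \<le> F_mu \<mu> \<tau> x"
proof (rule DERIV_nonpos_imp_nonincreasing[OF assms(3)])
  fix u assume "x \<le> u" "u \<le> y"
  then show "\<exists>d. (F_mu \<mu> \<tau> has_real_derivative d) (at u) \<and> d \<le> 0"
    using F_mu_has_derivative[OF assms(1)] F_mu_dz_nonpos[OF assms(1), of u] assms by fastforce
qed

lemma F_mu_le_1: "0 < \<tau> \<Longrightarrow> 0 \<le> z \<Longrightarrow> F_mu \<mu> \<tau> z \<le> 1"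
  using F_mu_antimono[of \<tau> 0 z \<mu>] by (simp add: F_mu_0)

text \<open>The derivative equals \<open>- exp (- \<mu> * u) * F_mu \<mu> \<tau> u * G_mu \<mu>
  \<tau> u\<close>, so this is the nonnegativity of \<open>G_mu\<close> in integrated form.\<close>

lemma exp_F_mu_antimono:
  assumes "0 < \<tau>" "0 \<le> x" "x \<le> y"
  shows "exp (- \<mu> * y) * F_mu \<mu> \<tau> y \<le> exp (- \<mu> * x) * F_mu \<mu> \<tau> x"
proof (rule DERIV_nonpos_imp_nonincreasing[OF assms(3)])
  fix u assume u: "x \<le> u" "u \<le> y"
  have "((\<lambda>u. exp (- \<mu> * u) * F_mu \<mu> \<tau> u) has_real_derivative
     exp (- \<mu> * u) * (F_mu_dz \<mu> \<tau> u - \<mu> * F_mu \<mu> \<tau> u)) (at u)"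
    by (auto intro!: derivative_eq_intros F_mu_has_derivative assms simp: algebra_simps)
  moreover have "exp (- \<mu> * u) * (F_mu_dz \<mu> \<tau> u - \<mu> * F_mu \<mu> \<tau> u) \<le> 0"
    using F_mu_dz_le[OF assms(1), of u \<mu>] u assms by (simp add: mult_le_0_iff)
  ultimately show "\<exists>d. ((\<lambda>u. exp (- \<mu> * u) * F_mu \<mu> \<tau> u) has_real_derivative d) (at u) \<and> d \<le> 0"
    by blast
qed

text \<open>Both tail arguments grow like \<open>w / sqrt \<tau>\<close>, while the exponential
  prefactor does not depend on \<open>\<tau>\<close>.\<close>

lemma F_mu_tendsto_0:
  assumes "0 < w"
  shows "((\<lambda>\<tau>. F_mu \<mu> \<tau> w) \<longlongrightarrow> 0) (at_right 0)"
proof -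
  have "filterlim (\<lambda>\<tau>. (w + \<mu> * \<tau>) / sqrt \<tau>) at_top (at_right 0)"
       "filterlim (\<lambda>\<tau>. (w - \<mu> * \<tau>) / sqrt \<tau>) at_top (at_right 0)"
    using assms by real_asymp+
  from this[THEN filterlim_compose[OF Phi_bar_tendsto_0]] show ?thesis
    unfolding F_mu_def by (auto intro!: tendsto_eq_intros)
qed

lemma f_mu_alt:
  assumes "0 < \<tau>"
  shows "f_mu \<mu> \<tau> = - F_mu_dz \<mu> \<tau> 0"
proof -
  have "std_normal_density (- (\<mu> * sqrt \<tau>)) * (2 / sqrt \<tau>) = sqrt (2 / (pi * \<tau>)) * exp (- \<mu>\<^sup>2 * \<tau> / 2)"
    using assms by (simp add: std_normal_density_def real_sqrt_mult real_sqrt_divide power_mult_distrib field_simps)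
  then show ?thesis by (simp add: f_mu_eq[OF assms] F_mu_dz_def mult.commute)
qed

lemma f_mu_nonneg: "0 < \<tau> \<Longrightarrow> 0 \<le> f_mu \<mu> \<tau>"
  using F_mu_dz_nonpos[of \<tau> 0 \<mu>] by (simp add: f_mu_alt)

lemma f_mu_add_nonneg: "0 < \<tau> \<Longrightarrow> 0 \<le> f_mu \<mu> \<tau> + \<mu>"
  using F_mu_dz_le[of \<tau> 0 \<mu>] by (simp add: f_mu_alt F_mu_0)

text \<open>The derivative of the density factor cancels against the derivative of the tail; only
  the derivative of \<open>2 / sqrt \<tau>\<close> remains.\<close>

lemma f_mu_has_derivative:
  assumes "0 < \<tau>"
  shows "(f_mu \<mu> has_real_derivative - std_normal_density (\<mu> * sqrt \<tau>) / (\<tau> * sqrt \<tau>)) (at \<tau>)"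
proof -
  define k where "k \<tau> = (2 / sqrt \<tau>) * std_normal_density (\<mu> * sqrt \<tau>) - 2 * \<mu> * Phi_bar (\<mu> * sqrt \<tau>)" for \<tau>
  have fk: "f_mu \<mu> x = k x" if "0 < x" for x
    using that by (simp add: f_mu_alt F_mu_dz_def k_def std_normal_density_minus)
  have ds: "((\<lambda>x. \<mu> * sqrt x) has_real_derivative \<mu> / (2 * sqrt \<tau>)) (at \<tau>)"
    using assms by (auto intro!: derivative_eq_intros simp: field_simps)
  note D1 = DERIV_chain2[OF std_normal_density_deriv ds]
  note D2 = DERIV_chain2[OF Phi_bar_has_real_derivative ds]
  have D3: "((\<lambda>x. 2 / sqrt x) has_real_derivative - 1 / (\<tau> * sqrt \<tau>)) (at \<tau>)"
    using assms by (auto intro!: derivative_eq_intros simp: field_simps)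
  have "(k has_real_derivative - std_normal_density (\<mu> * sqrt \<tau>) / (\<tau> * sqrt \<tau>)) (at \<tau>)"
    unfolding k_def
    by (rule derivative_eq_intros D1 D2 D3 refl)+
       (use assms in \<open>simp add: field_simps\<close>)
  then show ?thesis
    by (rule has_field_derivative_transform_within_open[where S="{0<..}"]) (use assms fk in auto)
qed

text \<open>Consequently the weight \<open>f_mu \<mu> (T - s)\<close> is nondecreasing in
  \<open>s\<close>: on \<open>[0, t]\<close> it is at most \<open>f_mu \<mu> (T - t)\<close>, and
  summation by parts against it has a definite sign.\<close>

lemma f_mu_antimono:
  assumes "0 < x" "x \<le> y"
  shows "f_mu \<mu> y \<le> f_mu \<mu> x"
proof (rule DERIV_nonpos_imp_nonincreasing[OF assms(2)])
  fix u assume "x \<le> u" "u \<le> y"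
  then have "0 < u" using assms by simp
  then show "\<exists>d. (f_mu \<mu> has_real_derivative d) (at u) \<and> d \<le> 0"
    using f_mu_has_derivative[of u \<mu>] by (intro exI conjI) (assumption, auto)
qed

lemma f_mu_continuous_on: "continuous_on {0<..} (f_mu \<mu>)"
  by (intro continuous_at_imp_continuous_on ballI DERIV_isCont[OF f_mu_has_derivative]) auto

section \<open>Running maxima and Riemann-Stieltjes sums\<close>

lemma running_max_upper:
  assumes "continuous_on {0..t} X" "r \<in> {0..t}"
  shows "X r \<le> running_max t X"
proof -
  have "bdd_above (X ` {0..t})"
    using compact_continuous_image[OF assms(1)] by (intro bounded_imp_bdd_above compact_imp_bounded) auto
  then show ?thesis unfolding running_max_def using assms(2) by (rule cSUP_upper[rotated])
qed

lemma running_max_least: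
  assumes "0 \<le> t" "\<And>r. r \<in> {0..t} \<Longrightarrow> X r \<le> c"
  shows "running_max t X \<le> c"
  unfolding running_max_def using assms by (intro cSUP_least) auto

lemma running_max_attained:
  assumes "0 \<le> t" "continuous_on {0..t} X"
  obtains r where "r \<in> {0..t}" "running_max t X = X r"
proof -
  obtain r where r: "r \<in> {0..t}" "\<forall>u\<in>{0..t}. X u \<le> X r"
    using continuous_attains_sup[OF compact_Icc _ assms(2)] assms(1) by auto
  then have "running_max t X = X r"
    by (intro antisym running_max_least running_max_upper assms) auto
  then show ?thesis using r that by blast
qed

lemma running_max_mono:
  assumes "continuous_on {0..t} X" "0 \<le> s" "s \<le> t"
  shows "running_max s X \<le> running_max t X"
  using assms by (intro running_max_least running_max_upper) auto

lemma running_max_0 [simp]: "running_max 0 X = X 0"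
  by (simp add: running_max_def)

lemma running_max_extend_le:
  assumes "continuous_on {0..t} X" "0 \<le> s" "s \<le> t" 
    and "running_max s X \<le> c" "\<And>r. r \<in> {s..t} \<Longrightarrow> X r \<le> c"
  shows "running_max t X \<le> c"
proof (rule running_max_least)
  fix r assume r: "r \<in> {0..t}"
  show "X r \<le> c"
  proof (cases "r \<le> s")
    case True
    then have "X r \<le> running_max s X" using r assms
      by (intro running_max_upper continuous_on_subset[OF assms(1)]) auto
    then show ?thesis using assms(4) by simp
  qed (use assms r in auto)
qed (use assms in auto)

text \<open>The last property is the induction step for comparing the running maximum with a sampled
  one: \<open>c\<close> stands for the sampled maximum at the previous grid point, and the same
  error \<open>e\<close> appears on both sides, so that errors do not accumulate along the
  grid.\<close>

lemma running_max_oscillation: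
  assumes X: "continuous_on {0..b} X" and e: "0 < e"
  obtains d where "0 < d" "\<And>r u. r \<in> {0..b} \<Longrightarrow> u \<in> {0..b} \<Longrightarrow> \<bar>r - u\<bar> < d \<Longrightarrow> \<bar>X r - X u\<bar> < e"
    "\<And>s t. 0 \<le> s \<Longrightarrow> s \<le> t \<Longrightarrow> t \<le> b \<Longrightarrow> t - s < d \<Longrightarrow> running_max t X \<le> running_max s X + e"
    "\<And>s t c. 0 \<le> s \<Longrightarrow> s \<le> t \<Longrightarrow> t \<le> b \<Longrightarrow> t - s < d \<Longrightarrow> running_max s X \<le> c + e \<Longrightarrow> 
      running_max t X \<le> max c (X t) + e"
proof -
  have "uniformly_continuous_on {0..b} X"
    using X by (intro compact_uniformly_continuous) auto
  then obtain d where d: "0 < d"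
      "\<And>r u. r \<in> {0..b} \<Longrightarrow> u \<in> {0..b} \<Longrightarrow> \<bar>r - u\<bar> < d \<Longrightarrow> \<bar>X r - X u\<bar> < e"
    using e unfolding uniformly_continuous_on_def dist_real_def by metis
  have "running_max t X \<le> running_max s X + e" if "0 \<le> s" "s \<le> t" "t \<le> b" "t - s < d" for s t
  proof (rule running_max_extend_le[OF continuous_on_subset[OF X] that(1,2)])
    fix r assume "r \<in> {s..t}"
    then have "\<bar>X r - X s\<bar> < e" using that by (intro d) auto
    moreover have "X s \<le> running_max s X"
      using that by (intro running_max_upper continuous_on_subset[OF X]) auto
    ultimately show "X r \<le> running_max s X + e" by simp
  qed (use that e in auto)
  moreover have "running_max t X \<le> max c (X t) + e" 
    if "0 \<le> s" "s \<le> t" "t \<le> b" "t - s < d" "running_max s X \<le> c + e" for s t c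
  proof (rule running_max_extend_le[OF continuous_on_subset[OF X] that(1,2)])
    fix r assume "r \<in> {s..t}"
    then have "\<bar>X r - X t\<bar> < e" using that by (intro d) auto
    then show "X r \<le> max c (X t) + e" by simp
  qed (use that e in auto)
  ultimately show ?thesis using d by (intro that[of d])
qed

lemma running_max_continuous_on:
  assumes X: "continuous_on {0..b} X"
  shows "continuous_on {0..b} (\<lambda>t. running_max t X)"
  unfolding continuous_on_iff dist_real_def
proof (intro ballI allI impI)
  fix t e :: real assume t: "t \<in> {0..b}" and e: "0 < e"
  obtain d where d: "0 < d" "\<And>s t. 0 \<le> s \<Longrightarrow> s \<le> t \<Longrightarrow> t \<le> b \<Longrightarrow> t - s < d \<Longrightarrow> running_max t X \<le> running_max s X + e / 2"
    by (rule running_max_oscillation[OF X, of "e / 2"]) (use e in auto)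
  show "\<exists>d>0. \<forall>x'\<in>{0..b}. \<bar>x' - t\<bar> < d \<longrightarrow> \<bar>running_max x' X - running_max t X\<bar> < e"
  proof (intro exI[of _ d] conjI d ballI impI)
    fix s assume s: "s \<in> {0..b}" "\<bar>s - t\<bar> < d"
    show "\<bar>running_max s X - running_max t X\<bar> < e"
    proof (cases "s \<le> t")
      case True
      with d(2)[of s t] running_max_mono[OF continuous_on_subset[OF X], of t s] s t e show ?thesis by auto
    next
      case False
      with d(2)[of t s] running_max_mono[OF continuous_on_subset[OF X], of s t] s t e show ?thesis by auto
    qed
  qed
qed

section \<open>Equidistant grids\<close>

definition grid :: "real \<Rightarrow> real \<Rightarrow> nat \<Rightarrow> nat \<Rightarrow> real" where
  "grid s t N i = s + real i * (t - s) / real N"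

lemma grid_0 [simp]: "grid s t N 0 = s" by (simp add: grid_def)
lemma grid_end [simp]: "0 < N \<Longrightarrow> grid s t N N = t" by (simp add: grid_def)
lemma grid_step: "grid s t N (Suc i) - grid s t N i = (t - s) / real N"
  by (simp add: grid_def diff_divide_distrib[symmetric] algebra_simps)
lemma grid_mono: "s \<le> t \<Longrightarrow> i \<le> j \<Longrightarrow> grid s t N i \<le> grid s t N j"
  by (auto simp: grid_def intro!: divide_right_mono mult_right_mono)
lemma grid_strict_mono: "s < t \<Longrightarrow> 0 < N \<Longrightarrow> i < j \<Longrightarrow> grid s t N i < grid s t N j"
  by (auto simp: grid_def intro!: divide_strict_right_mono mult_strict_right_mono)
lemma grid_mem: "s \<le> t \<Longrightarrow> i \<le> N \<Longrightarrow> grid s t N i \<in> {s..t}"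
  using grid_mono[of s t 0 i N] grid_mono[of s t i N N] by (cases "N = 0") auto

lemma eventually_mesh_less:
  assumes "0 < (d::real)"
  shows "\<forall>\<^sub>F n in sequentially. (t - s) / real (Suc n) < d"
proof -
  have "(\<lambda>n. (t - s) * inverse (real (Suc n))) \<longlonglongrightarrow> (t - s) * 0"
    by (intro tendsto_mult LIMSEQ_inverse_real_of_nat) auto
  then show ?thesis using assms by (auto simp: divide_inverse dest: order_tendstoD(2))
qed

section \<open>Stieltjes integrals as limits of left-endpoint sums\<close>

lemma interval_measure_Ioc:
  fixes g :: "real \<Rightarrow> real"
  assumes "mono g" "continuous_on UNIV g" "u \<le> v"
  shows "emeasure (interval_measure g) {u<..v} = g v - g u" "measure (interval_measure g) {u<..v} = g v - g u"
proof -
  have "continuous (at_right c) g" for c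
    using assms(2) by (auto simp: continuous_on_eq_continuous_within intro: continuous_within_subset)
  then show "emeasure (interval_measure g) {u<..v} = g v - g u" "measure (interval_measure g) {u<..v} = g v - g u"
    using assms by (auto intro!: emeasure_interval_measure_Ioc measure_interval_measure_Ioc dest: monoD)
qed

lemma interval_measure_set_integrable:
  fixes g h :: "real \<Rightarrow> real"
  assumes g: "mono g" "continuous_on UNIV g" and h: "continuous_on {a..b} h" and uv: "a \<le> u" "u \<le> v" "v \<le> b"
  shows "set_integrable (interval_measure g) {u<..v} h"
proof -
  let ?M = "interval_measure g"
  have "bounded (h ` {a..b})"
    using compact_continuous_image[OF h compact_Icc] by (rule compact_imp_bounded)
  then obtain B where B: "\<forall>x\<in>{a..b}. \<bar>h x\<bar> \<le> B" by (auto simp: bounded_iff)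
  have hm: "(\<lambda>x. indicator {a..b} x *\<^sub>R h x) \<in> borel_measurable ?M"
    using borel_measurable_continuous_on_indicator[OF _ h] by simp
  have "integrable ?M (\<lambda>x. indicator {u<..v} x *\<^sub>R (indicator {a..b} x *\<^sub>R h x))"
    by (rule integrableI_bounded_set_indicator[where B=B])
      (use uv B hm g in \<open>auto simp: interval_measure_Ioc indicator_def\<close>)
  moreover have "(\<lambda>x. indicator {u<..v} x *\<^sub>R (indicator {a..b} x *\<^sub>R h x)) = (\<lambda>x. indicator {u<..v} x *\<^sub>R h x)"
    using uv by (auto simp: indicator_def fun_eq_iff)
  ultimately show ?thesis unfolding set_integrable_def by (simp only:)
qed

text \<open>On each cell the integrand differs from its left endpoint value by less than
  \<open>e'\<close>. The error of a cell is thus at most \<open>e'\<close> times the mass of the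
  cell, and the masses telescope to \<open>g b - g a\<close>.\<close>

lemma Riemann_Stieltjes_tendsto:
  fixes g h :: "real \<Rightarrow> real"
  assumes g: "mono g" "continuous_on UNIV g" and h: "continuous_on {a..b} h" and ab: "a \<le> b"
  shows "(\<lambda>n. \<Sum>i<Suc n. h (grid a b (Suc n) i) * (g (grid a b (Suc n) (Suc i)) - g (grid a b (Suc n) i)))
    \<longlonglongrightarrow> (LINT r:{a<..b}|interval_measure g. h r)"
proof (rule LIMSEQ_I)
  let ?M = "interval_measure g"
  note meas = interval_measure_Ioc[OF g]
  note int = interval_measure_set_integrable[OF g h]
  have intc: "set_integrable ?M {u<..v} (\<lambda>_. c :: real)" if "u \<le> v" for u v c
    using that unfolding set_integrable_def
    by (intro integrableI_bounded_set_indicator[where B="\<bar>c\<bar>"]) (auto simp: meas)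
  fix e :: real assume e: "0 < e"
  \<comment> \<open>The summand 1 keeps the denominator positive when \<open>g\<close> is constant
    on the interval.\<close>
  define e' where "e' = e / (g b - g a + 1)"
  have gab: "g a \<le> g b" using g(1) ab by (simp add: monoD)
  have e': "0 < e'" "e' * (g b - g a) < e" using e gab by (auto simp: e'_def field_simps)
  have "uniformly_continuous_on {a..b} h"
    using h by (intro compact_uniformly_continuous) auto
  then obtain d where d: "0 < d" "\<And>r u. r \<in> {a..b} \<Longrightarrow> u \<in> {a..b} \<Longrightarrow> \<bar>r - u\<bar> < d \<Longrightarrow> \<bar>h r - h u\<bar> < e'"
    using e'(1) unfolding uniformly_continuous_on_def dist_real_def by metis
  obtain N where N: "\<And>n. n \<ge> N \<Longrightarrow> (b - a) / real (Suc n) < d"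
    using eventually_mesh_less[OF d(1), of b a] unfolding eventually_sequentially by blast
  show "\<exists>no. \<forall>n\<ge>no. norm ((\<Sum>i<Suc n. h (grid a b (Suc n) i) * (g (grid a b (Suc n) (Suc i)) - g (grid a b (Suc n) i)))
     - (LINT r:{a<..b}|?M. h r)) < e"
  proof (intro exI[of _ N] allI impI)
    fix n assume n: "n \<ge> N"
    define p where "p = grid a b (Suc n)"
    have p: "p i \<in> {a..b}" if "i \<le> Suc n" for i using grid_mem[OF ab that] by (simp add: p_def)
    have pm: "p i \<le> p (Suc i)" "p (Suc i) - p i < d" "a \<le> p i" for i
      using grid_mono[OF ab, of i "Suc i"] grid_mono[OF ab, of 0 i "Suc n"] grid_step[of a b "Suc n" i] N[OF n]
      unfolding p_def by auto
    have "\<bar>(\<Sum>i<k. h (p i) * (g (p (Suc i)) - g (p i))) - (LINT r:{a<..p k}|?M. h r)\<bar> \<le> e' * (g (p k) - g a)"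
      if "k \<le> Suc n" for k
      using that
    proof (induction k)
      case 0
      then show ?case by (simp add: p_def set_lebesgue_integral_def)
    next
      case (Suc k)
      have pk: "p k \<in> {a..b}" "p (Suc k) \<in> {a..b}" using p Suc by auto
      have "{a<..p (Suc k)} = {a<..p k} \<union> {p k<..p (Suc k)}" using pm[of k] by auto
      then have S: "(LINT r:{a<..p (Suc k)}|?M. h r) = (LINT r:{a<..p k}|?M. h r) + (LINT r:{p k<..p (Suc k)}|?M. h r)"
        using pk pm[of k] by (auto intro!: set_integral_Un int)
      have C: "(LINT r:{p k<..p (Suc k)}|?M. c) = c * (g (p (Suc k)) - g (p k))" for c :: real
        using pm[of k] by (simp add: set_lebesgue_integral_def meas mult.commute)
      have "(LINT r:{p k<..p (Suc k)}|?M. h r) \<le> (LINT r:{p k<..p (Suc k)}|?M. h (p k) + e')"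
           "(LINT r:{p k<..p (Suc k)}|?M. h (p k) - e') \<le> (LINT r:{p k<..p (Suc k)}|?M. h r)"
        using pk pm[of k] d(2)[of _ "p k"]
        by (auto intro!: set_integral_mono int intc simp: abs_less_iff; 
            smt (verit, best) atLeastAtMost_iff)+
      then have "\<bar>h (p k) * (g (p (Suc k)) - g (p k)) - (LINT r:{p k<..p (Suc k)}|?M. h r)\<bar>
         \<le> e' * (g (p (Suc k)) - g (p k))"
        unfolding C by (simp add: algebra_simps abs_le_iff)
      with Suc show ?case unfolding S by (simp add: algebra_simps)
    qed
    from this[of "Suc n"] show "norm ((\<Sum>i<Suc n. h (grid a b (Suc n) i) * (g (grid a b (Suc n) (Suc i)) - g (grid a b (Suc n) i)))
     - (LINT r:{a<..b}|?M. h r)) < e"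
      using e'(2) by (simp add: p_def)
  qed
qed

text \<open>\<open>interval_measure\<close> requires a monotone continuous integrator on the whole
  line, whereas nothing is known about the path outside \<open>[0, t]\<close>.\<close>

lemma clipped_running_max:
  assumes X: "continuous_on {0..t} X" and t: "0 \<le> t"
  shows "mono (\<lambda>s. running_max (max 0 (min s t)) X)"
    "continuous_on UNIV (\<lambda>s. running_max (max 0 (min s t)) X)"
proof -
  show "mono (\<lambda>s. running_max (max 0 (min s t)) X)"
    using t by (intro monoI running_max_mono continuous_on_subset[OF X]) auto
  show "continuous_on UNIV (\<lambda>s. running_max (max 0 (min s t)) X)"
    by (rule continuous_on_compose2[OF running_max_continuous_on[OF X]])
       (use t in \<open>auto intro!: continuous_intros\<close>)
qed

definition stieltjes_sum :: "real \<Rightarrow> real \<Rightarrow> real \<Rightarrow> real \<Rightarrow> nat \<Rightarrow> (real \<Rightarrow> real) \<Rightarrow> real" where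
  "stieltjes_sum T \<mu> a b N X = (\<Sum>i<N. f_mu \<mu> (T - grid a b N i) *
     (running_max (grid a b N (Suc i)) X - running_max (grid a b N i) X))"

lemma f_mu_shift_continuous_on: "t < T \<Longrightarrow> continuous_on {a..t} (\<lambda>s. f_mu \<mu> (T - s))"
  by (rule continuous_on_compose2[OF f_mu_continuous_on]) (auto intro!: continuous_intros)

text \<open>Splitting at \<open>s\<close> separates a factor that depends on the path up to
  \<open>s\<close> from the part that will be replaced by its sampled version.\<close>

lemma stieltjes_sum_tendsto:
  assumes X: "continuous_on {0..t} X" and st: "0 \<le> s" "s \<le> t" "t < T"
  shows "(\<lambda>n. stieltjes_sum T \<mu> 0 s (Suc n) X + stieltjes_sum T \<mu> s t (Suc n) X) \<longlonglongrightarrow>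
    (LINT s:{0..t}|interval_measure (\<lambda>s. running_max (max 0 (min s t)) X). f_mu \<mu> (T - s))"
proof -
  define g where "g = (\<lambda>s. running_max (max 0 (min s t)) X)"
  let ?M = "interval_measure g"
  have t: "0 \<le> t" using st by simp
  note g = clipped_running_max[OF X t, folded g_def]
  have I: "(\<lambda>n. stieltjes_sum T \<mu> a b (Suc n) X) \<longlonglongrightarrow> (LINT r:{a<..b}|?M. f_mu \<mu> (T - r))"
    if "0 \<le> a" "a \<le> b" "b \<le> t" for a b
  proof -
    have *: "stieltjes_sum T \<mu> a b (Suc n) X = (\<Sum>i<Suc n. f_mu \<mu> (T - grid a b (Suc n) i) * (g (grid a b (Suc n) (Suc i)) - g (grid a b (Suc n) i)))" for n
      unfolding stieltjes_sum_def
    proof (rule sum.cong)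
      fix i assume "i \<in> {..<Suc n}"
      then have "grid a b (Suc n) i \<in> {a..b}" "grid a b (Suc n) (Suc i) \<in> {a..b}"
        using grid_mem[OF that(2)] by auto
      then show "f_mu \<mu> (T - grid a b (Suc n) i) * (running_max (grid a b (Suc n) (Suc i)) X - running_max (grid a b (Suc n) i) X) =
         f_mu \<mu> (T - grid a b (Suc n) i) * (g (grid a b (Suc n) (Suc i)) - g (grid a b (Suc n) i))"
        using that by (simp add: g_def max_def min_def)
    qed simp
    show ?thesis unfolding *
      by (rule Riemann_Stieltjes_tendsto[OF g, where h="\<lambda>r. f_mu \<mu> (T - r)"])
         (use that st in \<open>auto intro!: f_mu_shift_continuous_on\<close>)
  qed
  \<comment> \<open>The clipped running maximum is continuous, hence its measure has no atom at
    \<open>0\<close>, and the closed interval may be replaced by a half-open one.\<close>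
  have null: "emeasure ?M {0} = 0"
    using emeasure_interval_measure_Icc[of 0 0 g] g by (simp add: monoD)
  have int: "set_integrable ?M {a<..b} (\<lambda>r. f_mu \<mu> (T - r))" if "0 \<le> a" "a \<le> b" "b \<le> t" for a b
    using that st by (intro interval_measure_set_integrable[OF g f_mu_shift_continuous_on[of t]]) auto
  have "(LINT r:{0..t}|?M. f_mu \<mu> (T - r)) = (LINT r:{0<..t}|?M. f_mu \<mu> (T - r))"
  proof -
    have "AE x in ?M. x \<noteq> 0"
      using null by (intro AE_I[where N="{0}"]) auto
    then have ae: "AE x in ?M. indicator {0..t} x *\<^sub>R f_mu \<mu> (T - x) = indicator {0<..t} x *\<^sub>R f_mu \<mu> (T - x)"
      by eventually_elim (auto simp: indicator_def)
    have h: "continuous_on {0..t} (\<lambda>r. f_mu \<mu> (T - r))" using st by (intro f_mu_shift_continuous_on) auto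
    have hm: "(\<lambda>x. indicator {0..t} x *\<^sub>R f_mu \<mu> (T - x)) \<in> borel_measurable ?M"
      using borel_measurable_continuous_on_indicator[OF _ h] by simp
    have hm': "(\<lambda>x. indicator {0<..t} x *\<^sub>R f_mu \<mu> (T - x)) \<in> borel_measurable ?M"
      using int[of 0 t] t unfolding set_integrable_def by auto
    show ?thesis unfolding set_lebesgue_integral_def
      by (rule integral_cong_AE[OF hm hm' ae])
  qed
  also have "\<dots> = (LINT r:{0<..s} \<union> {s<..t}|?M. f_mu \<mu> (T - r))"
    using st by (intro arg_cong2[where f="set_lebesgue_integral ?M"] refl) auto
  also have "\<dots> = (LINT r:{0<..s}|?M. f_mu \<mu> (T - r)) + (LINT r:{s<..t}|?M. f_mu \<mu> (T - r))"
    using st by (intro set_integral_Un int) auto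
  finally show ?thesis using tendsto_add[OF I[of 0 s] I[of s t]] st unfolding g_def by simp
qed

section \<open>The density of a path sampled on a grid\<close>

primrec disc_max :: "real \<Rightarrow> (nat \<Rightarrow> real) \<Rightarrow> nat \<Rightarrow> real" where
  "disc_max z x 0 = z"
| "disc_max z x (Suc k) = max (disc_max z x k) (\<Sum>i<Suc k. x i)"

text \<open>Everything is relative to the position at time \<open>s\<close>: \<open>z\<close> is the
  drawdown at that time, the partial sums of \<open>x\<close> are the sampled positions, and
  \<open>disc_max z x\<close> is their maximum including the one inherited from before
  \<open>s\<close>. As a function of \<open>z\<close> and the increments alone, this factor of the
  density can be studied by changing one increment.\<close>

definition disc_L :: "real \<Rightarrow> real \<Rightarrow> real \<Rightarrow> real \<Rightarrow> nat \<Rightarrow> real \<Rightarrow> (nat \<Rightarrow> real) \<Rightarrow> real" where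
  "disc_L T \<mu> s t N z x = F_mu \<mu> (T - t) (disc_max z x N - (\<Sum>i<N. x i)) *
     exp (\<Sum>i<N. f_mu \<mu> (T - grid s t N i) * (disc_max z x (Suc i) - disc_max z x i))"

definition grid_incr :: "real \<Rightarrow> real \<Rightarrow> nat \<Rightarrow> (real \<Rightarrow> real) \<Rightarrow> nat \<Rightarrow> real" where
  "grid_incr s t N X i = X (grid s t N (Suc i)) - X (grid s t N i)"

lemma sum_grid_incr: "(\<Sum>i<k. grid_incr s t N X i) = X (grid s t N k) - X s"
  by (simp add: grid_incr_def sum_lessThan_telescope[of "\<lambda>i. X (grid s t N i)"])

lemma disc_max_ge: "0 \<le> z \<Longrightarrow> (\<Sum>i<k. x i) \<le> disc_max z x k"
  by (cases k) auto

lemma disc_max_grid_le_running_max: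
  assumes X: "continuous_on {0..t} X" and st: "0 \<le> s" "s \<le> t" and k: "k \<le> N"
  shows "disc_max (running_max s X - X s) (grid_incr s t N X) k + X s \<le> running_max (grid s t N k) X"
  using k
proof (induction k)
  case (Suc k)
  have g: "grid s t N k \<in> {s..t}" "grid s t N (Suc k) \<in> {s..t}" "grid s t N k \<le> grid s t N (Suc k)"
    using grid_mem[OF st(2)] Suc grid_mono[OF st(2)] by auto
  have "running_max (grid s t N k) X \<le> running_max (grid s t N (Suc k)) X"
    using g st by (intro running_max_mono continuous_on_subset[OF X]) auto
  moreover have "X (grid s t N (Suc k)) \<le> running_max (grid s t N (Suc k)) X"
    using g st by (intro running_max_upper continuous_on_subset[OF X]) auto
  moreover have "disc_max (running_max s X - X s) (grid_incr s t N X) k + X s \<le> running_max (grid s t N k) X"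
    using Suc by simp
  ultimately show ?case using sum_grid_incr[of s t N X "Suc k"] by (simp del: sum.lessThan_Suc)
qed simp

text \<open>Summation by parts moves the differences from \<open>e\<close> to the nondecreasing
  weights \<open>f\<close>, so that only the size of \<open>e\<close> matters. This is essential
  because the gap between the running and the sampled maximum is small while nothing is known about
  its variation.\<close>

lemma abel_sum_bounds:
  fixes f e :: "nat \<Rightarrow> real"
  assumes f: "\<And>i j. i \<le> j \<Longrightarrow> j \<le> N \<Longrightarrow> f i \<le> f j" "0 \<le> f 0"
    and e: "e 0 = 0" "\<And>i. i \<le> N \<Longrightarrow> 0 \<le> e i" "\<And>i. i \<le> N \<Longrightarrow> e i \<le> \<epsilon>" and N: "k \<le> N"
  shows "(\<Sum>i<k. f i * (e (Suc i) - e i)) \<le> f k * e k"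
    "f k * e k - \<epsilon> * (f k - f 0) \<le> (\<Sum>i<k. f i * (e (Suc i) - e i))"
proof -
  have "(\<Sum>i<k. f i * (e (Suc i) - e i)) \<le> f k * e k \<and> f k * e k - \<epsilon> * (f k - f 0) \<le> (\<Sum>i<k. f i * (e (Suc i) - e i))"
    using N
  proof (induction k)
    case (Suc k)
    have a: "f k * e (Suc k) \<le> f (Suc k) * e (Suc k)"
      using f(1)[of k "Suc k"] Suc e by (intro mult_right_mono) auto
    have b: "(f (Suc k) - f k) * e (Suc k) \<le> (f (Suc k) - f k) * \<epsilon>"
      using f(1)[of k "Suc k"] Suc e by (intro mult_left_mono) auto
    show ?case using a b Suc by (simp add: algebra_simps)
  qed (simp add: e)
  then show "(\<Sum>i<k. f i * (e (Suc i) - e i)) \<le> f k * e k"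
    "f k * e k - \<epsilon> * (f k - f 0) \<le> (\<Sum>i<k. f i * (e (Suc i) - e i))" by auto
qed

text \<open>Uniform in the grid point \<open>k\<close>: once the mesh is below the modulus of
  continuity, the induction along the grid reproduces the error \<open>e\<close> instead of adding
  to it.\<close>

lemma eventually_running_max_le_disc_max_grid:
  assumes X: "continuous_on {0..t} X" and st: "0 \<le> s" "s \<le> t" and e: "0 < e"
  shows "\<forall>\<^sub>F n in sequentially. \<forall>k\<le>Suc n. running_max (grid s t (Suc n) k) X \<le>
    disc_max (running_max s X - X s) (grid_incr s t (Suc n) X) k + X s + e"
proof -
  define D where "D n k = disc_max (running_max s X - X s) (grid_incr s t (Suc n) X) k" for n k
  obtain d where d: "0 < d"
    "\<And>u v c. 0 \<le> u \<Longrightarrow> u \<le> v \<Longrightarrow> v \<le> t \<Longrightarrow> v - u < d \<Longrightarrow> running_max u X \<le> c + e \<Longrightarrow> 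
    running_max v X \<le> max c (X v) + e"
    by (rule running_max_oscillation[OF X e]) blast
  show ?thesis using eventually_mesh_less[OF d(1), of t s]
  proof eventually_elim
    case (elim n)
    have "running_max (grid s t (Suc n) k) X \<le> D n k + X s + e" if "k \<le> Suc n" for k
      using that
    proof (induction k)
      case (Suc k)
      let ?u = "grid s t (Suc n)"
      have g: "?u k \<in> {s..t}" "?u (Suc k) \<in> {s..t}" "?u k \<le> ?u (Suc k)" "?u (Suc k) - ?u k < d"
        using grid_mem[OF st(2)] Suc grid_mono[OF st(2)] elim by (auto simp: grid_step)
      have "running_max (?u (Suc k)) X \<le> max (D n k + X s) (X (?u (Suc k))) + e"
        using Suc g st by (intro d(2)[of "?u k"]) auto
      then show ?case using sum_grid_incr[of s t "Suc n" X "Suc k"]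
        by (simp add: D_def del: sum.lessThan_Suc)
    qed (use e in \<open>simp add: D_def\<close>)
    then show ?case by (simp add: D_def)
  qed
qed

lemma disc_max_grid_tendsto:
  assumes X: "continuous_on {0..t} X" and st: "0 \<le> s" "s \<le> t"
  shows "(\<lambda>n. disc_max (running_max s X - X s) (grid_incr s t (Suc n) X) (Suc n) + X s) \<longlonglongrightarrow> running_max t X"
    (is "?D \<longlonglongrightarrow> _")
proof (rule LIMSEQ_I)
  fix r :: real assume "0 < r"
  then have "0 < r / 2" by simp
  from eventually_running_max_le_disc_max_grid[OF X st this]
  obtain N where N: "\<And>n. n \<ge> N \<Longrightarrow> running_max t X \<le> ?D n + r / 2"
    unfolding eventually_sequentially by (metis grid_end order_refl zero_less_Suc)
  have "?D n \<le> running_max t X" for n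
    using disc_max_grid_le_running_max[OF X st order_refl, of "Suc n"] by (simp only: grid_end zero_less_Suc)
  then show "\<exists>no. \<forall>n\<ge>no. norm (?D n - running_max t X) < r"
    using N \<open>0 < r\<close> by (intro exI[of _ N] allI impI) (smt (verit) field_sum_of_halves real_norm_def)
qed

lemma disc_L_tendsto:
  assumes X: "continuous_on {0..t} X" and st: "0 \<le> s" "s \<le> t" "t < T"
  shows "(\<lambda>n. exp (stieltjes_sum T \<mu> 0 s (Suc n) X) *
      disc_L T \<mu> s t (Suc n) (running_max s X - X s) (grid_incr s t (Suc n) X)) \<longlonglongrightarrow> L_proc T \<mu> t X"
proof -
  define D where "D n k = disc_max (running_max s X - X s) (grid_incr s t (Suc n) X) k" for n k
  define f where "f n i = f_mu \<mu> (T - grid s t (Suc n) i)" for n i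
  define E where "E n k = running_max (grid s t (Suc n) k) X - X s - D n k" for n k
  have fm: "f n i \<le> f n j" if "i \<le> j" "j \<le> Suc n" for n i j
    unfolding f_def using grid_mono[OF st(2) that(1), of "Suc n"] grid_mem[OF st(2) that(2)] st
    by (intro f_mu_antimono) auto
  have f0: "0 \<le> f n 0" for n using st by (auto simp: f_def intro!: f_mu_nonneg)
  have E0: "E n 0 = 0" for n by (simp add: E_def D_def)
  have Enn: "0 \<le> E n k" if "k \<le> Suc n" for n k
    using disc_max_grid_le_running_max[OF X st(1,2) that] by (simp add: E_def D_def)
  have E: "\<forall>\<^sub>F n in sequentially. \<forall>k\<le>Suc n. E n k \<le> e" if e: "0 < e" for e
    using eventually_running_max_le_disc_max_grid[OF X st(1,2) e]
    by eventually_elim (simp add: E_def D_def algebra_simps)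
  \<comment> \<open>The two sums have the same weights, so their difference is a weighted sum of the
    differences of the gap \<open>E\<close>, to which summation by parts applies.\<close>
  have S: "(\<lambda>n. stieltjes_sum T \<mu> s t (Suc n) X - (\<Sum>i<Suc n. f n i * (D n (Suc i) - D n i))) \<longlonglongrightarrow> 0"
  proof -
    have *: "stieltjes_sum T \<mu> s t (Suc n) X - (\<Sum>i<Suc n. f n i * (D n (Suc i) - D n i))
        = (\<Sum>i<Suc n. f n i * (E n (Suc i) - E n i))" for n
      unfolding stieltjes_sum_def f_def E_def sum_subtractf[symmetric]
      by (intro sum.cong) (auto simp: algebra_simps)
    show ?thesis unfolding *
    proof (rule LIMSEQ_I)
      fix r :: real assume r: "0 < r"
      \<comment> \<open>The largest weight on every grid is \<open>f_mu \<mu> (T - t)\<close>,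
        attained at the last point, which gives a bound independent of \<open>n\<close>; adding 1
        makes \<open>C\<close> a legitimate divisor.\<close>
      define C where "C = f_mu \<mu> (T - t) + 1"
      have C: "0 < C" using f_mu_nonneg[of "T - t" \<mu>] st by (simp add: C_def)
      define e where "e = r / C / 2"
      have e: "0 < e" using r C by (simp add: e_def)
      from E[OF e] obtain N where N: "\<And>n k. n \<ge> N \<Longrightarrow> k \<le> Suc n \<Longrightarrow> E n k \<le> e"
        by (auto simp: eventually_sequentially)
      show "\<exists>no. \<forall>n\<ge>no. norm ((\<Sum>i<Suc n. f n i * (E n (Suc i) - E n i)) - 0) < r"
      proof (intro exI[of _ N] allI impI)
        fix n assume n: "n \<ge> N"
        have fN: "f n (Suc n) = C - 1" "0 \<le> C - 1" using st f_mu_nonneg[of "T - t" \<mu>] by (auto simp: f_def C_def)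
        note B = abel_sum_bounds[where f="f n" and e="E n" and N="Suc n" and k="Suc n" and \<epsilon>=e,
          OF fm f0 E0 Enn N[OF n] order_refl]
        have "f n (Suc n) * E n (Suc n) \<le> (C - 1) * e"
          unfolding fN using fN N[OF n] by (intro mult_left_mono) auto
        moreover have "e * (f n (Suc n) - f n 0) \<le> e * (C - 1)"
          unfolding fN using f0[of n] e by (intro mult_left_mono) auto
        moreover have "0 \<le> f n (Suc n) * E n (Suc n)" using fN Enn by simp
        ultimately have "\<bar>\<Sum>i<Suc n. f n i * (E n (Suc i) - E n i)\<bar> \<le> e * (C - 1)"
          using B by (simp add: abs_le_iff mult.commute del: sum.lessThan_Suc)
        also have "\<dots> < r" using r C by (simp add: e_def field_simps add_pos_pos)
        finally show "norm ((\<Sum>i<Suc n. f n i * (E n (Suc i) - E n i)) - 0) < r" 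
          by (simp del: sum.lessThan_Suc)
      qed
    qed
  qed
  have "(\<lambda>n. (stieltjes_sum T \<mu> 0 s (Suc n) X + stieltjes_sum T \<mu> s t (Suc n) X)
     - (stieltjes_sum T \<mu> s t (Suc n) X - (\<Sum>i<Suc n. f n i * (D n (Suc i) - D n i)))) \<longlonglongrightarrow>
     (LINT s:{0..t}|interval_measure (\<lambda>s. running_max (max 0 (min s t)) X). f_mu \<mu> (T - s)) - 0"
    by (intro tendsto_diff S stieltjes_sum_tendsto X st)
  then have A: "(\<lambda>n. exp (stieltjes_sum T \<mu> 0 s (Suc n) X + (\<Sum>i<Suc n. f n i * (D n (Suc i) - D n i)))) \<longlonglongrightarrow>
     exp (LINT s:{0..t}|interval_measure (\<lambda>s. running_max (max 0 (min s t)) X). f_mu \<mu> (T - s))"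
    by (intro tendsto_exp) (simp add: algebra_simps del: sum.lessThan_Suc)
  have "(\<lambda>n. D n (Suc n) + X s - X t) \<longlonglongrightarrow> running_max t X - X t"
    unfolding D_def by (intro tendsto_diff tendsto_const disc_max_grid_tendsto X st)
  then have "(\<lambda>n. D n (Suc n) - (\<Sum>i<Suc n. grid_incr s t (Suc n) X i)) \<longlonglongrightarrow> running_max t X - X t"
    unfolding sum_grid_incr by (simp add: algebra_simps)
  moreover have "isCont (F_mu \<mu> (T - t)) (running_max t X - X t)"
    using F_mu_has_derivative[of "T - t"] st by (auto intro: DERIV_isCont)
  ultimately have "(\<lambda>n. F_mu \<mu> (T - t) (D n (Suc n) - (\<Sum>i<Suc n. grid_incr s t (Suc n) X i))) \<longlonglongrightarrow>
      F_mu \<mu> (T - t) (running_max t X - X t)" 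
    by (rule isCont_tendsto_compose[rotated])
  from tendsto_mult[OF this A] show ?thesis
    unfolding L_proc_def disc_L_def D_def f_def by (simp add: exp_add mult_ac del: sum.lessThan_Suc disc_max.simps(2))
qed

lemma grid_const [simp]: "grid t t N i = t" by (simp add: grid_def)

lemma stieltjes_sum_const [simp]: "stieltjes_sum T \<mu> t t N X = 0"
  by (simp add: stieltjes_sum_def)

section \<open>Bounds and measurability of the density process\<close>

text \<open>A cell that starts after \<open>u\<close> contributes nothing, as the maximum no longer
  moves. Every other cell starts at or before \<open>u\<close>, where the weight is at most
  \<open>f_mu \<mu> (T - u)\<close>.\<close>

lemma stieltjes_sum_le:
  assumes X: "continuous_on {0..t} X" and t: "0 \<le> u" "u \<le> t" "t < T"
    and const: "\<And>r. r \<in> {u..t} \<Longrightarrow> running_max r X = running_max u X"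
  shows "stieltjes_sum T \<mu> 0 t (Suc n) X \<le> f_mu \<mu> (T - u) * (running_max u X - X 0)"
proof -
  let ?g = "grid 0 t (Suc n)"
  have t0: "0 \<le> t" using t by simp
  have "stieltjes_sum T \<mu> 0 t (Suc n) X \<le> (\<Sum>i<Suc n. f_mu \<mu> (T - u) * (running_max (?g (Suc i)) X - running_max (?g i) X))"
    unfolding stieltjes_sum_def
  proof (rule sum_mono)
    fix i assume "i \<in> {..<Suc n}"
    then have g: "?g i \<in> {0..t}" "?g (Suc i) \<in> {0..t}" "?g i \<le> ?g (Suc i)"
      using grid_mem[OF t0] grid_mono[OF t0] by auto
    show "f_mu \<mu> (T - ?g i) * (running_max (?g (Suc i)) X - running_max (?g i) X) \<le>
      f_mu \<mu> (T - u) * (running_max (?g (Suc i)) X - running_max (?g i) X)"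
    proof (cases "?g i \<le> u")
      case True
      then show ?thesis using g t
        by (intro mult_right_mono f_mu_antimono) (auto intro!: running_max_mono continuous_on_subset[OF X])
    next
      case False
      then have "running_max (?g (Suc i)) X = running_max (?g i) X"
        using const[of "?g i"] const[of "?g (Suc i)"] g by auto
      then show ?thesis by simp
    qed
  qed
  also have "\<dots> = f_mu \<mu> (T - u) * (running_max t X - X 0)"
    unfolding sum_distrib_left[symmetric] by (subst sum_lessThan_telescope) simp
  also have "running_max t X = running_max u X" using const[of t] t by simp
  finally show ?thesis .
qed

text \<open>With a fixed \<open>u\<close> at which the maximum freezes, \<open>t\<close> enters the
  bound only through \<open>F_mu \<mu> (T - t) w\<close>. With \<open>u = t\<close> and
  \<open>w = 0\<close> it becomes the exponential bound that gives integrability.\<close>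

lemma L_proc_le:
  assumes X: "continuous_on {0..t} X" and t: "0 \<le> u" "u \<le> t" "t < T" and w: "0 \<le> w" "w \<le> running_max t X - X t"
    and const: "\<And>r. r \<in> {u..t} \<Longrightarrow> running_max r X = running_max u X"
  shows "L_proc T \<mu> t X \<le> F_mu \<mu> (T - t) w * exp (f_mu \<mu> (T - u) * (running_max u X - X 0))"
proof -
  have "(LINT s:{0..t}|interval_measure (\<lambda>s. running_max (max 0 (min s t)) X). f_mu \<mu> (T - s)) 
      \<le> f_mu \<mu> (T - u) * (running_max u X - X 0)"
    using stieltjes_sum_tendsto[OF X, of t T \<mu>] t stieltjes_sum_le[OF X t const]
    by (intro LIMSEQ_le_const2[where X="\<lambda>n. stieltjes_sum T \<mu> 0 t (Suc n) X"]) auto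
  then show ?thesis unfolding L_proc_def using t w
    by (intro mult_mono F_mu_antimono) (auto intro: less_imp_le F_mu_pos)
qed

lemma L_proc_nonneg: "0 \<le> L_proc T \<mu> t X"
  unfolding L_proc_def using F_mu_pos[of \<mu>] by (simp add: less_imp_le)

text \<open>At a point where the path attains its maximum over \<open>[0, t]\<close> the drawdown
  vanishes, so that such a point cannot lie after \<open>u\<close>.\<close>

lemma running_max_constant_if_drawdown_pos:
  assumes X: "continuous_on {0..t} X" and t: "0 \<le> u" "u \<le> t" 
    and pos: "\<And>r. r \<in> {u..t} \<Longrightarrow> 0 < running_max r X - X r"
  shows "running_max t X = running_max u X"
proof -
  obtain r where r: "r \<in> {0..t}" "running_max t X = X r"
    using running_max_attained[OF _ X] t by auto
  have "r \<le> u"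
  proof (rule ccontr)
    assume "\<not> r \<le> u"
    then have "0 < running_max r X - X r" using r pos by auto
    moreover have "running_max r X \<le> running_max t X"
      using r by (intro running_max_mono X) auto
    ultimately show False using r by simp
  qed
  then have "X r \<le> running_max u X"
    using r t by (intro running_max_upper continuous_on_subset[OF X]) auto
  moreover have "running_max u X \<le> running_max t X"
    using t by (intro running_max_mono X) auto
  ultimately show ?thesis using r by simp
qed

section \<open>Measurability of functionals of sampled paths\<close>

lemma disc_max_measurable [measurable (raw)]:
  assumes [measurable]: "z \<in> borel_measurable M" and x: "\<And>i. i < k \<Longrightarrow> (\<lambda>\<omega>. x \<omega> i) \<in> borel_measurable M"
  shows "(\<lambda>\<omega>. disc_max (z \<omega>) (x \<omega>) k) \<in> borel_measurable M"
  using x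
proof (induction k)
  case (Suc k)
  have [measurable]: "(\<lambda>\<omega>. \<Sum>i<Suc k. x \<omega> i) \<in> borel_measurable M"
    using Suc.prems by (intro borel_measurable_sum) auto
  have [measurable]: "(\<lambda>\<omega>. disc_max (z \<omega>) (x \<omega>) k) \<in> borel_measurable M"
    using Suc by simp
  show ?case unfolding disc_max.simps by measurable
qed simp

lemma disc_L_measurable [measurable (raw)]:
  assumes [measurable]: "z \<in> borel_measurable M" and x: "\<And>i. i < N \<Longrightarrow> (\<lambda>\<omega>. x \<omega> i) \<in> borel_measurable M"
  shows "(\<lambda>\<omega>. disc_L T \<mu> s t N (z \<omega>) (x \<omega>)) \<in> borel_measurable M"
proof -
  have [measurable]: "(\<lambda>\<omega>. disc_max (z \<omega>) (x \<omega>) k) \<in> borel_measurable M" if "k \<le> N" for k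
    using x that by (intro disc_max_measurable) auto
  have [measurable]: "(\<lambda>\<omega>. \<Sum>i<N. x \<omega> i) \<in> borel_measurable M"
    using x by (intro borel_measurable_sum) auto
  have "(\<lambda>\<omega>. \<Sum>i<N. f_mu \<mu> (T - grid s t N i) * (disc_max (z \<omega>) (x \<omega>) (Suc i) - disc_max (z \<omega>) (x \<omega>) i)) \<in> borel_measurable M"
    by (intro borel_measurable_sum borel_measurable_times borel_measurable_diff) (auto simp del: disc_max.simps)
  then show ?thesis unfolding disc_L_def by measurable
qed

section \<open>The filtrations on path space and adaptedness of the density\<close>

lemma path_space_continuous_on: "\<omega> \<in> path_space T \<Longrightarrow> t < T \<Longrightarrow> continuous_on {0..t} \<omega>"
  unfolding path_space_def by (auto intro: continuous_on_subset)

lemma space_natural_filtration [simp]: "space (natural_filtration T t) = path_space T"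
  unfolding natural_filtration_def by (simp add: space_measure_of_conv)

lemma sets_natural_filtration:
  "sets (natural_filtration T t) =
     sigma_sets (path_space T) {{\<omega> \<in> path_space T. \<omega> s \<in> B} | s B. s \<in> {0..t} \<and> B \<in> sets borel}"
  unfolding natural_filtration_def by (rule sets_measure_of) auto

lemma natural_filtration_coordinate [measurable]:
  assumes "r \<in> {0..t}"
  shows "(\<lambda>\<omega>. \<omega> r) \<in> borel_measurable (natural_filtration T t)"
proof (rule measurableI)
  fix A :: "real set" assume "A \<in> sets borel"
  moreover have "(\<lambda>\<omega>. \<omega> r) -` A \<inter> space (natural_filtration T t) = {\<omega> \<in> path_space T. \<omega> r \<in> A}" by auto
  ultimately show "(\<lambda>\<omega>. \<omega> r) -` A \<inter> space (natural_filtration T t) \<in> sets (natural_filtration T t)"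
    unfolding sets_natural_filtration using assms by (auto intro!: sigma_sets.Basic)
qed simp

lemma natural_filtration_mono: "s \<le> t \<Longrightarrow> sets (natural_filtration T s) \<subseteq> sets (natural_filtration T t)"
  unfolding sets_natural_filtration by (rule sigma_sets_mono', clarify, intro CollectI exI conjI, rule refl) auto

text \<open>An intersection of sigma-algebras is closed under generation; \<open>t < T\<close>
  ensures that the intersected family is nonempty.\<close>

lemma sets_right_augmentation:
  assumes "t < T"
  shows "sets (right_augmentation T t) = (\<Inter>s\<in>{t<..<T}. sets (natural_filtration T s))"
proof -
  have "sets (right_augmentation T t) = sigma_sets (path_space T) (\<Inter>s\<in>{t<..<T}. sets (natural_filtration T s))"
    unfolding right_augmentation_def
  proof (rule sets_measure_of)
    obtain s where "s \<in> {t<..<T}" using dense[OF assms] by auto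
    then show "(\<Inter>s\<in>{t<..<T}. sets (natural_filtration T s)) \<subseteq> Pow (path_space T)"
      using sets.sets_into_space[where M="natural_filtration T s"] by fastforce
  qed
  also have "\<dots> = (\<Inter>s\<in>{t<..<T}. sets (natural_filtration T s))"
  proof (intro equalityI INT_greatest)
    fix s assume "s \<in> {t<..<T}"
    then have "(\<Inter>s\<in>{t<..<T}. sets (natural_filtration T s)) \<subseteq> sets (natural_filtration T s)" by blast
    from sets.sigma_sets_subset[OF this]
    show "sigma_sets (path_space T) (\<Inter>s\<in>{t<..<T}. sets (natural_filtration T s)) \<subseteq> sets (natural_filtration T s)"
      by simp
  qed auto
  finally show ?thesis .
qed

lemma space_right_augmentation [simp]: "space (right_augmentation T t) = path_space T"
  unfolding right_augmentation_def by (simp add: space_measure_of_conv)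

lemma space_path_algebra [simp]: "space (path_algebra T) = path_space T"
  unfolding path_algebra_def by (simp add: space_measure_of_conv)

lemma space_path_filtration [simp]: "space (path_filtration T t) = path_space T"
  by (simp add: path_filtration_def)

lemma natural_filtration_le_path_filtration:
  "t < T \<Longrightarrow> sets (natural_filtration T t) \<subseteq> sets (path_filtration T t)"
  unfolding path_filtration_def
  by (simp add: sets_right_augmentation) (intro INT_greatest natural_filtration_mono, simp)

lemma path_filtration_le_path_algebra:
  assumes "t \<in> {0..<T}"
  shows "sets (path_filtration T t) \<subseteq> sets (path_algebra T)"
proof -
  have "sets (path_algebra T) = sigma_sets (path_space T) (\<Union>t\<in>{0..<T}. sets (right_augmentation T t))"
    unfolding path_algebra_def
    by (rule sets_measure_of) (use sets.sets_into_space[where M="right_augmentation T _"] in fastforce)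
  then show ?thesis using assms by (auto simp: path_filtration_def intro!: sigma_sets.Basic)
qed

lemma natural_filtration_coordinate_incr:
  assumes "0 \<le> s" "s \<le> t" "i < N"
  shows "(\<lambda>\<omega>. grid_incr s t N \<omega> i) \<in> borel_measurable (natural_filtration T t)"
proof -
  have "grid s t N i \<in> {0..t}" "grid s t N (Suc i) \<in> {0..t}"
    using grid_mem[of s t i N] grid_mem[of s t "Suc i" N] assms by auto
  note [measurable] = this[THEN natural_filtration_coordinate]
  show ?thesis unfolding grid_incr_def by measurable
qed

text \<open>Continuity of the paths turns the uncountable supremum into a limit of maxima over grids
  of \<open>[0, r]\<close>.\<close>

lemma running_max_measurable [measurable]:
  assumes r: "r \<in> {0..t}" and t: "t < T"
  shows "running_max r \<in> borel_measurable (natural_filtration T t)"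
proof (rule borel_measurable_LIMSEQ_real)
  fix n
  have [measurable]: "(\<lambda>\<omega>. \<omega> 0) \<in> borel_measurable (natural_filtration T r)"
     using r by (intro natural_filtration_coordinate) auto
  have "(\<lambda>\<omega>. disc_max (running_max 0 \<omega> - \<omega> 0) (grid_incr 0 r (Suc n) \<omega>) (Suc n) + \<omega> 0)
     \<in> borel_measurable (natural_filtration T r)"
    using r by (intro borel_measurable_add disc_max_measurable natural_filtration_coordinate_incr) auto
  then show "(\<lambda>\<omega>. disc_max (running_max 0 \<omega> - \<omega> 0) (grid_incr 0 r (Suc n) \<omega>) (Suc n) + \<omega> 0)
     \<in> borel_measurable (natural_filtration T t)"
    by (rule measurable_mono[THEN subsetD, rotated -1])
       (use natural_filtration_mono[of r t T] r in auto)
next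
  fix \<omega> assume "\<omega> \<in> space (natural_filtration T t)"
  then show "(\<lambda>n. disc_max (running_max 0 \<omega> - \<omega> 0) (grid_incr 0 r (Suc n) \<omega>) (Suc n) + \<omega> 0) \<longlonglongrightarrow> running_max r \<omega>"
    using r t by (intro disc_max_grid_tendsto path_space_continuous_on) auto
qed

lemma stieltjes_sum_measurable:
  assumes r: "0 \<le> r" "r \<le> t" and t: "t < T"
  shows "stieltjes_sum T \<mu> 0 r (Suc n) \<in> borel_measurable (natural_filtration T t)"
  unfolding stieltjes_sum_def[abs_def]
proof (intro borel_measurable_sum borel_measurable_times borel_measurable_diff borel_measurable_const)
  fix i assume i: "i \<in> {..<Suc n}"
  then have "grid 0 r (Suc n) i \<in> {0..r}" "grid 0 r (Suc n) (Suc i) \<in> {0..r}"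
    using r by (intro grid_mem; simp)+
  then show "running_max (grid 0 r (Suc n) i) \<in> borel_measurable (natural_filtration T t)"
       "running_max (grid 0 r (Suc n) (Suc i)) \<in> borel_measurable (natural_filtration T t)"
    using r t by (auto intro!: running_max_measurable)
qed

text \<open>This uses the limit theorem for the sampled density with \<open>s = t\<close>: the grid
  after \<open>s\<close> collapses to a point, and what remains is built from Stieltjes sums over
  \<open>[0, t]\<close>.\<close>

lemma L_proc_measurable:
  assumes t: "0 \<le> t" "t < T"
  shows "L_proc T \<mu> t \<in> borel_measurable (natural_filtration T t)"
proof (rule borel_measurable_LIMSEQ_real)
  fix n
  have [measurable]: "(\<lambda>\<omega>. \<omega> t) \<in> borel_measurable (natural_filtration T t)"
      "running_max t \<in> borel_measurable (natural_filtration T t)"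
      "stieltjes_sum T \<mu> 0 t (Suc n) \<in> borel_measurable (natural_filtration T t)"
     using t by (auto intro!: natural_filtration_coordinate running_max_measurable stieltjes_sum_measurable)
  have [measurable]: "(\<lambda>\<omega>. disc_L T \<mu> t t (Suc n) (running_max t \<omega> - \<omega> t) (grid_incr t t (Suc n) \<omega>))
      \<in> borel_measurable (natural_filtration T t)"
    using t by (intro disc_L_measurable natural_filtration_coordinate_incr) auto
  show "(\<lambda>\<omega>. exp (stieltjes_sum T \<mu> 0 t (Suc n) \<omega>) *
     disc_L T \<mu> t t (Suc n) (running_max t \<omega> - \<omega> t) (grid_incr t t (Suc n) \<omega>)) \<in> borel_measurable (natural_filtration T t)"
    by measurable
next
  fix \<omega> assume "\<omega> \<in> space (natural_filtration T t)"
  then show "(\<lambda>n. exp (stieltjes_sum T \<mu> 0 t (Suc n) \<omega>) *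
     disc_L T \<mu> t t (Suc n) (running_max t \<omega> - \<omega> t) (grid_incr t t (Suc n) \<omega>)) \<longlonglongrightarrow> L_proc T \<mu> t \<omega>"
    using t by (intro disc_L_tendsto path_space_continuous_on) auto
qed

lemma closure_Rats_real: "closure (\<rat> :: real set) = UNIV"
proof -
  have "\<exists>q\<in>\<rat>. dist q x < e" if e: "0 < e" for x e :: real
  proof -
    obtain q where "q \<in> \<rat>" "x < q" "q < x + e" using Rats_dense_in_real[of x "x + e"] e by auto
    then show ?thesis by (intro bexI[of _ q]) (auto simp: dist_real_def)
  qed
  then show ?thesis by (auto simp: closure_approachable)
qed

section \<open>Change of measure and the drawdown near the horizon\<close>

locale drifted_brownian =
  fixes T \<mu> :: real and P :: "(real \<Rightarrow> real) measure"
  assumes T: "0 < T" and P: "drifted_brownian_law T \<mu> P"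
begin

sublocale prob_space P using P by (simp add: drifted_brownian_law_def)

lemma space_P [simp]: "space P = path_space T" and sets_P: "sets P = sets (path_algebra T)"
  using P by (auto simp: drifted_brownian_law_def)

end

locale brownian_change_of_measure = drifted_brownian T \<mu> P for T \<mu> P +
  fixes Q :: "(real \<Rightarrow> real) measure"
  assumes Q: "prob_space Q" and space_Q [simp]: "space Q = path_space T" and sets_Q: "sets Q = sets (path_algebra T)"
    and dQ_dP: "\<And>t. t \<in> {0..<T} \<Longrightarrow>
      restr_to_subalg Q (path_filtration T t) =
      density (restr_to_subalg P (path_filtration T t)) (\<lambda>\<omega>. ennreal (L_proc T \<mu> t \<omega>))"
begin

sublocale Q: prob_space Q by (rule Q)

section \<open>Transfer of integrals between the two measures\<close>

lemma path_filtration_subalgebra: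
  assumes "t \<in> {0..<T}"
  shows "subalgebra P (path_filtration T t)" "subalgebra Q (path_filtration T t)"
  using path_filtration_le_path_algebra[OF assms] by (auto simp: subalgebra_def sets_P sets_Q)

lemma measurable_natural:
  assumes "t \<in> {0..<T}" "f \<in> measurable (natural_filtration T t) N"
  shows "f \<in> measurable (path_filtration T t) N" "f \<in> measurable P N" "f \<in> measurable Q N"
proof -
  have "subalgebra (path_filtration T t) (natural_filtration T t)"
    using natural_filtration_le_path_filtration[of t T] assms by (simp add: subalgebra_def)
  then show "f \<in> measurable (path_filtration T t) N"
    using assms(2) by (rule measurable_from_subalg)
  then show "f \<in> measurable P N" "f \<in> measurable Q N"
    using path_filtration_subalgebra[OF assms(1)] by (auto intro: measurable_from_subalg)
qed

lemma L_proc_measurable_filtration: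
  assumes "t \<in> {0..<T}"
  shows "L_proc T \<mu> t \<in> borel_measurable (path_filtration T t)"
  using assms by (intro measurable_natural(1) L_proc_measurable) auto

lemma nn_integral_Q:
  assumes t: "t \<in> {0..<T}" and f: "f \<in> borel_measurable (path_filtration T t)"
  shows "(\<integral>\<^sup>+\<omega>. f \<omega> \<partial>Q) = (\<integral>\<^sup>+\<omega>. ennreal (L_proc T \<mu> t \<omega>) * f \<omega> \<partial>P)"
proof -
  note S = path_filtration_subalgebra[OF t]
  note L = L_proc_measurable_filtration[OF t]
  have "(\<integral>\<^sup>+\<omega>. f \<omega> \<partial>Q) = (\<integral>\<^sup>+\<omega>. f \<omega> \<partial>(restr_to_subalg Q (path_filtration T t)))"
    by (rule nn_integral_subalgebra2[OF S(2) f, symmetric])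
  also have "\<dots> = (\<integral>\<^sup>+\<omega>. ennreal (L_proc T \<mu> t \<omega>) * f \<omega> \<partial>(restr_to_subalg P (path_filtration T t)))"
    unfolding dQ_dP[OF t]
    by (intro nn_integral_density) (use L f in \<open>auto simp: measurable_cong_sets[OF sets_restr_to_subalg[OF S(1)] refl]\<close>)
  also have "\<dots> = (\<integral>\<^sup>+\<omega>. ennreal (L_proc T \<mu> t \<omega>) * f \<omega> \<partial>P)"
    by (rule nn_integral_subalgebra2[OF S(1)]) (use L f in measurable)
  finally show ?thesis .
qed

lemma integrable_Q_iff:
  assumes t: "t \<in> {0..<T}" and f: "f \<in> borel_measurable (path_filtration T t)"
  shows "integrable Q f \<longleftrightarrow> integrable P (\<lambda>\<omega>. L_proc T \<mu> t \<omega> * f \<omega>)" 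
    and integral_Q: "(LINT \<omega>|Q. f \<omega>) = (LINT \<omega>|P. L_proc T \<mu> t \<omega> * f \<omega> :: real)"
proof -
  note S = path_filtration_subalgebra[OF t]
  note L = L_proc_measurable_filtration[OF t]
  have M: "borel_measurable (restr_to_subalg P (path_filtration T t)) = borel_measurable (path_filtration T t)"
          "borel_measurable (restr_to_subalg Q (path_filtration T t)) = borel_measurable (path_filtration T t)"
    using S by (auto intro!: measurable_cong_sets sets_restr_to_subalg)
  have Lf: "(\<lambda>\<omega>. L_proc T \<mu> t \<omega> * f \<omega>) \<in> borel_measurable (path_filtration T t)" using L f by measurable
  have "integrable Q f \<longleftrightarrow> integrable (restr_to_subalg Q (path_filtration T t)) f"
    using integrable_from_subalg[OF S(2)] integrable_in_subalg[OF S(2) f] by blast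
  also have "\<dots> \<longleftrightarrow> integrable (restr_to_subalg P (path_filtration T t)) (\<lambda>\<omega>. L_proc T \<mu> t \<omega> * f \<omega>)"
    unfolding dQ_dP[OF t] by (subst integrable_density) (use L f L_proc_nonneg M in auto)
  also have "\<dots> \<longleftrightarrow> integrable P (\<lambda>\<omega>. L_proc T \<mu> t \<omega> * f \<omega>)"
    using integrable_from_subalg[OF S(1)] integrable_in_subalg[OF S(1) Lf] by blast
  finally show "integrable Q f \<longleftrightarrow> integrable P (\<lambda>\<omega>. L_proc T \<mu> t \<omega> * f \<omega>)" .
  have "(LINT \<omega>|Q. f \<omega>) = (LINT \<omega>|restr_to_subalg Q (path_filtration T t). f \<omega>)"
    by (rule integral_subalgebra2[OF S(2) f, symmetric])
  also have "\<dots> = (LINT \<omega>|restr_to_subalg P (path_filtration T t). L_proc T \<mu> t \<omega> * f \<omega>)"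
    unfolding dQ_dP[OF t] by (subst integral_density) (use L f L_proc_nonneg M in auto)
  also have "\<dots> = (LINT \<omega>|P. L_proc T \<mu> t \<omega> * f \<omega>)"
    by (rule integral_subalgebra2[OF S(1) Lf])
  finally show "(LINT \<omega>|Q. f \<omega>) = (LINT \<omega>|P. L_proc T \<mu> t \<omega> * f \<omega>)" .
qed

text \<open>Rational times make the event a countable intersection. The open interval allows
  \<open>t = T\<close>, although paths live on \<open>[0, T)\<close> only.\<close>

definition drawdown_ge :: "real \<Rightarrow> real \<Rightarrow> real \<Rightarrow> (real \<Rightarrow> real) set" where
  "drawdown_ge w u t = {\<omega> \<in> path_space T. \<forall>q\<in>\<rat> \<inter> {u<..<t}. w \<le> running_max q \<omega> - \<omega> q}"

lemma drawdown_ge_sets: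
  assumes "0 \<le> u" "t < T"
  shows "drawdown_ge w u t \<in> sets (natural_filtration T t)"
proof (cases "\<rat> \<inter> {u<..<t} = {}")
  \<comment> \<open>No rational time lies in the interval. This case is separate because an
    intersection over an empty index set would be \<open>UNIV\<close> rather than the path
    space.\<close>
  case True
  then have "drawdown_ge w u t = space (natural_filtration T t)" unfolding drawdown_ge_def by auto
  then show ?thesis by (simp only: sets.top)
next
  case False
  have "drawdown_ge w u t = (\<Inter>q\<in>\<rat> \<inter> {u<..<t}. {\<omega> \<in> space (natural_filtration T t). w \<le> running_max q \<omega> - \<omega> q})"
    using False unfolding drawdown_ge_def by auto
  also have "\<dots> \<in> sets (natural_filtration T t)"
  proof (rule sets.countable_INT'[OF _ False], goal_cases)
    case 2
    have "{\<omega> \<in> space (natural_filtration T t). w \<le> running_max q \<omega> - \<omega> q} \<in> sets (natural_filtration T t)"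
      if q: "q \<in> \<rat> \<inter> {u<..<t}" for q
    proof -
    have [measurable]: "running_max q \<in> borel_measurable (natural_filtration T t)"
       "(\<lambda>\<omega>. \<omega> q) \<in> borel_measurable (natural_filtration T t)" 
      using q assms by (auto intro!: running_max_measurable natural_filtration_coordinate)
    show ?thesis
      by measurable
    qed
    then show ?case by blast
  qed (intro countable_Int1 countable_rat)
  finally show ?thesis .
qed

text \<open>The drawdown is continuous and the rationals are dense in \<open>{u<..<t}\<close>, so
  the bound extends to the closed interval.\<close>

lemma drawdown_ge_D:
  assumes \<omega>: "\<omega> \<in> drawdown_ge w u t" and t: "0 \<le> u" "u < t" "t < T" and r: "r \<in> {u..t}"
  shows "w \<le> running_max r \<omega> - \<omega> r"
proof -
  have "\<omega> \<in> path_space T" using \<omega> by (simp add: drawdown_ge_def)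
  then have X: "continuous_on {0..t} \<omega>" using t by (intro path_space_continuous_on)
  have "closure (\<rat> \<inter> {u<..<t}) = closure {u<..<t}"
    using closure_open_Int_superset[of "{u<..<t}" \<rat>] by (simp add: closure_Rats_real Int_commute)
  then have cl: "closure (\<rat> \<inter> {u<..<t}) = {u..t}" using t by simp
  show ?thesis
  proof (rule continuous_ge_on_closure[where S="\<rat> \<inter> {u<..<t}" and f="\<lambda>r. running_max r \<omega> - \<omega> r"])
    show "continuous_on (closure (\<rat> \<inter> {u<..<t})) (\<lambda>r. running_max r \<omega> - \<omega> r)"
      unfolding cl using t running_max_continuous_on[OF X] X
      by (intro continuous_on_diff) (auto intro: continuous_on_subset)
  qed (use \<omega> r cl in \<open>auto simp: drawdown_ge_def\<close>)
qed

text \<open>Once the running maximum is frozen, the density is dominated by \<open>F_mu \<mu> (T - t) w\<close>, which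
  vanishes as \<open>t\<close> tends to \<open>T\<close>.\<close>

lemma drawdown_ge_null:
  assumes u: "0 \<le> u" "u < T" and w: "0 < w"
  shows "drawdown_ge w u T \<in> null_sets Q"
proof -
  define c where "c = f_mu \<mu> (T - u)"
  have c: "0 \<le> c" using u by (simp add: c_def f_mu_nonneg)
  \<comment> \<open>The bound on the density contains a random exponential of the rise of the path
    up to \<open>u\<close>. On \<open>A K\<close> that rise is at most \<open>K\<close>, and the
    sets \<open>A K\<close> exhaust the path space.\<close>
  define A where "A K = {\<omega> \<in> path_space T. running_max u \<omega> - \<omega> 0 \<le> real K}" for K
  have Am: "A K \<in> sets (natural_filtration T u)" for K
  proof -
    have [measurable]: "running_max u \<in> borel_measurable (natural_filtration T u)"
         "(\<lambda>\<omega>. \<omega> 0) \<in> borel_measurable (natural_filtration T u)"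
      using u by (auto intro!: running_max_measurable natural_filtration_coordinate)
    have "{\<omega> \<in> space (natural_filtration T u). running_max u \<omega> - \<omega> 0 \<le> real K} \<in> sets (natural_filtration T u)"
      by measurable
    then show ?thesis by (simp add: A_def)
  qed
  have sub: "drawdown_ge w u T \<inter> A K \<subseteq> drawdown_ge w u t \<inter> A K" if "t < T" for t K
    using that by (auto simp: drawdown_ge_def)
  have EQ: "drawdown_ge w u t \<inter> A K \<in> sets (natural_filtration T t)" if "u < t" "t < T" for t K
    using drawdown_ge_sets[OF u(1) that(2)] Am[of K] natural_filtration_mono[of u t T] that by auto
  have natQ: "sets (natural_filtration T t) \<subseteq> sets Q" if "0 \<le> t" "t < T" for t
    using natural_filtration_le_path_filtration[of t T] path_filtration_le_path_algebra[of t T] that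
    by (auto simp: sets_Q)
  \<comment> \<open>The offset 2 keeps \<open>t n\<close> strictly above \<open>u\<close> already
    for \<open>n = 0\<close>.\<close>
  define t where "t n = T - (T - u) / real (n + 2)" for n
  have t: "u < t n" "t n < T" for n
  proof -
    have "(T - u) / real (n + 2) < T - u" using u by (simp add: divide_less_eq)
    moreover have "0 < (T - u) / real (n + 2)" using u by simp
    ultimately show "u < t n" "t n < T" by (simp_all add: t_def)
  qed
  have ttend: "t \<longlonglongrightarrow> T"
  proof -
    have "(\<lambda>n. T - (T - u) / real (n + 2)) \<longlonglongrightarrow> T - 0"
      by real_asymp
    then show ?thesis by (simp add: t_def[abs_def])
  qed
  \<comment> \<open>The change of measure is available only before \<open>T\<close>, so the event at
    the horizon is approximated by events at times \<open>t n < T\<close>; this also yields its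
    measurability.\<close>
  have DT: "drawdown_ge w u T = (\<Inter>n. drawdown_ge w u (t n))"
  proof (intro equalityI subsetI)
    fix \<omega> assume "\<omega> \<in> (\<Inter>n. drawdown_ge w u (t n))"
    then have *: "\<omega> \<in> drawdown_ge w u (t n)" for n by auto
    show "\<omega> \<in> drawdown_ge w u T"
    proof -
      have "w \<le> running_max q \<omega> - \<omega> q" if q: "q \<in> \<rat> \<inter> {u<..<T}" for q
      proof -
        have "\<forall>\<^sub>F n in sequentially. q < t n" using order_tendstoD(1)[OF ttend] q by auto
        then obtain n where "q < t n" by (auto simp: eventually_sequentially)
        then show ?thesis using *[of n] q by (auto simp: drawdown_ge_def)
      qed
      then show ?thesis using *[of 0] by (auto simp: drawdown_ge_def)
    qed
  next
    fix \<omega> assume "\<omega> \<in> drawdown_ge w u T"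
    then have "\<omega> \<in> drawdown_ge w u (t n)" for n using t(2)[of n] by (auto simp: drawdown_ge_def)
    then show "\<omega> \<in> (\<Inter>n. drawdown_ge w u (t n))" by blast
  qed
  have DQ: "drawdown_ge w u T \<in> sets Q"
    unfolding DT using t u natQ drawdown_ge_sets[OF u(1)] by (intro sets.countable_INT) (auto, meson less_imp_le order_trans subsetD)
  have null: "emeasure Q (drawdown_ge w u T \<inter> A K) = 0" for K
  proof -
    have bound: "emeasure Q (drawdown_ge w u T \<inter> A K) \<le> ennreal (F_mu \<mu> (T - t n) w * exp (c * real K))" for n
    proof -
      let ?E = "drawdown_ge w u (t n) \<inter> A K"
      have t0: "t n \<in> {0..<T}" using t[of n] u by auto
      have Em: "?E \<in> sets (path_filtration T (t n))"
        using EQ[OF t(1,2)] natural_filtration_le_path_filtration[OF t(2)] by auto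
      then have EmP: "?E \<in> sets P" "?E \<in> sets Q"
        using path_filtration_le_path_algebra[OF t0] by (auto simp: sets_P sets_Q)
      have "emeasure Q (drawdown_ge w u T \<inter> A K) \<le> emeasure Q ?E"
        using sub[OF t(2)] EmP by (intro emeasure_mono)
      also have "\<dots> = (\<integral>\<^sup>+\<omega>. indicator ?E \<omega> \<partial>Q)" using EmP by simp
      also have "\<dots> = (\<integral>\<^sup>+\<omega>. ennreal (L_proc T \<mu> (t n) \<omega>) * indicator ?E \<omega> \<partial>P)"
        using Em by (intro nn_integral_Q t0) auto
      also have "\<dots> \<le> (\<integral>\<^sup>+\<omega>. ennreal (F_mu \<mu> (T - t n) w * exp (c * real K)) \<partial>P)"
      proof (rule nn_integral_mono)
        fix \<omega> assume "\<omega> \<in> space P"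
        then have \<omega>: "\<omega> \<in> path_space T" by simp
        show "ennreal (L_proc T \<mu> (t n) \<omega>) * indicator ?E \<omega> \<le> ennreal (F_mu \<mu> (T - t n) w * exp (c * real K))"
        proof (cases "\<omega> \<in> ?E")
          case True
          have X: "continuous_on {0..t n} \<omega>" using \<omega> t by (intro path_space_continuous_on) auto
          have dd: "w \<le> running_max r \<omega> - \<omega> r" if "r \<in> {u..t n}" for r
            using True u t that by (intro drawdown_ge_D[of \<omega> w u "t n"]) auto
          have const: "running_max r \<omega> = running_max u \<omega>" if "r \<in> {u..t n}" for r
            using that u w dd by (intro running_max_constant_if_drawdown_pos continuous_on_subset[OF X]) (fastforce intro: less_le_trans)+
          have "L_proc T \<mu> (t n) \<omega> \<le> F_mu \<mu> (T - t n) w * exp (f_mu \<mu> (T - u) * (running_max u \<omega> - \<omega> 0))"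
            by (rule L_proc_le[OF X u(1) _ t(2) _ _ const]) (use t(1)[of n] w dd[of "t n"] in auto)
          also have "\<dots> \<le> F_mu \<mu> (T - t n) w * exp (c * real K)"
          proof -
            have "c * (running_max u \<omega> - \<omega> 0) \<le> c * real K"
              using True c by (intro mult_left_mono) (auto simp: A_def)
            then show ?thesis using F_mu_pos[of \<mu> "T - t n" w] by (simp add: c_def)
          qed
          finally show ?thesis using True by (simp add: ennreal_leI)
        qed simp
      qed
      also have "\<dots> = ennreal (F_mu \<mu> (T - t n) w * exp (c * real K))" using emeasure_space_1 by simp
      finally show ?thesis .
    qed
    have "filterlim (\<lambda>n. T - t n) (at_right 0) sequentially"
      unfolding filterlim_at using tendsto_diff[OF tendsto_const ttend, of T] t(2) by (auto simp: eventually_sequentially)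
    from filterlim_compose[OF F_mu_tendsto_0[OF w] this]
    have "(\<lambda>n. F_mu \<mu> (T - t n) w * exp (c * real K)) \<longlonglongrightarrow> 0 * exp (c * real K)"
      by (intro tendsto_mult tendsto_const)
    then have "(\<lambda>n. ennreal (F_mu \<mu> (T - t n) w * exp (c * real K))) \<longlonglongrightarrow> 0"
      using tendsto_ennrealI by fastforce
    then have "emeasure Q (drawdown_ge w u T \<inter> A K) \<le> 0"
      using bound by (intro LIMSEQ_le_const) auto
    then show ?thesis by simp
  qed
  have "drawdown_ge w u T = (\<Union>K. drawdown_ge w u T \<inter> A K)"
    using real_arch_simple by (fastforce simp: A_def drawdown_ge_def)
  also have "\<dots> \<in> null_sets Q"
  proof (rule null_sets_UN)
    fix K show "drawdown_ge w u T \<inter> A K \<in> null_sets Q"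
      using null DQ Am[of K] natQ[of u] u by (intro null_setsI) auto
  qed
  finally show ?thesis .
qed

text \<open>The drawdown is nonnegative, so the claim fails only if it eventually stays above some
  \<open>1 / Suc n\<close> from a time \<open>T - T / Suc k\<close> on. These exceptional events are
  countably many null sets.\<close>

lemma prob_Liminf_drawdown_eq_0:
  "\<P>(\<omega> in Q. Liminf (at_left T) (\<lambda>t. ereal (running_max t \<omega> - \<omega> t)) = 0) = 1"
proof -
  define N where "N = (\<Union>(n, k). drawdown_ge (1 / real (Suc n)) (T - T / real (Suc k)) T)"
  have N: "N \<in> null_sets Q"
    unfolding N_def
  proof (rule null_sets_UN')
    fix p :: "nat \<times> nat"
    show "(case p of (n, k) \<Rightarrow> drawdown_ge (1 / real (Suc n)) (T - T / real (Suc k)) T) \<in> null_sets Q"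
      using T by (cases p) (auto intro!: drawdown_ge_null simp: field_simps)
  qed auto
  have "{\<omega> \<in> space Q. Liminf (at_left T) (\<lambda>t. ereal (running_max t \<omega> - \<omega> t)) = 0} = space Q - N"
  proof (intro equalityI subsetI)
    fix \<omega> assume \<omega>: "\<omega> \<in> {\<omega> \<in> space Q. Liminf (at_left T) (\<lambda>t. ereal (running_max t \<omega> - \<omega> t)) = 0}"
    have False if "\<omega> \<in> N"
    proof -
      from that obtain n k where nk: "\<omega> \<in> drawdown_ge (1 / real (Suc n)) (T - T / real (Suc k)) T"
        by (auto simp: N_def)
      define u where "u = T - T / real (Suc k)"
      have u: "0 \<le> u" "u < T" using T by (auto simp: u_def field_simps)
      have "\<forall>\<^sub>F t in at_left T. ereal (1 / real (Suc n)) \<le> ereal (running_max t \<omega> - \<omega> t)"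
      proof (rule eventually_at_leftI[OF _ u(2)])
        fix t assume t: "t \<in> {u<..<T}"
        have "\<omega> \<in> drawdown_ge (1 / real (Suc n)) u t" using nk t by (auto simp: drawdown_ge_def u_def)
        then show "ereal (1 / real (Suc n)) \<le> ereal (running_max t \<omega> - \<omega> t)"
          using drawdown_ge_D[of \<omega> _ u t t] u t by simp
      qed
      then have "ereal (1 / real (Suc n)) \<le> Liminf (at_left T) (\<lambda>t. ereal (running_max t \<omega> - \<omega> t))"
        by (rule Liminf_bounded)
      then show False using \<omega> by (simp add: zero_ereal_def)
    qed
    then show "\<omega> \<in> space Q - N" using \<omega> by auto
  next
    fix \<omega> assume \<omega>: "\<omega> \<in> space Q - N"
    have "\<forall>\<^sub>F t in at_left T. 0 \<le> ereal (running_max t \<omega> - \<omega> t)"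
    proof (rule eventually_at_leftI[OF _ T])
      fix t assume "t \<in> {0<..<T}"
      then show "0 \<le> ereal (running_max t \<omega> - \<omega> t)"
        using \<omega> by (auto intro!: running_max_upper path_space_continuous_on)
    qed
    then have "0 \<le> Liminf (at_left T) (\<lambda>t. ereal (running_max t \<omega> - \<omega> t))"
      by (rule Liminf_bounded)
    moreover have "\<not> 0 < Liminf (at_left T) (\<lambda>t. ereal (running_max t \<omega> - \<omega> t))"
    proof
      assume "0 < Liminf (at_left T) (\<lambda>t. ereal (running_max t \<omega> - \<omega> t))"
      then obtain c where c: "0 < c" "ereal c < Liminf (at_left T) (\<lambda>t. ereal (running_max t \<omega> - \<omega> t))"
        using ereal_dense2 ereal_less(2) by (metis (no_types, lifting))
      then have "\<forall>\<^sub>F t in at_left T. ereal c < ereal (running_max t \<omega> - \<omega> t)"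
        by (intro less_LiminfD)
      then obtain b where b: "b < T" "\<And>t. b < t \<Longrightarrow> t < T \<Longrightarrow> c < running_max t \<omega> - \<omega> t"
        by (auto simp: eventually_at_left[OF T])
      obtain n where n: "1 / real (Suc n) < c" using nat_approx_posE[OF c(1)] by (metis)
      have "0 < (T - b) / T" using b T by simp
      then obtain k where k: "1 / real (Suc k) < (T - b) / T" using nat_approx_posE by metis
      then have bk: "b < T - T / real (Suc k)" using T by (simp add: field_simps)
      have "\<omega> \<in> drawdown_ge (1 / real (Suc n)) (T - T / real (Suc k)) T"
        unfolding drawdown_ge_def
      proof (intro CollectI conjI ballI)
        fix q assume "q \<in> \<rat> \<inter> {T - T / real (Suc k)<..<T}"
        then have "c < running_max q \<omega> - \<omega> q" using bk by (intro b(2)) auto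
        then show "1 / real (Suc n) \<le> running_max q \<omega> - \<omega> q" using n by linarith
      qed (use \<omega> in simp)
      then show False using \<omega> by (auto simp: N_def)
    qed
    ultimately show "\<omega> \<in> {\<omega> \<in> space Q. Liminf (at_left T) (\<lambda>t. ereal (running_max t \<omega> - \<omega> t)) = 0}"
      using \<omega> by (auto simp: antisym_conv2)
  qed
  moreover have "measure Q N = 0" "N \<in> sets Q" using N by (auto simp: null_sets_def measure_def)
  ultimately show ?thesis using Q.prob_compl[of N] by simp
qed

end

section \<open>Independence of a single increment\<close>

text \<open>Positions after \<open>a\<close> are taken relative to the position at \<open>b\<close>;
  for the times \<open>r \<ge> b\<close> at which it is used, this removes the increment over
  \<open>[a, b]\<close>.\<close>

definition outer_coord :: "real \<Rightarrow> real \<Rightarrow> real \<Rightarrow> (real \<Rightarrow> real) \<Rightarrow> real" where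
  "outer_coord a b r \<omega> = (if r \<le> a then \<omega> r else \<omega> r - \<omega> b)"

text \<open>The information carried by a path outside \<open>(a, b)\<close>, except for the increment over \<open>[a, b]\<close>.\<close>

definition outer_algebra :: "real \<Rightarrow> real \<Rightarrow> real \<Rightarrow> (real \<Rightarrow> real) measure" where
  "outer_algebra T a b = sigma (path_space T)
     {{\<omega> \<in> path_space T. \<forall>r\<in>J. outer_coord a b r \<omega> \<in> C r} | J C.
        finite J \<and> J \<subseteq> {0..a} \<union> {b..<T} \<and> (\<forall>r. C r \<in> sets borel)}"

lemma space_outer_algebra [simp]: "space (outer_algebra T a b) = path_space T"
  unfolding outer_algebra_def by (simp add: space_measure_of_conv)

lemma sets_outer_algebra:
  "sets (outer_algebra T a b) = sigma_sets (path_space T)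
     {{\<omega> \<in> path_space T. \<forall>r\<in>J. outer_coord a b r \<omega> \<in> C r} | J C.
        finite J \<and> J \<subseteq> {0..a} \<union> {b..<T} \<and> (\<forall>r. C r \<in> sets borel)}"
  unfolding outer_algebra_def by (rule sets_measure_of) auto

lemma outer_coord_measurable:
  assumes "r \<in> {0..a} \<union> {b..<T}"
  shows "outer_coord a b r \<in> borel_measurable (outer_algebra T a b)"
proof (rule measurableI)
  fix A :: "real set" assume "A \<in> sets borel"
  moreover have "outer_coord a b r -` A \<inter> space (outer_algebra T a b) = 
      {\<omega> \<in> path_space T. \<forall>q\<in>{r}. outer_coord a b q \<omega> \<in> A}" by auto
  ultimately show "outer_coord a b r -` A \<inter> space (outer_algebra T a b) \<in> sets (outer_algebra T a b)"
    unfolding sets_outer_algebra using assms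
    by (simp only:, intro sigma_sets.Basic CollectI exI[of _ "{r}"] exI[of _ "\<lambda>_. A"]) auto
qed simp

lemma natural_filtration_le_outer_algebra:
  "sets (natural_filtration T a) \<subseteq> sets (outer_algebra T a b)"
proof -
  have "{\<omega> \<in> path_space T. \<omega> s \<in> B} \<in> sets (outer_algebra T a b)" if "s \<in> {0..a}" "B \<in> sets borel" for s B
  proof -
    have "outer_coord a b s -` B \<inter> space (outer_algebra T a b) \<in> sets (outer_algebra T a b)"
      using that by (intro measurable_sets[OF outer_coord_measurable]) auto
    moreover have "outer_coord a b s -` B \<inter> space (outer_algebra T a b) = {\<omega> \<in> path_space T. \<omega> s \<in> B}"
      using that by (auto simp: outer_coord_def)
    ultimately show ?thesis by simp
  qed
  then have "{{\<omega> \<in> path_space T. \<omega> s \<in> B} | s B. s \<in> {0..a} \<and> B \<in> sets borel} \<subseteq> sets (outer_algebra T a b)"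
    by blast
  from sets.sigma_sets_subset[OF this] show ?thesis by (simp add: sets_natural_filtration)
qed

lemma natural_filtration_measurable_outer:
  "f \<in> measurable (natural_filtration T a) N \<Longrightarrow> f \<in> measurable (outer_algebra T a b) N"
  by (erule measurable_from_subalg[rotated])
     (unfold subalgebra_def, intro conjI natural_filtration_le_outer_algebra, simp)

lemma incr_measurable_outer:
  assumes "0 \<le> u" "u \<le> v" "v < T" "v \<le> a \<or> b \<le> u" "a < b"
  shows "(\<lambda>\<omega>. \<omega> v - \<omega> u) \<in> borel_measurable (outer_algebra T a b)"
proof -
  have "(\<lambda>\<omega>. outer_coord a b v \<omega> - outer_coord a b u \<omega>) \<in> borel_measurable (outer_algebra T a b)"
    using assms by (intro borel_measurable_diff outer_coord_measurable) auto
  moreover have "(\<lambda>\<omega>. outer_coord a b v \<omega> - outer_coord a b u \<omega>) = (\<lambda>\<omega>. \<omega> v - \<omega> u)"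
    using assms by (auto simp: outer_coord_def fun_eq_iff)
  ultimately show ?thesis by simp
qed

text \<open>Brings a finite set of times into the form in which \<open>drifted_brownian_law\<close>
  provides independence, namely consecutive increments along increasing times.\<close>

lemma finite_set_strict_enumeration:
  fixes J :: "'a::linorder set"
  assumes "finite J" "J \<noteq> {}"
  shows "\<exists>u N. J = u ` {..N::nat} \<and> strict_mono_on {..N} u"
proof (intro exI conjI)
  let ?l = "sorted_list_of_set J"
  have len: "length ?l = Suc (card J - 1)" using assms by (simp add: card_gt_0_iff)
  have "J = set ?l" using assms by simp
  also have "\<dots> = (\<lambda>i. ?l ! i) ` {..<length ?l}" by (auto simp: set_conv_nth)
  also have "{..<length ?l} = {..card J - 1}" unfolding len by (rule lessThan_Suc_atMost)
  finally show "J = (\<lambda>i. ?l ! i) ` {..card J - 1}" .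
  show "strict_mono_on {..card J - 1} (\<lambda>i. ?l ! i)"
    using len by (intro strict_mono_onI sorted_wrt_nth_less[OF strict_sorted_list_of_set]) auto
qed

context drifted_brownian
begin

section \<open>Joint law of one increment and the rest of the path\<close>

lemma measurable_natural_P:
  assumes "t \<in> {0..<T}" "f \<in> measurable (natural_filtration T t) N"
  shows "f \<in> measurable P N"
proof -
  have "subalgebra P (natural_filtration T t)"
    using natural_filtration_le_path_filtration[of t T] path_filtration_le_path_algebra[of t T] assms(1)
    by (auto simp: subalgebra_def sets_P)
  then show ?thesis using assms(2) by (rule measurable_from_subalg)
qed

lemma coordinate_measurable [measurable]: "t \<in> {0..<T} \<Longrightarrow> (\<lambda>\<omega>. \<omega> t) \<in> borel_measurable P"
  by (rule measurable_natural_P[of t], assumption, rule natural_filtration_coordinate) simp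

lemma AE_start_0: "AE \<omega> in P. \<omega> 0 = 0"
  using P unfolding drifted_brownian_law_def by (elim conjE)

lemma distr_incr:
  assumes "0 \<le> s" "s < t" "t < T"
  shows "distr P borel (\<lambda>\<omega>. \<omega> t - \<omega> s) = density lborel (normal_density (\<mu> * (t - s)) (sqrt (t - s)))"
proof -
  have "distributed P lborel (\<lambda>\<omega>. \<omega> t - \<omega> s) (normal_density (\<mu> * (t - s)) (sqrt (t - s)))"
    using P assms by (simp add: drifted_brownian_law_def)
  from distributed_distr_eq_density[OF this] show ?thesis
    by (simp add: distr_cong[OF refl sets_lborel[symmetric] refl])
qed

lemma indep_incr_vars:
  fixes u :: "nat \<Rightarrow> real"
  assumes "0 \<le> u 0" "\<And>i. i < n \<Longrightarrow> u i < u (Suc i)" "u n < T"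
  shows "indep_vars (\<lambda>_. borel) (\<lambda>i \<omega>. \<omega> (u (Suc i)) - \<omega> (u i)) {..<n}"
proof -
  have "\<forall>(n::nat) u. 0 \<le> u 0 \<and> (\<forall>i<n. u i < u (Suc i)) \<and> u n < T \<longrightarrow>
        indep_vars (\<lambda>_. borel) (\<lambda>i \<omega>. \<omega> (u (Suc i)) - \<omega> (u i)) {..<n}"
    using P unfolding drifted_brownian_law_def by (elim conjE)
  from this[rule_format, of u n] show ?thesis using assms by simp
qed

lemma outer_cylinder_event:
  assumes ab: "0 \<le> a" "a < b" "b < T" and J: "finite J" "J \<subseteq> {0..a} \<union> {b..<T}"
    and C: "\<And>r. C r \<in> sets borel"
  shows "{\<omega> \<in> path_space T. \<forall>r\<in>J. outer_coord a b r \<omega> \<in> C r} \<in> events"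
proof -
  have om: "outer_coord a b r \<in> borel_measurable P" if "r \<in> J" for r
  proof -
    have "r \<in> {0..<T}" "b \<in> {0..<T}" using J that ab by auto
    note [measurable] = this[THEN coordinate_measurable]
    show ?thesis unfolding outer_coord_def[abs_def] by measurable
  qed
  have "{\<omega> \<in> space P. \<forall>r\<in>J. outer_coord a b r \<omega> \<in> C r} \<in> events"
  proof (rule sets.sets_Collect_finite_All)
    fix r assume "r \<in> J"
    note [measurable] = om[OF this]
    show "{\<omega> \<in> space P. outer_coord a b r \<omega> \<in> C r} \<in> events" using C by measurable
  qed (rule J)
  then show ?thesis by simp
qed

text \<open>After \<open>0\<close>, \<open>a\<close> and \<open>b\<close> are added to the times and
  all are enumerated increasingly, \<open>a\<close> and \<open>b\<close> are neighbours, because no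
  time lies strictly between them. The increment over \<open>[a, b]\<close> is then one consecutive
  increment, and every outer coordinate is a sum of other ones.\<close>

lemma prob_outer_cylinder_incr:
  assumes ab: "0 \<le> a" "a < b" "b < T" and J: "finite J" "J \<subseteq> {0..a} \<union> {b..<T}"
    and C: "\<And>r. C r \<in> sets borel" and B: "B \<in> sets borel"
  shows "prob ({\<omega> \<in> path_space T. \<forall>r\<in>J. outer_coord a b r \<omega> \<in> C r} \<inter> {\<omega> \<in> path_space T. \<omega> b - \<omega> a \<in> B}) =
    prob {\<omega> \<in> path_space T. \<forall>r\<in>J. outer_coord a b r \<omega> \<in> C r} * prob {\<omega> \<in> path_space T. \<omega> b - \<omega> a \<in> B}"
proof -
  define J' where "J' = J \<union> {0, a, b}"
  have J': "finite J'" "J' \<noteq> {}" "J' \<subseteq> {0..a} \<union> {b..<T}" using J ab by (auto simp: J'_def)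
  obtain u :: "nat \<Rightarrow> real" and N where u1: "J' = u ` {..N}" and u2: "strict_mono_on {..N} u"
    using finite_set_strict_enumeration[OF J'(1,2)] by blast
  have u: "J' = u ` {..N}" "\<And>i j. i < j \<Longrightarrow> j \<le> N \<Longrightarrow> u i < u j"
    using u1 strict_mono_onD[OF u2] by auto
  have ui: "u i \<in> {0..a} \<union> {b..<T}" if "i \<le> N" for i using u(1) J' that by auto
  have u_le: "i \<le> j" if "u i \<le> u j" "i \<le> N" "j \<le> N" for i j
    using u(2)[of j i] that by (meson not_le)
  have "0 \<in> J'" "a \<in> J'" "b \<in> J'" by (auto simp: J'_def)
  then have "0 \<in> u ` {..N}" "a \<in> u ` {..N}" "b \<in> u ` {..N}" by (simp_all only: u(1))
  then obtain i0 k m where ik: "i0 \<le> N" "u i0 = 0" "k \<le> N" "u k = a" "m \<le> N" "u m = b"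
    by (metis atMost_iff imageE)
  have u0: "u 0 = 0"
  proof -
    have "u 0 \<le> u i0" using u(2)[of 0 i0] ik(1) by (cases "i0 = 0") (auto intro: less_imp_le)
    then show ?thesis using ui[of 0] ik ab by auto
  qed
  have km: "m = Suc k"
  proof -
    have "k < m" using u(2)[of m k] ik ab by (cases m k rule: linorder_cases) auto
    moreover have "\<not> Suc k < m"
    proof
      assume "Suc k < m"
      then have "a < u (Suc k)" "u (Suc k) < b" using u(2)[of k "Suc k"] u(2)[of "Suc k" m] ik by auto
      then show False using ui[of "Suc k"] \<open>Suc k < m\<close> ik by auto
    qed
    ultimately show ?thesis by simp
  qed
  have kN: "k < N" using km ik by simp
  define \<Delta> where "\<Delta> i \<omega> = \<omega> (u (Suc i)) - \<omega> (u i)" for i and \<omega> :: "real \<Rightarrow> real"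
  \<comment> \<open>Indices of the increments that add up to the outer coordinate at time
    \<open>u i\<close>: counted from time \<open>0\<close> up to \<open>a\<close>, and from
    \<open>b = u (Suc k)\<close> afterwards. The index \<open>k\<close> never occurs.\<close>
  define D where "D i = (if i \<le> k then {..<i} else {Suc k..<i})" for i
  define I where "I = {..<N} - {k}"
  have D: "D i \<subseteq> I" if "i \<le> N" for i using that by (auto simp: D_def I_def)
  have ind: "indep_vars (\<lambda>_. borel) \<Delta> {..<N}"
    unfolding \<Delta>_def using u u0 ui[of N] ab by (intro indep_incr_vars) auto
  have iv: "indep_var (PiM I (\<lambda>_. borel)) (\<lambda>\<omega>. restrict (\<lambda>i. \<Delta> i \<omega>) I)
      (PiM {k} (\<lambda>_. borel)) (\<lambda>\<omega>. restrict (\<lambda>i. \<Delta> i \<omega>) {k})"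
    by (rule indep_var_restrict[OF ind]) (use kN in \<open>auto simp: I_def\<close>)
  define B' where "B' = {f \<in> space (PiM {k} (\<lambda>_. borel :: real measure)). f k \<in> B}"
  have Bm: "B' \<in> sets (PiM {k} (\<lambda>_. borel))"
    unfolding B'_def using B by measurable
  define S where "S = {i. i \<le> N \<and> u i \<in> J}"
  have JS: "J = u ` S" using u(1) by (auto simp: J'_def S_def)
  have S: "finite S" "\<And>i. i \<in> S \<Longrightarrow> i \<le> N" by (auto simp: S_def)
  define A where "A = {f \<in> space (PiM I (\<lambda>_. borel :: real measure)). \<forall>i\<in>S. (\<Sum>l\<in>D i. f l) \<in> C (u i)}"
  have Am: "A \<in> sets (PiM I (\<lambda>_. borel))"
    unfolding A_def
  proof (rule sets.sets_Collect_finite_All)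
    fix i assume i: "i \<in> S"
    have [measurable]: "(\<lambda>f. \<Sum>l\<in>D i. f l) \<in> borel_measurable (PiM I (\<lambda>_. borel :: real measure))"
      using D[OF S(2)[OF i]] by (intro borel_measurable_sum measurable_component_singleton) auto
    show "{f \<in> space (PiM I (\<lambda>_. borel)). (\<Sum>l\<in>D i. f l) \<in> C (u i)} \<in> sets (PiM I (\<lambda>_. borel :: real measure))"
      using C by measurable
  qed (rule S(1))
  have V: "outer_coord a b (u i) \<omega> = (\<Sum>l\<in>D i. \<Delta> l \<omega>)" if i: "i \<le> N" and \<omega>: "\<omega> 0 = 0" for i \<omega>
  proof (cases "i \<le> k")
    case True
    then have "u i \<le> a" using u(2)[of i k] ik by (cases "i = k") auto
    then show ?thesis using True \<omega> u0 
      by (simp add: outer_coord_def D_def \<Delta>_def sum_lessThan_telescope[of "\<lambda>i. \<omega> (u i)"])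
  next
    case False
    then have "\<not> u i \<le> a" using u(2)[of k i] ik i by auto
    moreover have "(\<Sum>l\<in>{Suc k..<i}. \<omega> (u (Suc l)) - \<omega> (u l)) = \<omega> (u i) - \<omega> (u (Suc k))"
      using False by (intro sum_Suc_diff') auto
    ultimately show ?thesis using False ik km by (simp add: outer_coord_def D_def \<Delta>_def)
  qed
  define E where "E = {\<omega> \<in> path_space T. \<forall>r\<in>J. outer_coord a b r \<omega> \<in> C r}"
  define E' where "E' = (\<lambda>\<omega>. restrict (\<lambda>i. \<Delta> i \<omega>) I) -` A \<inter> space P"
  define G where "G = {\<omega> \<in> path_space T. \<omega> b - \<omega> a \<in> B}"
  have Gd: "G = (\<lambda>\<omega>. restrict (\<lambda>i. \<Delta> i \<omega>) {k}) -` B' \<inter> space P" using ik km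
    by (auto simp: G_def \<Delta>_def B'_def space_PiM)
  have Em: "E \<in> events" unfolding E_def by (rule outer_cylinder_event[OF ab J C])
  have E'm: "E' \<in> events" "G \<in> events"
  proof -
    have rv: "random_variable (PiM I (\<lambda>_. borel)) (\<lambda>\<omega>. restrict (\<lambda>i. \<Delta> i \<omega>) I)"
      "random_variable (PiM {k} (\<lambda>_. borel)) (\<lambda>\<omega>. restrict (\<lambda>i. \<Delta> i \<omega>) {k})"
      using iv unfolding indep_var_eq by blast+
    show "E' \<in> events" "G \<in> events"
      unfolding E'_def Gd by (rule measurable_sets[OF rv(1) Am], rule measurable_sets[OF rv(2) Bm])
  qed
  \<comment> \<open>Only almost sure, since writing a position as a sum of increments requires the
    path to start at \<open>0\<close>.\<close>
  have EE': "AE \<omega> in P. \<omega> \<in> E \<longleftrightarrow> \<omega> \<in> E'"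
    using AE_start_0 AE_space
  proof eventually_elim
    case (elim \<omega>)
    have "(\<forall>r\<in>J. outer_coord a b r \<omega> \<in> C r) \<longleftrightarrow> (\<forall>i\<in>S. outer_coord a b (u i) \<omega> \<in> C (u i))"
      unfolding JS by simp
    also have "\<dots> \<longleftrightarrow> (\<forall>i\<in>S. (\<Sum>l\<in>D i. restrict (\<lambda>i. \<Delta> i \<omega>) I l) \<in> C (u i))"
    proof (intro ball_cong refl)
      fix i assume "i \<in> S"
      then have "(\<Sum>l\<in>D i. restrict (\<lambda>i. \<Delta> i \<omega>) I l) = (\<Sum>l\<in>D i. \<Delta> l \<omega>)"
        using D[of i] S(2)[of i] by (intro sum.cong) auto
      then show "(outer_coord a b (u i) \<omega> \<in> C (u i)) = ((\<Sum>l\<in>D i. restrict (\<lambda>i. \<Delta> i \<omega>) I l) \<in> C (u i))"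
        using V S(2)[of i] \<open>i \<in> S\<close> elim by simp
    qed
    finally show ?case using elim by (simp add: E_def E'_def A_def space_PiM)
  qed
  have "prob (E \<inter> G) = prob (E' \<inter> G)"
    by (rule finite_measure_eq_AE) (use EE' Em E'm in \<open>auto elim: AE_mp\<close>)
  also have "E' \<inter> G = (\<lambda>\<omega>. (restrict (\<lambda>i. \<Delta> i \<omega>) I, restrict (\<lambda>i. \<Delta> i \<omega>) {k})) -` (A \<times> B') \<inter> space P"
    by (auto simp: E'_def Gd)
  also have "prob \<dots> = prob E' * prob G"
    unfolding E'_def Gd by (rule indep_varD[OF iv Am Bm])
  also have "prob E' = prob E"
    by (rule finite_measure_eq_AE) (use EE' Em E'm in \<open>auto elim: AE_mp\<close>)
  finally show ?thesis unfolding E_def G_def .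
qed

text \<open>Both generating families are closed under intersection, so independence extends from
  cylinders to the generated sigma-algebras.\<close>

lemma indep_set_outer_incr:
  assumes ab: "0 \<le> a" "a < b" "b < T"
  shows "indep_set (sets (outer_algebra T a b)) {{\<omega> \<in> path_space T. \<omega> b - \<omega> a \<in> B} | B. B \<in> sets borel}"
proof -
  let ?A = "{{\<omega> \<in> path_space T. \<forall>r\<in>J. outer_coord a b r \<omega> \<in> C r} | J C.
        finite J \<and> J \<subseteq> {0..a} \<union> {b..<T} \<and> (\<forall>r. C r \<in> sets borel)}"
  let ?B = "{{\<omega> \<in> path_space T. \<omega> b - \<omega> a \<in> B} | B. B \<in> sets borel}"
  have [measurable]: "(\<lambda>\<omega>. \<omega> a) \<in> borel_measurable P" "(\<lambda>\<omega>. \<omega> b) \<in> borel_measurable P" using ab by auto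
  have subA: "?A \<subseteq> events" using outer_cylinder_event[OF ab] by blast
  have subB: "?B \<subseteq> events"
  proof clarify
    fix B :: "real set" assume [measurable]: "B \<in> sets borel"
    have "{\<omega> \<in> space P. \<omega> b - \<omega> a \<in> B} \<in> events" by measurable
    then show "{\<omega> \<in> path_space T. \<omega> b - \<omega> a \<in> B} \<in> events" by simp
  qed
  have "indep_set ?A ?B"
    using subA subB by (rule indep_setI) (use prob_outer_cylinder_incr[OF ab] in blast)
  moreover have "Int_stable ?A"
  proof (rule Int_stableI)
    fix X Y assume "X \<in> ?A" "Y \<in> ?A"
    then obtain J C J' C' where X: "X = {\<omega> \<in> path_space T. \<forall>r\<in>J. outer_coord a b r \<omega> \<in> C r}" "finite J" "J \<subseteq> {0..a} \<union> {b..<T}" "\<forall>r. C r \<in> sets borel"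
      and Y: "Y = {\<omega> \<in> path_space T. \<forall>r\<in>J'. outer_coord a b r \<omega> \<in> C' r}" "finite J'" "J' \<subseteq> {0..a} \<union> {b..<T}" "\<forall>r. C' r \<in> sets borel"
      by blast
    \<comment> \<open>Constraints missing in one of the two cylinders are filled in with
      \<open>UNIV\<close>, which gives the intersection the common index set
      \<open>J \<union> J'\<close>.\<close>
    define C'' where "C'' r = (if r \<in> J then C r else UNIV) \<inter> (if r \<in> J' then C' r else UNIV)" for r
    have "X \<inter> Y = {\<omega> \<in> path_space T. \<forall>r\<in>J \<union> J'. outer_coord a b r \<omega> \<in> C'' r}"
      unfolding X(1) Y(1) C''_def by auto
    moreover have "\<forall>r. C'' r \<in> sets borel" using X(4) Y(4) by (auto simp: C''_def)
    ultimately show "X \<inter> Y \<in> ?A" using X(2,3) Y(2,3)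
      by (intro CollectI exI[of _ "J \<union> J'"] exI[of _ C'']) auto
  qed
  moreover have "Int_stable ?B"
  proof (rule Int_stableI)
    fix X Y assume "X \<in> ?B" "Y \<in> ?B"
    then obtain B B' where "X = {\<omega> \<in> path_space T. \<omega> b - \<omega> a \<in> B}" "Y = {\<omega> \<in> path_space T. \<omega> b - \<omega> a \<in> B'}"
       "B \<in> sets borel" "B' \<in> sets borel" by blast
    then show "X \<inter> Y \<in> ?B" by (intro CollectI exI[of _ "B \<inter> B'"]) auto
  qed
  ultimately have ind: "indep_set (sigma_sets (space P) ?A) (sigma_sets (space P) ?B)"
    by (rule indep_set_sigma_sets)
  then have "indep_set (sets (outer_algebra T a b)) (sigma_sets (space P) ?B)"
    by (simp add: sets_outer_algebra)
  then show ?thesis unfolding indep_sets2_eq by blast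
qed

lemma outer_algebra_measurable_P:
  assumes ab: "0 \<le> a" "a < b" "b < T"
  shows "(\<lambda>\<omega>. \<omega>) \<in> measurable P (outer_algebra T a b)" "(\<lambda>\<omega>. \<omega> b - \<omega> a) \<in> borel_measurable P"
proof -
  have sub: "sets (outer_algebra T a b) \<subseteq> events"
    using indep_setD_ev1[OF indep_set_outer_incr[OF ab]] .
  show "(\<lambda>\<omega>. \<omega>) \<in> measurable P (outer_algebra T a b)"
  proof (rule measurableI)
    fix A assume A: "A \<in> sets (outer_algebra T a b)"
    then have "(\<lambda>\<omega>. \<omega>) -` A \<inter> space P = A" using sets.sets_into_space[OF A] by auto
    then show "(\<lambda>\<omega>. \<omega>) -` A \<inter> space P \<in> events" using A sub by auto
  qed simp
  have [measurable]: "(\<lambda>\<omega>. \<omega> a) \<in> borel_measurable P" "(\<lambda>\<omega>. \<omega> b) \<in> borel_measurable P" using ab by auto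
  show "(\<lambda>\<omega>. \<omega> b - \<omega> a) \<in> borel_measurable P" by measurable
qed

text \<open>Independence in the form required by Fubini. The first component is the whole path, but
  seen through the outer algebra only, so a function of it cannot detect the increment over
  \<open>[a, b]\<close>.\<close>

lemma distr_outer_incr:
  assumes ab: "0 \<le> a" "a < b" "b < T"
  shows "distr P (outer_algebra T a b \<Otimes>\<^sub>M borel) (\<lambda>\<omega>. (\<omega>, \<omega> b - \<omega> a)) =
    distr P (outer_algebra T a b) (\<lambda>\<omega>. \<omega>) \<Otimes>\<^sub>M density lborel (normal_density (\<mu> * (b - a)) (sqrt (b - a)))"
proof -
  note [measurable] = outer_algebra_measurable_P[OF ab]
  let ?O = "distr P (outer_algebra T a b) (\<lambda>\<omega>. \<omega>)" and ?N = "distr P borel (\<lambda>\<omega>. \<omega> b - \<omega> a)"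
  interpret O: prob_space ?O by (intro prob_space_distr) measurable
  interpret N: prob_space ?N by (intro prob_space_distr) measurable
  have "?O \<Otimes>\<^sub>M ?N = distr P (outer_algebra T a b \<Otimes>\<^sub>M borel) (\<lambda>\<omega>. (\<omega>, \<omega> b - \<omega> a))"
  proof (rule pair_measure_eqI)
    fix A B assume "A \<in> sets ?O" "B \<in> sets ?N"
    then have A: "A \<in> sets (outer_algebra T a b)" and B: "B \<in> sets borel" by auto
    have AP: "A \<inter> path_space T = A" using sets.sets_into_space[OF A] by auto
    have BP: "(\<lambda>\<omega>. \<omega> b - \<omega> a) -` B \<inter> path_space T = {\<omega> \<in> path_space T. \<omega> b - \<omega> a \<in> B}" by auto
    have AB: "(\<lambda>\<omega>. (\<omega>, \<omega> b - \<omega> a)) -` (A \<times> B) \<inter> path_space T = A \<inter> {\<omega> \<in> path_space T. \<omega> b - \<omega> a \<in> B}"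
      using sets.sets_into_space[OF A] by auto
    have "prob (A \<inter> {\<omega> \<in> path_space T. \<omega> b - \<omega> a \<in> B}) = prob A * prob {\<omega> \<in> path_space T. \<omega> b - \<omega> a \<in> B}"
      using B by (intro indep_setD[OF indep_set_outer_incr[OF ab] A]) blast
    then show "emeasure ?O A * emeasure ?N B =
      emeasure (distr P (outer_algebra T a b \<Otimes>\<^sub>M borel) (\<lambda>\<omega>. (\<omega>, \<omega> b - \<omega> a))) (A \<times> B)"
      using A B by (simp add: emeasure_distr AP BP AB emeasure_eq_measure ennreal_mult)
  next
    show "sets (?O \<Otimes>\<^sub>M ?N) = sets (distr P (outer_algebra T a b \<Otimes>\<^sub>M borel) (\<lambda>\<omega>. (\<omega>, \<omega> b - \<omega> a)))"
      by (simp only: sets_distr) (intro sets_pair_measure_cong sets_distr)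
  qed (rule O.sigma_finite_measure_axioms N.sigma_finite_measure_axioms)+
  then show ?thesis by (simp add: distr_incr[OF ab])
qed

text \<open>The increment is replaced by an independent Gaussian variable while the rest of the path
  is frozen. This nonnegative version serves the exponential moments, where integrability is still
  to be shown; the version for real integrands serves the sign argument.\<close>

lemma nn_integral_outer_incr:
  assumes ab: "0 \<le> a" "a < b" "b < T" and h: "h \<in> borel_measurable (outer_algebra T a b \<Otimes>\<^sub>M borel)"
  shows "(\<integral>\<^sup>+\<omega>. h (\<omega>, \<omega> b - \<omega> a) \<partial>P) =
    (\<integral>\<^sup>+\<omega>. (\<integral>\<^sup>+y. ennreal (normal_density (\<mu> * (b - a)) (sqrt (b - a)) y) * h (\<omega>, y) \<partial>lborel) \<partial>P)"
proof -
  note [measurable] = outer_algebra_measurable_P[OF ab]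
  let ?N = "density lborel (normal_density (\<mu> * (b - a)) (sqrt (b - a)))"
  let ?O = "distr P (outer_algebra T a b) (\<lambda>\<omega>. \<omega>)"
  interpret N: prob_space ?N using ab by (intro prob_space_normal_density) auto
  have hm: "h \<in> borel_measurable (?O \<Otimes>\<^sub>M ?N)" 
    using h by (simp cong: measurable_cong_sets sets_pair_measure_cong)
  have "(\<integral>\<^sup>+\<omega>. h (\<omega>, \<omega> b - \<omega> a) \<partial>P) = (\<integral>\<^sup>+p. h p \<partial>distr P (outer_algebra T a b \<Otimes>\<^sub>M borel) (\<lambda>\<omega>. (\<omega>, \<omega> b - \<omega> a)))"
    using h by (subst nn_integral_distr) auto
  also have "\<dots> = (\<integral>\<^sup>+\<omega>. (\<integral>\<^sup>+y. h (\<omega>, y) \<partial>?N) \<partial>?O)"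
    unfolding distr_outer_incr[OF ab] using hm by (rule N.nn_integral_fst[symmetric])
  also have "\<dots> = (\<integral>\<^sup>+\<omega>. (\<integral>\<^sup>+y. h (\<omega>, y) \<partial>?N) \<partial>P)"
  proof (rule nn_integral_distr)
    show "(\<lambda>\<omega>. (\<integral>\<^sup>+y. h (\<omega>, y) \<partial>?N)) \<in> borel_measurable ?O"
      using N.borel_measurable_nn_integral_fst[of h "outer_algebra T a b"] h
      by (simp cong: measurable_cong_sets sets_pair_measure_cong)
  qed (rule outer_algebra_measurable_P[OF ab])
  also have "\<dots> = (\<integral>\<^sup>+\<omega>. (\<integral>\<^sup>+y. ennreal (normal_density (\<mu> * (b - a)) (sqrt (b - a)) y) * h (\<omega>, y) \<partial>lborel) \<partial>P)"
  proof (rule nn_integral_cong)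
    fix \<omega> assume "\<omega> \<in> space P"
    then have "Pair \<omega> \<in> measurable borel (outer_algebra T a b \<Otimes>\<^sub>M borel)" by (intro measurable_Pair1') simp
    from measurable_compose[OF this h] have "(\<lambda>y. h (\<omega>, y)) \<in> borel_measurable borel" .
    then show "(\<integral>\<^sup>+y. h (\<omega>, y) \<partial>?N) = (\<integral>\<^sup>+y. ennreal (normal_density (\<mu> * (b - a)) (sqrt (b - a)) y) * h (\<omega>, y) \<partial>lborel)"
      by (intro nn_integral_density) auto
  qed
  finally show ?thesis .
qed

lemma integral_outer_incr:
  fixes h :: "(real \<Rightarrow> real) \<times> real \<Rightarrow> real"
  assumes ab: "0 \<le> a" "a < b" "b < T" and h: "h \<in> borel_measurable (outer_algebra T a b \<Otimes>\<^sub>M borel)"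
    and int: "integrable P (\<lambda>\<omega>. h (\<omega>, \<omega> b - \<omega> a))"
  shows "(LINT \<omega>|P. h (\<omega>, \<omega> b - \<omega> a)) =
    (LINT \<omega>|P. (LINT y|lborel. normal_density (\<mu> * (b - a)) (sqrt (b - a)) y * h (\<omega>, y)))"
proof -
  note [measurable] = outer_algebra_measurable_P[OF ab]
  let ?N = "density lborel (normal_density (\<mu> * (b - a)) (sqrt (b - a)))"
  let ?O = "distr P (outer_algebra T a b) (\<lambda>\<omega>. \<omega>)"
  interpret N: prob_space ?N using ab by (intro prob_space_normal_density) auto
  interpret O: prob_space ?O by (intro prob_space_distr) measurable
  interpret ON: pair_sigma_finite ?O ?N ..
  have "integrable (distr P (outer_algebra T a b \<Otimes>\<^sub>M borel) (\<lambda>\<omega>. (\<omega>, \<omega> b - \<omega> a))) h"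
    using h int by (subst integrable_distr_eq) auto
  then have int': "integrable (?O \<Otimes>\<^sub>M ?N) h" by (simp only: distr_outer_incr[OF ab])
  have "(LINT \<omega>|P. h (\<omega>, \<omega> b - \<omega> a)) = (LINT p|distr P (outer_algebra T a b \<Otimes>\<^sub>M borel) (\<lambda>\<omega>. (\<omega>, \<omega> b - \<omega> a)). h p)"
    using h by (subst integral_distr) auto
  also have "\<dots> = (LINT \<omega>|?O. (LINT y|?N. h (\<omega>, y)))"
    unfolding distr_outer_incr[OF ab] using int' by (rule ON.integral_fst'[symmetric])
  also have "\<dots> = (LINT \<omega>|P. (LINT y|?N. h (\<omega>, y)))"
  proof (rule integral_distr)
    show "(\<lambda>\<omega>. (LINT y|?N. h (\<omega>, y))) \<in> borel_measurable (outer_algebra T a b)"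
      using N.borel_measurable_lebesgue_integral[of "\<lambda>\<omega> y. h (\<omega>, y)" "outer_algebra T a b"] h
      by (simp cong: measurable_cong_sets sets_pair_measure_cong)
  qed (rule outer_algebra_measurable_P[OF ab])
  also have "\<dots> = (LINT \<omega>|P. (LINT y|lborel. normal_density (\<mu> * (b - a)) (sqrt (b - a)) y * h (\<omega>, y)))"
  proof (rule Bochner_Integration.integral_cong[OF refl])
    fix \<omega> assume "\<omega> \<in> space P"
    then have "Pair \<omega> \<in> measurable borel (outer_algebra T a b \<Otimes>\<^sub>M borel)" by (intro measurable_Pair1') simp
    from measurable_compose[OF this h] have "(\<lambda>y. h (\<omega>, y)) \<in> borel_measurable borel" .
    then show "(LINT y|?N. h (\<omega>, y)) = (LINT y|lborel. normal_density (\<mu> * (b - a)) (sqrt (b - a)) y * h (\<omega>, y))"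
      by (subst integral_density) auto
  qed
  finally show ?thesis .
qed

end

section \<open>Exponential moments of the running maximum\<close>

text \<open>The maximum of \<open>0\<close> and the partial sums of the last \<open>k\<close> of the \<open>N\<close> terms, by backward recursion:
  each step involves one new increment, independent of all later ones.\<close>

primrec back_max :: "(nat \<Rightarrow> real) \<Rightarrow> nat \<Rightarrow> nat \<Rightarrow> real" where
  "back_max x N 0 = 0"
| "back_max x N (Suc k) = max 0 (x (N - Suc k) + back_max x N k)"

lemma sum_le_back_max:
  assumes "k \<le> N" "m \<le> k"
  shows "(\<Sum>i\<in>{N - k..<N - k + m}. x i) \<le> back_max x N k"
  using assms
proof (induction k arbitrary: m)
  case (Suc k)
  show ?case
  proof (cases m)
    case (Suc m')
    have "{N - Suc k..<N - Suc k + m} = insert (N - Suc k) {N - k..<N - k + m'}"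
      using Suc Suc.prems by auto
    then have "(\<Sum>i\<in>{N - Suc k..<N - Suc k + m}. x i) = x (N - Suc k) + (\<Sum>i\<in>{N - k..<N - k + m'}. x i)"
      using Suc.prems by simp
    also have "\<dots> \<le> x (N - Suc k) + back_max x N k"
      using Suc.IH[of m'] Suc Suc.prems by simp
    finally show ?thesis by simp
  qed simp
qed simp

lemma disc_max_le:
  assumes "z \<le> c" "\<And>m. m \<le> k \<Longrightarrow> (\<Sum>i<m. x i) \<le> c"
  shows "disc_max z x k \<le> c"
  using assms
proof (induction k)
  case (Suc k)
  then show ?case using Suc.prems(2)[of "Suc k"] by (simp del: sum.lessThan_Suc)
qed simp

text \<open>The reason for working with \<open>cosh\<close>: it is minimal at \<open>0\<close>, so
  cutting off at \<open>0\<close> does not increase it. An exponential would increase on one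
  side.\<close>

lemma cosh_max_0_le: "cosh (c * max 0 y) \<le> cosh (c * y :: real)"
  by (cases "0 \<le> y") (auto simp: cosh_real_ge_1 max_def)

lemma nn_integral_normal_density_exp:
  assumes "0 < s"
  shows "(\<integral>\<^sup>+y. ennreal (normal_density m s y) * ennreal (exp (c * y + d)) \<partial>lborel) =
    ennreal (exp (c * m + c\<^sup>2 * s\<^sup>2 / 2 + d))"
proof -
  have *: "normal_density m s y * exp (c * y + d) = exp (c * m + c\<^sup>2 * s\<^sup>2 / 2 + d) * normal_density (m + c * s\<^sup>2) s y" for y
  proof -
    have "- (y - m)\<^sup>2 / (2 * s\<^sup>2) + (c * y + d) = (c * m + c\<^sup>2 * s\<^sup>2 / 2 + d) + - (y - (m + c * s\<^sup>2))\<^sup>2 / (2 * s\<^sup>2)"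
      using assms by (simp add: field_simps power2_eq_square)
    then show ?thesis unfolding normal_density_def by (simp add: exp_add[symmetric] mult.assoc mult.left_commute)
  qed
  have "(\<integral>\<^sup>+y. ennreal (normal_density m s y) * ennreal (exp (c * y + d)) \<partial>lborel) =
    (\<integral>\<^sup>+y. ennreal (exp (c * m + c\<^sup>2 * s\<^sup>2 / 2 + d)) * ennreal (normal_density (m + c * s\<^sup>2) s y) \<partial>lborel)"
    by (intro nn_integral_cong) (simp add: ennreal_mult[symmetric] *)
  also have "\<dots> = ennreal (exp (c * m + c\<^sup>2 * s\<^sup>2 / 2 + d)) * (\<integral>\<^sup>+y. ennreal (normal_density (m + c * s\<^sup>2) s y) \<partial>lborel)"
    by (intro nn_integral_cmult) auto
  also have "(\<integral>\<^sup>+y. ennreal (normal_density (m + c * s\<^sup>2) s y) \<partial>lborel) = 1"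
    using assms by (subst nn_integral_eq_integral) auto
  finally show ?thesis by simp
qed

context drifted_brownian
begin

text \<open>For \<open>\<sigma> = 1\<close> this is the rise of the maximum above the start, for
  \<open>\<sigma> = -1\<close> the depth of the minimum below it. The two together bound every
  increment of the path up to \<open>t\<close>.\<close>

definition excess :: "real \<Rightarrow> real \<Rightarrow> (real \<Rightarrow> real) \<Rightarrow> real" where
  "excess \<sigma> t \<omega> = running_max t (\<lambda>r. \<sigma> * \<omega> r) - \<sigma> * \<omega> 0"

lemma disc_max_grid_excess_tendsto:
  assumes "\<omega> \<in> path_space T" "0 \<le> t" "t < T"
  shows "(\<lambda>n. disc_max 0 (\<lambda>i. \<sigma> * grid_incr 0 t (Suc n) \<omega> i) (Suc n)) \<longlonglongrightarrow> excess \<sigma> t \<omega>"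
proof -
  have "continuous_on {0..t} (\<lambda>r. \<sigma> * \<omega> r)"
    using assms by (intro continuous_intros path_space_continuous_on)
  from disc_max_grid_tendsto[OF this, of 0] assms
  have "(\<lambda>n. disc_max 0 (grid_incr 0 t (Suc n) (\<lambda>r. \<sigma> * \<omega> r)) (Suc n) + \<sigma> * \<omega> 0) \<longlonglongrightarrow> running_max t (\<lambda>r. \<sigma> * \<omega> r)"
    by (simp del: disc_max.simps(2))
  from tendsto_diff[OF this tendsto_const[of "\<sigma> * \<omega> 0"]]
  have "(\<lambda>n. disc_max 0 (grid_incr 0 t (Suc n) (\<lambda>r. \<sigma> * \<omega> r)) (Suc n)) \<longlonglongrightarrow> excess \<sigma> t \<omega>"
    by (simp add: excess_def del: disc_max.simps(2))
  moreover have "grid_incr 0 t N (\<lambda>r. \<sigma> * \<omega> r) = (\<lambda>i. \<sigma> * grid_incr 0 t N \<omega> i)" for N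
    by (simp add: fun_eq_iff grid_incr_def right_diff_distrib)
  ultimately show ?thesis by simp
qed

lemma grid_incr_measurable_P:
  assumes "0 \<le> s" "s \<le> t" "t < T" "i < N"
  shows "(\<lambda>\<omega>. grid_incr s t N \<omega> i) \<in> borel_measurable P"
  using assms by (intro measurable_natural_P[of t] natural_filtration_coordinate_incr) auto

lemma excess_measurable:
  assumes "0 \<le> t" "t < T"
  shows "excess \<sigma> t \<in> borel_measurable P"
proof (rule borel_measurable_LIMSEQ_real)
  fix n
  show "(\<lambda>\<omega>. disc_max 0 (\<lambda>i. \<sigma> * grid_incr 0 t (Suc n) \<omega> i) (Suc n)) \<in> borel_measurable P"
    using assms by (intro disc_max_measurable borel_measurable_times grid_incr_measurable_P) auto
next
  fix \<omega> assume "\<omega> \<in> space P"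
  then show "(\<lambda>n. disc_max 0 (\<lambda>i. \<sigma> * grid_incr 0 t (Suc n) \<omega> i) (Suc n)) \<longlonglongrightarrow> excess \<sigma> t \<omega>"
    using assms by (intro disc_max_grid_excess_tendsto) auto
qed

lemma excess_nonneg:
  assumes "\<omega> \<in> path_space T" "0 \<le> t" "t < T"
  shows "0 \<le> excess \<sigma> t \<omega>"
proof -
  have "continuous_on {0..t} (\<lambda>r. \<sigma> * \<omega> r)"
    using assms by (intro continuous_intros path_space_continuous_on)
  from running_max_upper[OF this, of 0] show ?thesis using assms by (simp add: excess_def)
qed

text \<open>By symmetry, averaging over a centred Gaussian shift multiplies \<open>cosh\<close> by a
  constant; therefore the recursion for the maximum closes up.\<close>

lemma nn_integral_cosh_incr:
  assumes \<sigma>: "\<sigma>\<^sup>2 = 1" and d: "0 < d"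
  shows "(\<integral>\<^sup>+y. ennreal (normal_density (\<mu> * d) (sqrt d) y) * ennreal (cosh (c * (\<sigma> * (y - \<mu> * d) + b))) \<partial>lborel) =
    ennreal (exp (c\<^sup>2 * d / 2)) * ennreal (cosh (c * b))"
proof -
  have e: "ennreal (cosh x) = ennreal (1/2) * (ennreal (exp x) + ennreal (exp (- x)))" for x :: real
  proof -
    have "cosh x = 1 / 2 * (exp x + exp (- x))" by (simp add: cosh_def)
    then have "ennreal (cosh x) = ennreal (1 / 2) * ennreal (exp x + exp (- x))"
      by (simp only:) (rule ennreal_mult, auto)
    also have "ennreal (exp x + exp (- x)) = ennreal (exp x) + ennreal (exp (- x))"
      by (rule ennreal_plus) auto
    finally show ?thesis .
  qed
  let ?n = "\<lambda>y. ennreal (normal_density (\<mu> * d) (sqrt d) y)"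
  have 1: "(\<integral>\<^sup>+y. ?n y * ennreal (exp ((k * \<sigma>) * y + k * (b - \<sigma> * \<mu> * d))) \<partial>lborel) = ennreal (exp (k\<^sup>2 * d / 2)) * ennreal (exp (k * b))" for k
    using d by (subst nn_integral_normal_density_exp)
      (auto simp: power_mult_distrib \<sigma> ennreal_mult[symmetric] exp_add[symmetric] algebra_simps)
  have "(\<integral>\<^sup>+y. ?n y * ennreal (cosh (c * (\<sigma> * (y - \<mu> * d) + b))) \<partial>lborel) =
     (\<integral>\<^sup>+y. ennreal (1/2) * (?n y * ennreal (exp ((c * \<sigma>) * y + c * (b - \<sigma> * \<mu> * d))) +
        ?n y * ennreal (exp ((- c * \<sigma>) * y + - c * (b - \<sigma> * \<mu> * d)))) \<partial>lborel)"
  proof (rule nn_integral_cong)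
    fix y
    have "c * (\<sigma> * (y - \<mu> * d) + b) = (c * \<sigma>) * y + c * (b - \<sigma> * \<mu> * d)"
      "- (c * (\<sigma> * (y - \<mu> * d) + b)) = (- c * \<sigma>) * y + - c * (b - \<sigma> * \<mu> * d)" by (simp_all add: algebra_simps)
    then show "?n y * ennreal (cosh (c * (\<sigma> * (y - \<mu> * d) + b))) =
       ennreal (1/2) * (?n y * ennreal (exp ((c * \<sigma>) * y + c * (b - \<sigma> * \<mu> * d))) +
        ?n y * ennreal (exp ((- c * \<sigma>) * y + - c * (b - \<sigma> * \<mu> * d))))"
      unfolding e by (simp only: distrib_left mult.left_commute)
  qed
  also have "\<dots> = ennreal (1/2) * (ennreal (exp (c\<^sup>2 * d / 2)) * ennreal (exp (c * b)) +
      ennreal (exp ((-c)\<^sup>2 * d / 2)) * ennreal (exp (- c * b)))"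
    by (subst nn_integral_cmult, simp, subst nn_integral_add, simp, simp) (simp only: 1)
  also have "\<dots> = ennreal (exp (c\<^sup>2 * d / 2)) * ennreal (cosh (c * b))"
    unfolding e by (simp only: power2_minus distrib_left mult.left_commute minus_mult_left)
  finally show ?thesis .
qed

text \<open>The last \<open>k\<close> increments begin at grid point \<open>N - k\<close> or later,
  hence after the cell that the next backward step adds.\<close>

lemma back_max_measurable_outer:
  assumes t: "0 < t" "t < T" and k: "k < N"
  shows "(\<lambda>\<omega>. back_max (\<lambda>i. \<sigma> * (grid_incr 0 t N \<omega> i - c)) N k) \<in>
    borel_measurable (outer_algebra T (grid 0 t N (N - Suc k)) (grid 0 t N (N - k)))"
proof -
  let ?M = "outer_algebra T (grid 0 t N (N - Suc k)) (grid 0 t N (N - k))"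
  have "j \<le> k \<Longrightarrow> (\<lambda>\<omega>. back_max (\<lambda>i. \<sigma> * (grid_incr 0 t N \<omega> i - c)) N j) \<in> borel_measurable ?M" for j
  proof (induction j)
    case (Suc j)
    have "(\<lambda>\<omega>. grid_incr 0 t N \<omega> (N - Suc j)) \<in> borel_measurable ?M"
      unfolding grid_incr_def
    proof (rule incr_measurable_outer)
      have "Suc (N - Suc j) \<le> N" "N - Suc j \<le> N" using Suc k by auto
      then have "grid 0 t N (N - Suc j) \<in> {0..t}" "grid 0 t N (Suc (N - Suc j)) \<in> {0..t}"
        using t grid_mem[of 0 t "N - Suc j" N] grid_mem[of 0 t "Suc (N - Suc j)" N] by auto
      then show "0 \<le> grid 0 t N (N - Suc j)" "grid 0 t N (Suc (N - Suc j)) < T" using t by auto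
      show "grid 0 t N (N - Suc j) \<le> grid 0 t N (Suc (N - Suc j))" using t by (intro grid_mono) auto
      show "grid 0 t N (N - Suc k) < grid 0 t N (N - k)" using t k by (intro grid_strict_mono) auto
      show "grid 0 t N (Suc (N - Suc j)) \<le> grid 0 t N (N - Suc k) \<or> grid 0 t N (N - k) \<le> grid 0 t N (N - Suc j)"
        using t k Suc by (intro disjI2 grid_mono) auto
    qed
    note [measurable] = this
    have [measurable]: "(\<lambda>\<omega>. back_max (\<lambda>i. \<sigma> * (grid_incr 0 t N \<omega> i - c)) N j) \<in> borel_measurable ?M"
      using Suc by simp
    show ?case unfolding back_max.simps by measurable
  qed simp
  then show ?thesis by simp
qed

text \<open>In each backward step the cut-off at \<open>0\<close> is discarded and the new increment
  is integrated out, which costs one factor \<open>exp (c^2 * (t / N) / 2)\<close>. After all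
  \<open>N\<close> steps the product no longer depends on the grid.\<close>

lemma nn_integral_cosh_back_max_le:
  assumes t: "0 < t" "t < T" and \<sigma>: "\<sigma>\<^sup>2 = 1" and k: "k \<le> N"
  shows "(\<integral>\<^sup>+\<omega>. ennreal (cosh (c * back_max (\<lambda>i. \<sigma> * (grid_incr 0 t N \<omega> i - \<mu> * (t / N))) N k)) \<partial>P) \<le>
    ennreal (exp (c\<^sup>2 * (t / N) / 2 * real k))"
  using k
proof (induction k)
  case 0
  then show ?case using emeasure_space_1 by simp
next
  case (Suc k)
  define j where "j = N - Suc k"
  have j: "Suc j = N - k" "j < N" using Suc by (auto simp: j_def)
  define d where "d = t / N"
  have d: "0 < d" using t Suc by (simp add: d_def)
  define a b where "a = grid 0 t N j" and "b = grid 0 t N (Suc j)"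
  have ba: "b - a = d" by (simp add: a_def b_def grid_step d_def)
  have ab: "0 \<le> a" "a < b" "b < T"
    using t j grid_mem[of 0 t j N] grid_mem[of 0 t "Suc j" N] ba d by (auto simp: a_def b_def)
  define B where "B \<omega> = back_max (\<lambda>i. \<sigma> * (grid_incr 0 t N \<omega> i - \<mu> * d)) N k" for \<omega>
  have Bm [measurable]: "B \<in> borel_measurable (outer_algebra T a b)"
    using back_max_measurable_outer[OF t, of k N \<sigma> "\<mu> * d"] Suc.prems
    unfolding B_def[abs_def] a_def b_def j_def j(1)[unfolded j_def] by simp
  have "(\<integral>\<^sup>+\<omega>. ennreal (cosh (c * back_max (\<lambda>i. \<sigma> * (grid_incr 0 t N \<omega> i - \<mu> * d)) N (Suc k))) \<partial>P) \<le>
     (\<integral>\<^sup>+\<omega>. ennreal (cosh (c * (\<sigma> * ((\<omega> b - \<omega> a) - \<mu> * d) + B \<omega>))) \<partial>P)"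
    unfolding back_max.simps B_def a_def b_def j_def[symmetric]
    by (intro nn_integral_mono ennreal_leI order_trans[OF cosh_max_0_le]) (simp add: grid_incr_def)
  also have "\<dots> = (\<integral>\<^sup>+\<omega>. (\<integral>\<^sup>+y. ennreal (normal_density (\<mu> * (b - a)) (sqrt (b - a)) y) *
      ennreal (cosh (c * (\<sigma> * (y - \<mu> * d) + B \<omega>))) \<partial>lborel) \<partial>P)"
    using nn_integral_outer_incr[OF ab, of "\<lambda>p. ennreal (cosh (c * (\<sigma> * (snd p - \<mu> * d) + B (fst p))))"]
    unfolding cosh_def by simp
  also have "\<dots> = (\<integral>\<^sup>+\<omega>. ennreal (exp (c\<^sup>2 * d / 2)) * ennreal (cosh (c * B \<omega>)) \<partial>P)"
    unfolding ba nn_integral_cosh_incr[OF \<sigma> d] ..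
  also have "\<dots> = ennreal (exp (c\<^sup>2 * d / 2)) * (\<integral>\<^sup>+\<omega>. ennreal (cosh (c * B \<omega>)) \<partial>P)"
  proof (rule nn_integral_cmult)
    have [measurable]: "B \<in> borel_measurable P"
      using measurable_compose[OF outer_algebra_measurable_P(1)[OF ab] Bm] .
    show "(\<lambda>\<omega>. ennreal (cosh (c * B \<omega>))) \<in> borel_measurable P" unfolding cosh_def by measurable
  qed
  also have "\<dots> \<le> ennreal (exp (c\<^sup>2 * d / 2)) * ennreal (exp (c\<^sup>2 * (t / N) / 2 * real k))"
    using Suc by (intro mult_left_mono) (auto simp: B_def d_def)
  also have "\<dots> = ennreal (exp (c\<^sup>2 * (t / N) / 2 * real (Suc k)))"
  proof -
    have "c\<^sup>2 * d / 2 + c\<^sup>2 * (t / N) / 2 * real k = c\<^sup>2 * (t / N) / 2 * real (Suc k)"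
      unfolding d_def by (simp only: of_nat_Suc distrib_left mult_1_right)
    then show ?thesis by (simp only: ennreal_mult[symmetric] exp_ge_zero exp_add[symmetric])
  qed
  finally show ?case by (simp only: d_def)
qed

text \<open>The moments of the sampled maxima are bounded uniformly in the grid, and Fatou's lemma
  carries the bound to the limit.\<close>

lemma integrable_exp_excess:
  assumes t: "0 < t" "t < T" and \<sigma>: "\<sigma>\<^sup>2 = 1" and c: "0 \<le> c"
  shows "integrable P (\<lambda>\<omega>. exp (c * excess \<sigma> t \<omega>))"
proof (rule integrableI_bounded)
  have [measurable]: "excess \<sigma> t \<in> borel_measurable P" using t by (intro excess_measurable) auto
  show "(\<lambda>\<omega>. exp (c * excess \<sigma> t \<omega>)) \<in> borel_measurable P" by measurable
  define D where "D n \<omega> = disc_max 0 (\<lambda>i. \<sigma> * grid_incr 0 t (Suc n) \<omega> i) (Suc n)" for n \<omega>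
  have Dm [measurable]: "D n \<in> borel_measurable P" for n
    unfolding D_def[abs_def] using t
    by (intro disc_max_measurable borel_measurable_times grid_incr_measurable_P) auto
  \<comment> \<open>The factor 2 comes from bounding \<open>exp\<close> by \<open>2 * cosh\<close>,
    the first exponential from removing the drift, the second from the \<open>N\<close> backward
    steps.\<close>
  define K where "K = ennreal (2 * exp (c * (\<bar>\<mu>\<bar> * t)) * exp (c\<^sup>2 * t / 2))"
  have s1: "\<bar>\<sigma>\<bar> = 1" using \<sigma> by (auto simp: power2_eq_1_iff)
  have bound: "(\<integral>\<^sup>+\<omega>. ennreal (exp (c * D n \<omega>)) \<partial>P) \<le> K" for n
  proof -
    let ?N = "Suc n"
    define y where "y \<omega> i = \<sigma> * (grid_incr 0 t ?N \<omega> i - \<mu> * (t / ?N))" for \<omega> i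
    have le: "D n \<omega> \<le> back_max (y \<omega>) ?N ?N + \<bar>\<mu>\<bar> * t" for \<omega>
      unfolding D_def
    proof (rule disc_max_le)
      show "0 \<le> back_max (y \<omega>) ?N ?N + \<bar>\<mu>\<bar> * t" using t by (simp add: add_nonneg_nonneg)
      fix m assume m: "m \<le> ?N"
      have "(\<Sum>i<m. \<sigma> * grid_incr 0 t ?N \<omega> i) = (\<Sum>i<m. y \<omega> i) + real m * (\<sigma> * \<mu> * (t / ?N))"
        unfolding y_def by (simp add: right_diff_distrib sum_subtractf mult.assoc)
      also have "(\<Sum>i<m. y \<omega> i) \<le> back_max (y \<omega>) ?N ?N"
        using sum_le_back_max[of ?N ?N m "y \<omega>"] m by (simp add: atLeast0LessThan del: back_max.simps(2))
      also have "real m * (\<sigma> * \<mu> * (t / ?N)) \<le> \<bar>\<mu>\<bar> * t"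
      proof -
        have "real m * (\<sigma> * \<mu> * (t / ?N)) \<le> \<bar>real m * (\<sigma> * \<mu> * (t / ?N))\<bar>" by (rule abs_ge_self)
        also have "\<dots> = (real m / ?N) * (\<bar>\<mu>\<bar> * t)" using t s1 by (simp add: abs_mult)
        also have "\<dots> \<le> 1 * (\<bar>\<mu>\<bar> * t)" using m t by (intro mult_right_mono) auto
        finally show ?thesis by simp
      qed
      finally show "(\<Sum>i<m. \<sigma> * grid_incr 0 t ?N \<omega> i) \<le> back_max (y \<omega>) ?N ?N + \<bar>\<mu>\<bar> * t" by simp
    qed
    have "exp (c * D n \<omega>) \<le> 2 * exp (c * (\<bar>\<mu>\<bar> * t)) * cosh (c * back_max (y \<omega>) ?N ?N)" for \<omega>
    proof -
      have "exp (c * D n \<omega>) \<le> exp (c * (back_max (y \<omega>) ?N ?N + \<bar>\<mu>\<bar> * t))"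
        using mult_left_mono[OF le c] by simp
      also have "\<dots> = exp (c * (\<bar>\<mu>\<bar> * t)) * exp (c * back_max (y \<omega>) ?N ?N)"
        by (simp add: exp_add[symmetric] distrib_left add.commute)
      also have "exp (c * back_max (y \<omega>) ?N ?N) \<le> 2 * cosh (c * back_max (y \<omega>) ?N ?N)"
        by (simp add: cosh_def)
      finally show ?thesis by (simp add: mult_ac)
    qed
    then have "(\<integral>\<^sup>+\<omega>. ennreal (exp (c * D n \<omega>)) \<partial>P) \<le>
      (\<integral>\<^sup>+\<omega>. ennreal (2 * exp (c * (\<bar>\<mu>\<bar> * t))) * ennreal (cosh (c * back_max (y \<omega>) ?N ?N)) \<partial>P)"
      by (intro nn_integral_mono) (simp add: ennreal_mult[symmetric] ennreal_leI)
    also have "\<dots> = ennreal (2 * exp (c * (\<bar>\<mu>\<bar> * t))) * (\<integral>\<^sup>+\<omega>. ennreal (cosh (c * back_max (y \<omega>) ?N ?N)) \<partial>P)"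
    proof (rule nn_integral_cmult)
      have "(\<lambda>\<omega>. back_max (y \<omega>) ?N k) \<in> borel_measurable P" if "k \<le> ?N" for k
        using that
      proof (induction k)
        case (Suc k)
        have [measurable]: "(\<lambda>\<omega>. grid_incr 0 t ?N \<omega> (?N - Suc k)) \<in> borel_measurable P"
          using t by (intro grid_incr_measurable_P) auto
        have [measurable]: "(\<lambda>\<omega>. back_max (y \<omega>) ?N k) \<in> borel_measurable P" using Suc by simp
        show ?case unfolding back_max.simps unfolding y_def[of _ "?N - Suc k"] by measurable
      qed simp
      from this[of ?N] have [measurable]: "(\<lambda>\<omega>. back_max (y \<omega>) ?N ?N) \<in> borel_measurable P" by simp
      show "(\<lambda>\<omega>. ennreal (cosh (c * back_max (y \<omega>) ?N ?N))) \<in> borel_measurable P"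
        unfolding cosh_def by measurable
    qed
    also have "\<dots> \<le> ennreal (2 * exp (c * (\<bar>\<mu>\<bar> * t))) * ennreal (exp (c\<^sup>2 * (t / ?N) / 2 * real ?N))"
      unfolding y_def by (intro mult_left_mono nn_integral_cosh_back_max_le t \<sigma>) auto
    also have "c\<^sup>2 * (t / ?N) / 2 * real ?N = c\<^sup>2 * t / 2" by (simp del: of_nat_Suc)
    also have "ennreal (2 * exp (c * (\<bar>\<mu>\<bar> * t))) * ennreal (exp (c\<^sup>2 * t / 2)) = K"
      by (simp add: K_def ennreal_mult[symmetric])
    finally show ?thesis .
  qed
  have "(\<integral>\<^sup>+\<omega>. ennreal (norm (exp (c * excess \<sigma> t \<omega>))) \<partial>P) = (\<integral>\<^sup>+\<omega>. liminf (\<lambda>n. ennreal (exp (c * D n \<omega>))) \<partial>P)"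
  proof (rule nn_integral_cong)
    fix \<omega> assume "\<omega> \<in> space P"
    then have "(\<lambda>n. D n \<omega>) \<longlonglongrightarrow> excess \<sigma> t \<omega>"
      unfolding D_def using t by (intro disc_max_grid_excess_tendsto) auto
    then have "(\<lambda>n. ennreal (exp (c * D n \<omega>))) \<longlonglongrightarrow> ennreal (exp (c * excess \<sigma> t \<omega>))"
      by (intro tendsto_intros)
    from lim_imp_Liminf[OF _ this] show "ennreal (norm (exp (c * excess \<sigma> t \<omega>))) = liminf (\<lambda>n. ennreal (exp (c * D n \<omega>)))"
      by simp
  qed
  also have "\<dots> \<le> liminf (\<lambda>n. \<integral>\<^sup>+\<omega>. ennreal (exp (c * D n \<omega>)) \<partial>P)"
    by (intro nn_integral_liminf) measurable
  also have "\<dots> \<le> liminf (\<lambda>n. K)" by (intro Liminf_mono always_eventually allI bound)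
  also have "\<dots> = K" by (simp add: Liminf_const)
  also have "K < \<infinity>" by (simp add: K_def)
  finally show "(\<integral>\<^sup>+\<omega>. ennreal (norm (exp (c * excess \<sigma> t \<omega>))) \<partial>P) < \<infinity>" .
qed

end

section \<open>The submartingale property\<close>

text \<open>Raising increments raises the maximum by no more than the final position, so the
  drawdown shrinks; and the gap between the two maxima grows with \<open>k\<close>, so every step of
  the maximum becomes larger. For the latter: when a new position exceeds the old maximum, the gap
  is at least the total shift so far, which dominates all earlier gaps.\<close>

lemma disc_max_perturb:
  assumes "\<And>i. x i \<le> x' i"
  shows "disc_max z x k \<le> disc_max z x' k"
    "disc_max z x' k - disc_max z x k \<le> (\<Sum>i<k. x' i - x i)"
    "disc_max z x' k - disc_max z x k \<le> disc_max z x' (Suc k) - disc_max z x (Suc k)"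
proof -
  define \<sigma> where "\<sigma> k = (\<Sum>i<k. x' i - x i)" for k
  have \<sigma>: "\<sigma> k \<le> \<sigma> (Suc k)" "(\<Sum>i<k. x' i) = (\<Sum>i<k. x i) + \<sigma> k" "0 \<le> \<sigma> k" for k
    using assms by (auto simp: \<sigma>_def sum_subtractf intro!: sum_mono)
  have *: "disc_max z x k \<le> disc_max z x' k \<and> disc_max z x' k - disc_max z x k \<le> \<sigma> k" for k
  proof (induction k)
    case (Suc k)
    then show ?case using \<sigma>(1)[of k] \<sigma>(3)[of "Suc k"] \<sigma>(2)[of "Suc k"]
      unfolding disc_max.simps by (auto simp del: sum.lessThan_Suc simp: max_def)
  qed (simp add: \<sigma>_def)
  from *[of k] show "disc_max z x k \<le> disc_max z x' k"
    "disc_max z x' k - disc_max z x k \<le> (\<Sum>i<k. x' i - x i)" by (auto simp: \<sigma>_def)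
  show "disc_max z x' k - disc_max z x k \<le> disc_max z x' (Suc k) - disc_max z x (Suc k)"
    using *[of k] \<sigma>(1)[of k] \<sigma>(2)[of "Suc k"]
    unfolding disc_max.simps by (auto simp del: sum.lessThan_Suc simp: max_def)
qed

text \<open>The exponential tilt turns the drifted law of the increments into a driftless one. Monotonicity in
  each increment then plays the role of the nonnegativity of the drift \<open>G_mu\<close>: the factor
  \<open>exp (- \<mu> * z) * F_mu \<mu> \<tau> z\<close> decreases in \<open>z\<close>, and \<open>f_mu \<mu> \<tau> + \<mu> = G_mu \<mu> \<tau> 0\<close> is nonnegative.\<close>

lemma tilted_disc_L_mono:
  assumes st: "s \<le> t" "t < T" and z: "0 \<le> z" and x: "\<And>i. x i \<le> x' i"
  shows "exp (\<mu> * (\<Sum>i<N. x i)) * disc_L T \<mu> s t N z x \<le> exp (\<mu> * (\<Sum>i<N. x' i)) * disc_L T \<mu> s t N z x'"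
proof -
  define f where "f i = f_mu \<mu> (T - grid s t N i)" for i
  \<comment> \<open>The exponent \<open>\<mu>\<close> times the final position is split into
    \<open>\<mu> * z\<close>, \<open>\<mu>\<close> times the rise of the maximum, which joins the
    weights \<open>f\<close>, and \<open>- \<mu>\<close> times the final drawdown, which joins
    \<open>F_mu\<close>.\<close>
  have decomp: "exp (\<mu> * (\<Sum>i<N. x i)) * disc_L T \<mu> s t N z x =
    exp (- \<mu> * (disc_max z x N - (\<Sum>i<N. x i))) * F_mu \<mu> (T - t) (disc_max z x N - (\<Sum>i<N. x i)) *
    exp (\<mu> * z + (\<Sum>i<N. (f i + \<mu>) * (disc_max z x (Suc i) - disc_max z x i)))" for x
  proof -
    have "(\<Sum>i<N. (f i + \<mu>) * (disc_max z x (Suc i) - disc_max z x i)) =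
      (\<Sum>i<N. f i * (disc_max z x (Suc i) - disc_max z x i)) + \<mu> * (disc_max z x N - z)"
      using sum_lessThan_telescope[of "disc_max z x" N]
      by (simp add: distrib_right sum.distrib sum_distrib_left[symmetric] del: disc_max.simps(2))
    then show ?thesis unfolding disc_L_def f_def[symmetric]
      by (simp add: exp_add[symmetric] mult_ac(1) mult.left_commute[of _ "F_mu _ _ _"] algebra_simps del: disc_max.simps(2))
  qed
  have "0 \<le> f i + \<mu>" if "i < N" for i
    unfolding f_def using grid_mem[of s t i N] that st by (intro f_mu_add_nonneg) auto
  then have S: "(\<Sum>i<N. (f i + \<mu>) * (disc_max z x (Suc i) - disc_max z x i)) \<le>
      (\<Sum>i<N. (f i + \<mu>) * (disc_max z x' (Suc i) - disc_max z x' i))"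
    using disc_max_perturb(3)[where x=x and x'=x' and z=z, OF x] by (intro sum_mono mult_left_mono) (auto simp: algebra_simps simp del: disc_max.simps(2))
  have "disc_max z x' N - (\<Sum>i<N. x' i) \<le> disc_max z x N - (\<Sum>i<N. x i)"
    using disc_max_perturb(2)[where x=x and x'=x' and z=z and k=N, OF x] by (simp add: sum_subtractf)
  then have F: "exp (- \<mu> * (disc_max z x N - (\<Sum>i<N. x i))) * F_mu \<mu> (T - t) (disc_max z x N - (\<Sum>i<N. x i)) \<le>
    exp (- \<mu> * (disc_max z x' N - (\<Sum>i<N. x' i))) * F_mu \<mu> (T - t) (disc_max z x' N - (\<Sum>i<N. x' i))"
    using st disc_max_ge[OF z, where k=N and x=x'] by (intro exp_F_mu_antimono) auto
  show ?thesis unfolding decomp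
    by (intro mult_mono F) (use S F_mu_pos[of \<mu> "T - t"] in \<open>auto intro: less_imp_le\<close>)
qed

text \<open>The drifted normal density is a constant times \<open>exp (\<mu> * y)\<close> times the
  centred one. The tilted function is monotone, so multiplied by \<open>y\<close> it is at least
  \<open>q 0 * y\<close>, whose centred Gaussian integral vanishes. Integrability is not assumed, so
  that the result applies to every frozen path.\<close>

lemma tilted_mono_normal_integral_nonneg:
  fixes q :: "real \<Rightarrow> real"
  assumes d: "0 < d" and mono: "\<And>x y. x \<le> y \<Longrightarrow> exp (\<mu> * x) * q x \<le> exp (\<mu> * y) * q y"
  shows "0 \<le> (LINT y|lborel. normal_density (\<mu> * d) (sqrt d) y * (q y * y))"
proof (cases "integrable lborel (\<lambda>y. normal_density (\<mu> * d) (sqrt d) y * (q y * y))")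
  case True
  define c where "c = exp (- \<mu>\<^sup>2 * d / 2)"
  have nd: "normal_density (\<mu> * d) (sqrt d) y = c * (exp (\<mu> * y) * normal_density 0 (sqrt d) y)" for y
  proof -
    have "- (y - \<mu> * d)\<^sup>2 / (2 * d) = - \<mu>\<^sup>2 * d / 2 + (\<mu> * y + - y\<^sup>2 / (2 * d))"
      using d by (simp add: field_simps power2_eq_square)
    then have "exp (- (y - \<mu> * d)\<^sup>2 / (2 * d)) = c * (exp (\<mu> * y) * exp (- y\<^sup>2 / (2 * d)))"
      unfolding c_def by (simp only: exp_add)
    moreover have "normal_density m (sqrt d) y = 1 / sqrt (2 * pi * d) * exp (- (y - m)\<^sup>2 / (2 * d))" for m
      using d by (simp add: normal_density_def)
    ultimately show ?thesis by simp
  qed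
  have odd: "has_bochner_integral lborel (\<lambda>y. normal_density 0 (sqrt d) y * y) 0"
    using normal_moment_odd[of "sqrt d" 0 0] d by simp
  have "0 = (LINT y|lborel. c * q 0 * (normal_density 0 (sqrt d) y * y))"
    using has_bochner_integral_integral_eq[OF odd] by simp
  also have "\<dots> \<le> (LINT y|lborel. normal_density (\<mu> * d) (sqrt d) y * (q y * y))"
  proof (rule integral_mono[OF _ True])
    show "integrable lborel (\<lambda>y. c * q 0 * (normal_density 0 (sqrt d) y * y))"
      using integrable.intros[OF odd] by simp
    fix y :: real
    have "q 0 * y \<le> exp (\<mu> * y) * q y * y"
    proof (cases "0 \<le> y")
      case True
      then show ?thesis using mono[of 0 y] by (intro mult_right_mono) auto
    next
      case False
      then show ?thesis using mono[of y 0] by (intro mult_right_mono_neg) auto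
    qed
    then have "c * normal_density 0 (sqrt d) y * (q 0 * y) \<le> c * normal_density 0 (sqrt d) y * (exp (\<mu> * y) * q y * y)"
      by (intro mult_left_mono) (auto simp: c_def)
    then show "c * q 0 * (normal_density 0 (sqrt d) y * y) \<le> normal_density (\<mu> * d) (sqrt d) y * (q y * y)"
      unfolding nd by (simp add: mult_ac)
  qed
  finally show ?thesis .
\<comment> \<open>The Bochner integral of a function that is not integrable is \<open>0\<close> by
  convention.\<close>
qed (simp add: not_integrable_integral_eq)

context drifted_brownian
begin

section \<open>An integrable bound common to all grids\<close>

lemma abs_incr_le_excess:
  assumes "\<omega> \<in> path_space T" "u \<in> {0..t}" "v \<in> {0..t}" "t < T"
  shows "\<bar>\<omega> v - \<omega> u\<bar> \<le> excess 1 t \<omega> + excess (-1) t \<omega>"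
proof -
  have X: "continuous_on {0..t} \<omega>" using assms by (intro path_space_continuous_on)
  have X': "continuous_on {0..t} (\<lambda>r. - \<omega> r)" using X by (intro continuous_intros)
  show ?thesis
    using running_max_upper[OF X assms(2)] running_max_upper[OF X assms(3)]
      running_max_upper[OF X' assms(2)] running_max_upper[OF X' assms(3)]
    by (simp add: excess_def)
qed

text \<open>With \<open>C = f_mu \<mu> (T - t)\<close> and excesses \<open>a\<close>,
  \<open>b\<close> on the two sides, \<open>exp (C * a) * (a + b)\<close> is at most
  \<open>exp ((C + 1) * a) * exp b\<close>, hence at most the sum of the two squares. The sum needs
  only moments of one-sided excesses, not their joint law.\<close>

definition dominator :: "real \<Rightarrow> (real \<Rightarrow> real) \<Rightarrow> real" where
  "dominator t \<omega> = exp (2 * (f_mu \<mu> (T - t) + 1) * excess 1 t \<omega>) + exp (2 * excess (-1) t \<omega>)"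

lemma integrable_dominator:
  assumes "0 < t" "t < T"
  shows "integrable P (dominator t)"
  unfolding dominator_def[abs_def] using assms f_mu_nonneg[of "T - t" \<mu>]
  by (intro Bochner_Integration.integrable_add integrable_exp_excess) auto

lemma exp_excess_le_dominator:
  assumes \<omega>: "\<omega> \<in> path_space T" and t: "0 \<le> t" "t < T"
    and x: "\<bar>x\<bar> \<le> exp (f_mu \<mu> (T - t) * excess 1 t \<omega>)" and y: "\<bar>y\<bar> \<le> excess 1 t \<omega> + excess (-1) t \<omega>"
  shows "\<bar>x * y\<bar> \<le> dominator t \<omega>"
proof -
  define a b C where "a = excess 1 t \<omega>" and "b = excess (-1) t \<omega>" and "C = f_mu \<mu> (T - t)"
  have ab: "0 \<le> a" "0 \<le> b" using excess_nonneg[OF \<omega> t] by (auto simp: a_def b_def)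
  have "\<bar>x * y\<bar> \<le> exp (C * a) * (a + b)"
    unfolding abs_mult using x y by (intro mult_mono) (auto simp: a_def b_def C_def)
  also have "\<dots> \<le> exp (C * a) * exp (a + b)"
  proof -
    have "a + b \<le> exp (a + b)" using exp_ge_add_one_self[of "a + b"] by linarith
    then show ?thesis by (intro mult_left_mono) auto
  qed
  also have "\<dots> = exp ((C + 1) * a) * exp b" by (simp add: exp_add[symmetric] algebra_simps)
  also have "\<dots> \<le> (exp ((C + 1) * a))\<^sup>2 + (exp b)\<^sup>2"
  proof -
    have "0 \<le> (exp ((C + 1) * a) - exp b)\<^sup>2" by simp
    then have "2 * (exp ((C + 1) * a) * exp b) \<le> (exp ((C + 1) * a))\<^sup>2 + (exp b)\<^sup>2"
      by (simp add: power2_diff mult.assoc)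
    moreover have "0 \<le> exp ((C + 1) * a) * exp b" by simp
    ultimately show ?thesis by linarith
  qed
  also have "\<dots> = dominator t \<omega>"
    by (simp add: dominator_def a_def b_def C_def exp_double[symmetric] mult.assoc)
  finally show ?thesis .
qed

lemma L_proc_le_exp_excess:
  assumes \<omega>: "\<omega> \<in> path_space T" and t: "0 \<le> t" "t < T"
  shows "\<bar>L_proc T \<mu> t \<omega>\<bar> \<le> exp (f_mu \<mu> (T - t) * excess 1 t \<omega>)"
proof -
  have X: "continuous_on {0..t} \<omega>" using assms by (intro path_space_continuous_on)
  have "L_proc T \<mu> t \<omega> \<le> F_mu \<mu> (T - t) 0 * exp (f_mu \<mu> (T - t) * (running_max t \<omega> - \<omega> 0))"
    by (rule L_proc_le[OF X]) (use t running_max_upper[OF X, of t] in auto)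
  then show ?thesis using t L_proc_nonneg[of T \<mu> t \<omega>] by (simp add: F_mu_0 excess_def)
qed

text \<open>All weights are at most \<open>f_mu \<mu> (T - t)\<close>, the sampled maximum stays
  below the true one, and the rises before and after \<open>s\<close> add up to the excess. The
  bound is independent of both grids.\<close>

lemma weighted_disc_L_le_exp_excess:
  assumes \<omega>: "\<omega> \<in> path_space T" and st: "0 \<le> s" "s \<le> t" "t < T"
  shows "\<bar>exp (stieltjes_sum T \<mu> 0 s (Suc n) \<omega>) * 
      disc_L T \<mu> s t N (running_max s \<omega> - \<omega> s) (grid_incr s t N \<omega>)\<bar> \<le> exp (f_mu \<mu> (T - t) * excess 1 t \<omega>)"
proof -
  define C where "C = f_mu \<mu> (T - t)"
  have X: "continuous_on {0..t} \<omega>" using assms by (intro path_space_continuous_on)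
  have Xs: "continuous_on {0..s} \<omega>" using st by (intro continuous_on_subset[OF X]) auto
  have C: "0 \<le> C" "f_mu \<mu> (T - s) \<le> C" using st by (auto simp: C_def intro!: f_mu_nonneg f_mu_antimono)
  define z where "z = running_max s \<omega> - \<omega> s"
  have z: "0 \<le> z" using running_max_upper[OF Xs, of s] st by (simp add: z_def)
  let ?x = "grid_incr s t N \<omega>"
  have "stieltjes_sum T \<mu> 0 s (Suc n) \<omega> \<le> f_mu \<mu> (T - s) * (running_max s \<omega> - \<omega> 0)"
    using st by (intro stieltjes_sum_le[OF Xs]) auto
  also have "\<dots> \<le> C * (running_max s \<omega> - \<omega> 0)"
    using running_max_upper[OF Xs, of 0] st C by (intro mult_right_mono) auto
  finally have 1: "stieltjes_sum T \<mu> 0 s (Suc n) \<omega> \<le> C * (running_max s \<omega> - \<omega> 0)" .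
  have "(\<Sum>i<N. f_mu \<mu> (T - grid s t N i) * (disc_max z ?x (Suc i) - disc_max z ?x i)) \<le>
     (\<Sum>i<N. C * (disc_max z ?x (Suc i) - disc_max z ?x i))"
  proof (intro sum_mono mult_right_mono)
    fix i assume "i \<in> {..<N}"
    then show "f_mu \<mu> (T - grid s t N i) \<le> C"
      unfolding C_def using grid_mem[of s t i N] st by (intro f_mu_antimono) auto
  qed simp
  also have "\<dots> = C * (disc_max z ?x N - z)"
    unfolding sum_distrib_left[symmetric] using sum_lessThan_telescope[of "disc_max z ?x" N] by simp
  also have "\<dots> \<le> C * (running_max t \<omega> - running_max s \<omega>)"
  proof (cases "N = 0")
    case True
    then show ?thesis using C running_max_mono[OF X st(1,2)] by simp
  next
    case False
    then show ?thesis using C disc_max_grid_le_running_max[OF X st(1,2) order_refl, of N]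
      by (intro mult_left_mono) (auto simp: z_def)
  qed
  finally have 2: "(\<Sum>i<N. f_mu \<mu> (T - grid s t N i) * (disc_max z ?x (Suc i) - disc_max z ?x i)) \<le>
    C * (running_max t \<omega> - running_max s \<omega>)" .
  have "disc_L T \<mu> s t N z ?x \<le> 1 * exp (C * (running_max t \<omega> - running_max s \<omega>))"
    unfolding disc_L_def using st disc_max_ge[OF z, of ?x N] 2
    by (intro mult_mono F_mu_le_1) auto
  moreover have "exp (stieltjes_sum T \<mu> 0 s (Suc n) \<omega>) \<le> exp (C * (running_max s \<omega> - \<omega> 0))" using 1 by simp
  moreover have nn: "0 \<le> disc_L T \<mu> s t N z ?x" unfolding disc_L_def using F_mu_pos[of \<mu> "T - t"] by (simp add: less_imp_le)
  ultimately have "exp (stieltjes_sum T \<mu> 0 s (Suc n) \<omega>) * disc_L T \<mu> s t N z ?x \<le>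
    exp (C * (running_max s \<omega> - \<omega> 0)) * (1 * exp (C * (running_max t \<omega> - running_max s \<omega>)))"
    by (intro mult_mono) auto
  also have "\<dots> = exp (C * excess 1 t \<omega>)"
    by (simp add: exp_add[symmetric] excess_def algebra_simps)
  finally show ?thesis using nn by (simp add: abs_mult z_def C_def)
qed

text \<open>\<open>W\<close>, the drawdown at \<open>s\<close> and all other increments are
  measurable with respect to the path outside the \<open>j\<close>-th cell. With these frozen, a
  Gaussian integral of a tilted monotone function times its argument remains.\<close>

lemma integral_disc_L_incr_nonneg:
  assumes st: "0 \<le> s" "s < t" "t < T" and j: "j < N"
    and W: "W \<in> borel_measurable (natural_filtration T s)" "\<And>\<omega>. 0 \<le> W \<omega>"
    and int: "integrable P (\<lambda>\<omega>. W \<omega> * disc_L T \<mu> s t N (running_max s \<omega> - \<omega> s) (grid_incr s t N \<omega>) * grid_incr s t N \<omega> j)"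
  shows "0 \<le> (LINT \<omega>|P. W \<omega> * disc_L T \<mu> s t N (running_max s \<omega> - \<omega> s) (grid_incr s t N \<omega>) * grid_incr s t N \<omega> j)"
proof -
  define a b where "a = grid s t N j" and "b = grid s t N (Suc j)"
  have ga: "grid s t N j \<in> {s..t}" "grid s t N (Suc j) \<in> {s..t}"
    using grid_mem[of s t j N] grid_mem[of s t "Suc j" N] st j by auto
  have ab: "0 \<le> a" "a < b" "b < T" "s \<le> a"
    using ga st j grid_strict_mono[of s t N j "Suc j"] by (auto simp: a_def b_def)
  let ?O = "outer_algebra T a b"
  have nat: "f \<in> borel_measurable ?O" if "f \<in> borel_measurable (natural_filtration T s)" for f :: "(real \<Rightarrow> real) \<Rightarrow> real"
  proof (rule natural_filtration_measurable_outer)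
    show "f \<in> borel_measurable (natural_filtration T a)"
      by (rule measurable_from_subalg[OF _ that])
         (unfold subalgebra_def, intro conjI natural_filtration_mono ab(4), simp)
  qed
  define z where "z \<omega> = running_max s \<omega> - \<omega> s" for \<omega>
  have [measurable]: "W \<in> borel_measurable ?O" using W by (intro nat)
  have [measurable]: "z \<in> borel_measurable ?O"
    unfolding z_def[abs_def] using st
    by (intro nat borel_measurable_diff running_max_measurable natural_filtration_coordinate) auto
  have xm: "(\<lambda>\<omega>. grid_incr s t N \<omega> i) \<in> borel_measurable ?O" if "i < N" "i \<noteq> j" for i
    unfolding grid_incr_def
  proof (rule incr_measurable_outer)
    have "grid s t N i \<in> {s..t}" "grid s t N (Suc i) \<in> {s..t}"
      using grid_mem[of s t i N] grid_mem[of s t "Suc i" N] st that by auto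
    then show "0 \<le> grid s t N i" "grid s t N (Suc i) < T" using st by auto
    show "grid s t N i \<le> grid s t N (Suc i)" using st by (intro grid_mono) auto
    show "grid s t N (Suc i) \<le> a \<or> b \<le> grid s t N i"
    proof (cases "i < j")
      case True
      then show ?thesis unfolding a_def using st by (intro disjI1 grid_mono) auto
    next
      case False
      then show ?thesis unfolding b_def using st that by (intro disjI2 grid_mono) auto
    qed
  qed (rule ab)
  \<comment> \<open>The \<open>j\<close>-th increment is overwritten by a free variable, so that the
    path enters through the outer algebra only.\<close>
  define h where "h p = W (fst p) * disc_L T \<mu> s t N (z (fst p)) ((grid_incr s t N (fst p))(j := snd p)) * snd p" for p
  have hm: "h \<in> borel_measurable (?O \<Otimes>\<^sub>M borel)"
  proof -
    have "(\<lambda>p. disc_L T \<mu> s t N (z (fst p)) ((grid_incr s t N (fst p))(j := snd p))) \<in> borel_measurable (?O \<Otimes>\<^sub>M borel)"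
    proof (rule disc_L_measurable)
      fix i assume i: "i < N"
      show "(\<lambda>p. ((grid_incr s t N (fst p))(j := snd p)) i) \<in> borel_measurable (?O \<Otimes>\<^sub>M borel)"
      proof (cases "i = j")
        case False
        from measurable_compose[OF measurable_fst xm[OF i False]] False show ?thesis by simp
      qed simp
    qed measurable
    note [measurable] = this
    show ?thesis unfolding h_def[abs_def] by measurable
  qed
  have hval: "h (\<omega>, \<omega> b - \<omega> a) = W \<omega> * disc_L T \<mu> s t N (running_max s \<omega> - \<omega> s) (grid_incr s t N \<omega>) * grid_incr s t N \<omega> j" for \<omega>
  proof -
    have "\<omega> b - \<omega> a = grid_incr s t N \<omega> j" by (simp add: grid_incr_def a_def b_def)
    then show ?thesis by (simp add: h_def z_def)
  qed
  have "(LINT \<omega>|P. W \<omega> * disc_L T \<mu> s t N (running_max s \<omega> - \<omega> s) (grid_incr s t N \<omega>) * grid_incr s t N \<omega> j) =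
    (LINT \<omega>|P. (LINT y|lborel. normal_density (\<mu> * (b - a)) (sqrt (b - a)) y * h (\<omega>, y)))"
    using integral_outer_incr[OF ab(1-3) hm] int unfolding hval by blast
  also have "0 \<le> \<dots>"
  proof (rule integral_nonneg_AE[OF AE_I2])
    fix \<omega> assume "\<omega> \<in> space P"
    then have "continuous_on {0..s} \<omega>" using st by (intro path_space_continuous_on[of \<omega> T]) auto
    then have z0: "0 \<le> z \<omega>" using st by (auto simp: z_def intro!: running_max_upper)
    define x where "x y = (grid_incr s t N \<omega>)(j := y)" for y
    define R where "R = (\<Sum>i\<in>{..<N} - {j}. grid_incr s t N \<omega> i)"
    have sum_x: "(\<Sum>i<N. x y i) = y + R" for y
    proof -
      have "(\<Sum>i<N. x y i) = x y j + (\<Sum>i\<in>{..<N} - {j}. x y i)"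
        using j by (intro sum.remove) auto
      also have "(\<Sum>i\<in>{..<N} - {j}. x y i) = R" unfolding R_def x_def by (intro sum.cong) auto
      finally show ?thesis by (simp add: x_def)
    qed
    have "0 \<le> (LINT y|lborel. normal_density (\<mu> * (b - a)) (sqrt (b - a)) y * ((W \<omega> * disc_L T \<mu> s t N (z \<omega>) (x y)) * y))"
    proof (rule tilted_mono_normal_integral_nonneg)
      fix y y' :: real assume "y \<le> y'"
      then have "exp (\<mu> * (\<Sum>i<N. x y i)) * disc_L T \<mu> s t N (z \<omega>) (x y) \<le>
         exp (\<mu> * (\<Sum>i<N. x y' i)) * disc_L T \<mu> s t N (z \<omega>) (x y')"
        using st z0 by (intro tilted_disc_L_mono) (auto simp: x_def)
      then have "W \<omega> * exp (- \<mu> * R) * (exp (\<mu> * (\<Sum>i<N. x y i)) * disc_L T \<mu> s t N (z \<omega>) (x y)) \<le>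
         W \<omega> * exp (- \<mu> * R) * (exp (\<mu> * (\<Sum>i<N. x y' i)) * disc_L T \<mu> s t N (z \<omega>) (x y'))"
        using W(2) by (intro mult_left_mono) auto
      moreover have "W \<omega> * exp (- \<mu> * R) * (exp (\<mu> * (\<Sum>i<N. x u i)) * D) = exp (\<mu> * u) * (W \<omega> * D)" for u D
      proof -
        have "exp (- \<mu> * R) * exp (\<mu> * (\<Sum>i<N. x u i)) = exp (\<mu> * u)"
          by (simp add: sum_x exp_add[symmetric] distrib_left)
        then show ?thesis by (metis mult.assoc mult.left_commute)
      qed
      ultimately show "exp (\<mu> * y) * (W \<omega> * disc_L T \<mu> s t N (z \<omega>) (x y)) \<le> exp (\<mu> * y') * (W \<omega> * disc_L T \<mu> s t N (z \<omega>) (x y'))"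
        by (simp only:)
    qed (use ab in simp)
    then show "0 \<le> (LINT y|lborel. normal_density (\<mu> * (b - a)) (sqrt (b - a)) y * h (\<omega>, y))"
      by (simp add: h_def x_def)
  qed
  finally show ?thesis .
qed

lemma integral_L_proc_incr_nonneg:
  assumes st: "0 \<le> s" "s < t" "t < T" and A: "A \<in> sets (natural_filtration T s)"
  shows "0 \<le> (LINT \<omega>|P. indicator A \<omega> * (L_proc T \<mu> t \<omega> * (\<omega> t - \<omega> s)))"
proof -
  \<comment> \<open>Everything determined by the path up to \<open>s\<close> is collected in
    \<open>W\<close>; \<open>D\<close> carries the sampled future.\<close>
  define W where "W n \<omega> = indicator A \<omega> * exp (stieltjes_sum T \<mu> 0 s (Suc n) \<omega>)" for n \<omega>
  define D where "D n \<omega> = disc_L T \<mu> s t (Suc n) (running_max s \<omega> - \<omega> s) (grid_incr s t (Suc n) \<omega>)" for n \<omega>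
  have Wm: "W n \<in> borel_measurable (natural_filtration T s)" for n
  proof -
    have [measurable]: "stieltjes_sum T \<mu> 0 s (Suc n) \<in> borel_measurable (natural_filtration T s)"
      using st by (intro stieltjes_sum_measurable) auto
    show ?thesis unfolding W_def[abs_def] using A by measurable
  qed
  have WmP: "W n \<in> borel_measurable P" for n
    using st by (intro measurable_natural_P[OF _ Wm]) auto
  have DmP: "D n \<in> borel_measurable P" for n
    unfolding D_def[abs_def] using st
    by (intro disc_L_measurable grid_incr_measurable_P borel_measurable_diff coordinate_measurable
        measurable_natural_P[of s] running_max_measurable) auto
  have WD: "\<bar>W n \<omega> * D n \<omega>\<bar> \<le> exp (f_mu \<mu> (T - t) * excess 1 t \<omega>)" if "\<omega> \<in> path_space T" for n \<omega>
  proof -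
    have "\<bar>W n \<omega> * D n \<omega>\<bar> \<le> \<bar>exp (stieltjes_sum T \<mu> 0 s (Suc n) \<omega>) * D n \<omega>\<bar>"
      unfolding W_def by (auto simp: indicator_def abs_mult)
    also have "\<dots> \<le> exp (f_mu \<mu> (T - t) * excess 1 t \<omega>)"
      unfolding D_def using st by (intro weighted_disc_L_le_exp_excess that) auto
    finally show ?thesis .
  qed
  have t0: "0 < t" using st by simp
  have int: "integrable P (\<lambda>\<omega>. W n \<omega> * D n \<omega> * grid_incr s t (Suc n) \<omega> j)" if j: "j < Suc n" for n j
  proof (rule Bochner_Integration.integrable_bound[OF integrable_dominator[OF t0 st(3)]])
    show "(\<lambda>\<omega>. W n \<omega> * D n \<omega> * grid_incr s t (Suc n) \<omega> j) \<in> borel_measurable P"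
      using st j by (intro borel_measurable_times WmP DmP grid_incr_measurable_P) auto
    show "AE \<omega> in P. norm (W n \<omega> * D n \<omega> * grid_incr s t (Suc n) \<omega> j) \<le> norm (dominator t \<omega>)"
    proof (rule AE_I2)
      fix \<omega> assume "\<omega> \<in> space P"
      then have \<omega>: "\<omega> \<in> path_space T" by simp
      have "grid s t (Suc n) j \<in> {s..t}" "grid s t (Suc n) (Suc j) \<in> {s..t}"
        using grid_mem[of s t j "Suc n"] grid_mem[of s t "Suc j" "Suc n"] st j by auto
      then have "\<bar>grid_incr s t (Suc n) \<omega> j\<bar> \<le> excess 1 t \<omega> + excess (-1) t \<omega>"
        unfolding grid_incr_def using st by (intro abs_incr_le_excess \<omega>) auto
      from exp_excess_le_dominator[OF \<omega> _ st(3) WD[OF \<omega>] this] st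
      have "norm (W n \<omega> * D n \<omega> * grid_incr s t (Suc n) \<omega> j) \<le> dominator t \<omega>" by simp
      also have "\<dots> \<le> norm (dominator t \<omega>)" by simp
      finally show "norm (W n \<omega> * D n \<omega> * grid_incr s t (Suc n) \<omega> j) \<le> norm (dominator t \<omega>)" .
    qed
  qed
  have nonneg: "0 \<le> (LINT \<omega>|P. W n \<omega> * D n \<omega> * (\<omega> t - \<omega> s))" for n
  proof -
    have "W n \<omega> * D n \<omega> * (\<omega> t - \<omega> s) = (\<Sum>j<Suc n. W n \<omega> * D n \<omega> * grid_incr s t (Suc n) \<omega> j)" for \<omega>
      unfolding sum_distrib_left[symmetric] sum_grid_incr by simp
    then have "(LINT \<omega>|P. W n \<omega> * D n \<omega> * (\<omega> t - \<omega> s)) = (\<Sum>j<Suc n. LINT \<omega>|P. W n \<omega> * D n \<omega> * grid_incr s t (Suc n) \<omega> j)"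
      using int by (simp only:) (rule Bochner_Integration.integral_sum, auto)
    also have "0 \<le> \<dots>"
    proof (rule sum_nonneg)
      fix j assume "j \<in> {..<Suc n}"
      then have j: "j < Suc n" by simp
      show "0 \<le> (LINT \<omega>|P. W n \<omega> * D n \<omega> * grid_incr s t (Suc n) \<omega> j)"
        using integral_disc_L_incr_nonneg[OF st j Wm, of n] int[OF j] unfolding D_def by (auto simp: W_def)
    qed
    finally show ?thesis .
  qed
  have "(\<lambda>n. LINT \<omega>|P. W n \<omega> * D n \<omega> * (\<omega> t - \<omega> s)) \<longlonglongrightarrow> (LINT \<omega>|P. indicator A \<omega> * (L_proc T \<mu> t \<omega> * (\<omega> t - \<omega> s)))"
  proof (rule integral_dominated_convergence[where w="dominator t"])
    have [measurable]: "(\<lambda>\<omega>. \<omega> t) \<in> borel_measurable P" "(\<lambda>\<omega>. \<omega> s) \<in> borel_measurable P"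
       "L_proc T \<mu> t \<in> borel_measurable P" 
      using st by (auto intro!: coordinate_measurable measurable_natural_P[OF _ L_proc_measurable])
    have [measurable]: "(indicator A :: _ \<Rightarrow> real) \<in> borel_measurable P"
      using A st by (intro measurable_natural_P[of s]) auto
    show "(\<lambda>\<omega>. indicator A \<omega> * (L_proc T \<mu> t \<omega> * (\<omega> t - \<omega> s))) \<in> borel_measurable P" by measurable
    show "(\<lambda>\<omega>. W n \<omega> * D n \<omega> * (\<omega> t - \<omega> s)) \<in> borel_measurable P" for n
      by (intro borel_measurable_times WmP DmP borel_measurable_diff coordinate_measurable) (use st in auto)
    show "integrable P (dominator t)" by (rule integrable_dominator[OF t0 st(3)])
    show "AE \<omega> in P. (\<lambda>n. W n \<omega> * D n \<omega> * (\<omega> t - \<omega> s)) \<longlonglongrightarrow> indicator A \<omega> * (L_proc T \<mu> t \<omega> * (\<omega> t - \<omega> s))"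
    proof (rule AE_I2)
      fix \<omega> assume "\<omega> \<in> space P"
      then have "continuous_on {0..t} \<omega>" using st by (intro path_space_continuous_on[of \<omega> T]) auto
      from disc_L_tendsto[OF this, of s T \<mu>] st
      have "(\<lambda>n. exp (stieltjes_sum T \<mu> 0 s (Suc n) \<omega>) * D n \<omega>) \<longlonglongrightarrow> L_proc T \<mu> t \<omega>" unfolding D_def by simp
      then have "(\<lambda>n. indicator A \<omega> * ((exp (stieltjes_sum T \<mu> 0 s (Suc n) \<omega>) * D n \<omega>) * (\<omega> t - \<omega> s))) \<longlonglongrightarrow>
         indicator A \<omega> * (L_proc T \<mu> t \<omega> * (\<omega> t - \<omega> s))" by (intro tendsto_intros)
      then show "(\<lambda>n. W n \<omega> * D n \<omega> * (\<omega> t - \<omega> s)) \<longlonglongrightarrow> indicator A \<omega> * (L_proc T \<mu> t \<omega> * (\<omega> t - \<omega> s))"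
        by (simp add: W_def mult.assoc)
    qed
    show "AE \<omega> in P. norm (W n \<omega> * D n \<omega> * (\<omega> t - \<omega> s)) \<le> dominator t \<omega>" for n
    proof (rule AE_I2)
      fix \<omega> assume "\<omega> \<in> space P"
      then have \<omega>: "\<omega> \<in> path_space T" by simp
      have "\<bar>\<omega> t - \<omega> s\<bar> \<le> excess 1 t \<omega> + excess (-1) t \<omega>"
        using st by (intro abs_incr_le_excess \<omega>) auto
      from exp_excess_le_dominator[OF \<omega> _ st(3) WD[OF \<omega>] this] st
      show "norm (W n \<omega> * D n \<omega> * (\<omega> t - \<omega> s)) \<le> dominator t \<omega>" by simp
    qed
  qed
  then show ?thesis by (rule LIMSEQ_le_const) (use nonneg in blast)
qed

text \<open>An event of the right-continuous filtration at \<open>s\<close> belongs to the natural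
  filtration at every later time. The inequality thus holds from \<open>u n\<close> on, and
  continuity of the path lets \<open>u n\<close> decrease to \<open>s\<close>.\<close>

lemma integral_L_proc_incr_nonneg_right:
  assumes st: "0 \<le> s" "s < t" "t < T" and A: "A \<in> sets (path_filtration T s)"
  shows "0 \<le> (LINT \<omega>|P. indicator A \<omega> * (L_proc T \<mu> t \<omega> * (\<omega> t - \<omega> s)))"
proof -
  define u where "u n = s + (t - s) / real (n + 2)" for n
  have u: "s < u n" "u n < t" for n
  proof -
    have "(t - s) / real (n + 2) < t - s" using st by (simp add: divide_less_eq)
    moreover have "0 < (t - s) / real (n + 2)" using st by simp
    ultimately show "s < u n" "u n < t" by (simp_all add: u_def)
  qed
  have "(\<lambda>n. s + (t - s) / real (n + 2)) \<longlonglongrightarrow> s + 0" by real_asymp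
  then have ulim: "u \<longlonglongrightarrow> s" by (simp add: u_def[abs_def])
  have An: "A \<in> sets (natural_filtration T (u n))" for n
    using A u[of n] st by (auto simp: path_filtration_def sets_right_augmentation)
  have AP: "A \<in> events" using A path_filtration_le_path_algebra[of s T] st by (auto simp: sets_P)
  have nonneg: "0 \<le> (LINT \<omega>|P. indicator A \<omega> * (L_proc T \<mu> t \<omega> * (\<omega> t - \<omega> (u n))))" for n
    using st u[of n] An by (intro integral_L_proc_incr_nonneg) auto
  have "(\<lambda>n. LINT \<omega>|P. indicator A \<omega> * (L_proc T \<mu> t \<omega> * (\<omega> t - \<omega> (u n)))) \<longlonglongrightarrow>
    (LINT \<omega>|P. indicator A \<omega> * (L_proc T \<mu> t \<omega> * (\<omega> t - \<omega> s)))"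
  proof (rule integral_dominated_convergence[where w="dominator t"])
    have m: "(\<lambda>\<omega>. indicator A \<omega> * (L_proc T \<mu> t \<omega> * (\<omega> t - \<omega> r))) \<in> borel_measurable P" if "0 \<le> r" "r < T" for r
    proof -
      have [measurable]: "(\<lambda>\<omega>. \<omega> t) \<in> borel_measurable P" "(\<lambda>\<omega>. \<omega> r) \<in> borel_measurable P"
         "L_proc T \<mu> t \<in> borel_measurable P" 
        using st that by (auto intro!: coordinate_measurable measurable_natural_P[OF _ L_proc_measurable])
      show ?thesis using AP by measurable
    qed
    show "(\<lambda>\<omega>. indicator A \<omega> * (L_proc T \<mu> t \<omega> * (\<omega> t - \<omega> s))) \<in> borel_measurable P"
      using st by (intro m) auto
    show "(\<lambda>\<omega>. indicator A \<omega> * (L_proc T \<mu> t \<omega> * (\<omega> t - \<omega> (u n)))) \<in> borel_measurable P" for n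
      using st u[of n] by (intro m) auto
    show "integrable P (dominator t)" using st by (intro integrable_dominator) auto
    show "AE \<omega> in P. (\<lambda>n. indicator A \<omega> * (L_proc T \<mu> t \<omega> * (\<omega> t - \<omega> (u n)))) \<longlonglongrightarrow>
       indicator A \<omega> * (L_proc T \<mu> t \<omega> * (\<omega> t - \<omega> s))"
    proof (rule AE_I2)
      fix \<omega> assume "\<omega> \<in> space P"
      then have X: "continuous_on {0..t} \<omega>" using st by (intro path_space_continuous_on[of \<omega> T]) auto
      have "u n \<in> {0..t}" for n using st u[of n] by auto
      then have "(\<lambda>n. \<omega> (u n)) \<longlonglongrightarrow> \<omega> s"
        using st by (intro continuous_on_tendsto_compose[OF X ulim] always_eventually allI) auto
      then show "(\<lambda>n. indicator A \<omega> * (L_proc T \<mu> t \<omega> * (\<omega> t - \<omega> (u n)))) \<longlonglongrightarrow>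
         indicator A \<omega> * (L_proc T \<mu> t \<omega> * (\<omega> t - \<omega> s))" by (intro tendsto_intros)
    qed
    show "AE \<omega> in P. norm (indicator A \<omega> * (L_proc T \<mu> t \<omega> * (\<omega> t - \<omega> (u n)))) \<le> dominator t \<omega>" for n
    proof (rule AE_I2)
      fix \<omega> assume "\<omega> \<in> space P"
      then have \<omega>: "\<omega> \<in> path_space T" by simp
      have "\<bar>\<omega> t - \<omega> (u n)\<bar> \<le> excess 1 t \<omega> + excess (-1) t \<omega>"
        using st u[of n] by (intro abs_incr_le_excess \<omega>) auto
      from exp_excess_le_dominator[OF \<omega> _ st(3) L_proc_le_exp_excess[OF \<omega> _ st(3)] this] st
      show "norm (indicator A \<omega> * (L_proc T \<mu> t \<omega> * (\<omega> t - \<omega> (u n)))) \<le> dominator t \<omega>"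
        by (auto simp: indicator_def intro: order_trans[OF abs_ge_zero])
    qed
  qed
  then show ?thesis by (rule LIMSEQ_le_const) (use nonneg in blast)
qed

end

context brownian_change_of_measure
begin

section \<open>The submartingale property under the changed measure\<close>

lemma coordinate_measurable_filtration:
  assumes "t \<in> {0..<T}" "r \<in> {0..t}"
  shows "(\<lambda>\<omega>. \<omega> r) \<in> borel_measurable (path_filtration T t)"
  by (rule measurable_natural(1)[OF assms(1)], rule natural_filtration_coordinate[OF assms(2)])

lemma integrable_coordinate_Q:
  assumes t: "t \<in> {0..<T}"
  shows "integrable Q (\<lambda>\<omega>. \<omega> t)"
proof -
  \<comment> \<open>A strictly later time is positive even for \<open>t = 0\<close>, as required by
    the moment bounds.\<close>
  obtain t' where t': "t < t'" "t' < T" using dense[of t T] t by auto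
  have tt: "t' \<in> {0..<T}" "0 < t'" using t t' by auto
  have "integrable P (\<lambda>\<omega>. L_proc T \<mu> t' \<omega> * \<omega> t)"
  proof (rule Bochner_Integration.integrable_bound[OF integrable_dominator[OF tt(2) t'(2)]])
    have [measurable]: "(\<lambda>\<omega>. \<omega> t) \<in> borel_measurable P" "L_proc T \<mu> t' \<in> borel_measurable P"
      using tt t by (auto intro!: coordinate_measurable measurable_natural_P[OF _ L_proc_measurable])
    show "(\<lambda>\<omega>. L_proc T \<mu> t' \<omega> * \<omega> t) \<in> borel_measurable P" by measurable
    show "AE \<omega> in P. norm (L_proc T \<mu> t' \<omega> * \<omega> t) \<le> norm (dominator t' \<omega>)"
      using AE_start_0 AE_space
    proof eventually_elim
      case (elim \<omega>)
      then have \<omega>: "\<omega> \<in> path_space T" by simp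
      have "\<bar>\<omega> t - \<omega> 0\<bar> \<le> excess 1 t' \<omega> + excess (-1) t' \<omega>"
        using t t' by (intro abs_incr_le_excess \<omega>) auto
      then have "\<bar>\<omega> t\<bar> \<le> excess 1 t' \<omega> + excess (-1) t' \<omega>" using elim by simp
      from exp_excess_le_dominator[OF \<omega> _ t'(2) L_proc_le_exp_excess[OF \<omega> _ t'(2)] this] tt
      have "norm (L_proc T \<mu> t' \<omega> * \<omega> t) \<le> dominator t' \<omega>" by simp
      also have "\<dots> \<le> norm (dominator t' \<omega>)" by simp
      finally show ?case .
    qed
  qed
  then show ?thesis
    using integrable_Q_iff[OF tt(1) coordinate_measurable_filtration[OF tt(1)], of t] t t' by simp
qed

lemma integral_incr_Q_nonneg:
  assumes s: "s \<in> {0..<T}" and t: "t \<in> {s..<T}" and A: "A \<in> sets (path_filtration T s)"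
  shows "0 \<le> (LINT \<omega>|Q. indicator A \<omega> * (\<omega> t - \<omega> s))"
proof (cases "s = t")
  case False
  then have st: "0 \<le> s" "s < t" "t < T" and tT: "t \<in> {0..<T}" using s t by auto
  have At: "A \<in> sets (path_filtration T t)"
  proof -
    obtain r where r: "s < r" "r < t" using dense st by blast
    have "A \<in> sets (natural_filtration T r)"
      using A r st by (auto simp: path_filtration_def sets_right_augmentation)
    then show ?thesis
      using natural_filtration_mono[of r t T] natural_filtration_le_path_filtration[of t T] r st by auto
  qed
  have [measurable]: "(\<lambda>\<omega>. \<omega> t) \<in> borel_measurable (path_filtration T t)" "(\<lambda>\<omega>. \<omega> s) \<in> borel_measurable (path_filtration T t)"
    using tT st by (auto intro!: coordinate_measurable_filtration)
  have "(\<lambda>\<omega>. indicator A \<omega> * (\<omega> t - \<omega> s)) \<in> borel_measurable (path_filtration T t)"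
    using At by measurable
  from integral_Q[OF tT this] show ?thesis
    using integral_L_proc_incr_nonneg_right[OF st A] by (simp add: mult.left_commute)
qed simp

lemma submartingale_coordinate:
  "submartingale_on Q (path_filtration T) T (\<lambda>t \<omega>. \<omega> t)"
  unfolding submartingale_on_def
proof (intro conjI ballI)
  fix t assume t: "t \<in> {0..<T}"
  show "(\<lambda>\<omega>. \<omega> t) \<in> borel_measurable (path_filtration T t)"
    using t by (intro coordinate_measurable_filtration) auto
  show "integrable Q (\<lambda>\<omega>. \<omega> t)" by (rule integrable_coordinate_Q[OF t])
next
  fix s t assume s: "s \<in> {0..<T}" and t: "t \<in> {s..<T}"
  have tT: "t \<in> {0..<T}" using s t by auto
  let ?F = "path_filtration T s"
  interpret F: finite_measure_subalgebra Q ?F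
    by (intro finite_measure_subalgebra.intro finite_measure_subalgebra_axioms.intro
        path_filtration_subalgebra(2)[OF s] Q.finite_measure_axioms)
  define g where "g = real_cond_exp Q ?F (\<lambda>\<omega>. \<omega> t)"
  have int: "integrable Q (\<lambda>\<omega>. \<omega> t)" "integrable Q (\<lambda>\<omega>. \<omega> s)"
    using integrable_coordinate_Q s tT by auto
  have gi: "integrable Q g" unfolding g_def using int(1) by (rule F.real_cond_exp_int(1))
  have [measurable]: "g \<in> borel_measurable ?F" unfolding g_def by simp
  have [measurable]: "(\<lambda>\<omega>. \<omega> s) \<in> borel_measurable ?F" using s by (intro coordinate_measurable_filtration) auto
  \<comment> \<open>The event on which the submartingale inequality would fail is used as the test
    event; the integral over it is forced to be both nonnegative and nonpositive.\<close>
  define A where "A = {\<omega> \<in> space ?F. g \<omega> < \<omega> s}"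
  have A: "A \<in> sets ?F" unfolding A_def by measurable
  have AQ: "A \<in> sets Q" using A path_filtration_subalgebra(2)[OF s] by (auto simp: subalgebra_def)
  have iA: "integrable Q (\<lambda>\<omega>. indicator A \<omega> * f \<omega>)" if "integrable Q f" for f :: "_ \<Rightarrow> real"
    using integrable_mult_indicator[OF AQ that] by simp
  have "(LINT \<omega>|Q. indicator A \<omega> * (\<omega> s - g \<omega>)) = (LINT \<omega>|Q. indicator A \<omega> * \<omega> s) - (LINT \<omega>|Q. indicator A \<omega> * g \<omega>)"
    unfolding right_diff_distrib by (intro Bochner_Integration.integral_diff iA int gi)
  also have "(LINT \<omega>|Q. indicator A \<omega> * g \<omega>) = (LINT \<omega>|Q. indicator A \<omega> * \<omega> t)"
    using F.real_cond_exp_intA[OF int(1) A] by (simp add: g_def set_lebesgue_integral_def)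
  also have "(LINT \<omega>|Q. indicator A \<omega> * \<omega> s) - \<dots> = - (LINT \<omega>|Q. indicator A \<omega> * (\<omega> t - \<omega> s))"
    unfolding right_diff_distrib by (subst Bochner_Integration.integral_diff) (auto intro!: iA int)
  also have "\<dots> \<le> 0" using integral_incr_Q_nonneg[OF s t A] by simp
  finally have le: "(LINT \<omega>|Q. indicator A \<omega> * (\<omega> s - g \<omega>)) \<le> 0" .
  have nn: "0 \<le> indicator A \<omega> * (\<omega> s - g \<omega>)" for \<omega> by (auto simp: A_def indicator_def)
  have "(LINT \<omega>|Q. indicator A \<omega> * (\<omega> s - g \<omega>)) = 0"
    using le nn by (intro antisym integral_nonneg_AE) auto
  then have "AE \<omega> in Q. indicator A \<omega> * (\<omega> s - g \<omega>) = 0"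
    by (subst (asm) integral_nonneg_eq_0_iff_AE) (use nn int gi in \<open>auto intro!: iA\<close>)
  then show "AE \<omega> in Q. \<omega> s \<le> real_cond_exp Q (path_filtration T s) (\<lambda>\<omega>. \<omega> t) \<omega>"
    using AE_space
  proof eventually_elim
    case (elim \<omega>)
    then show ?case by (auto simp: A_def indicator_def g_def split: if_splits)
  qed
qed

text \<open>The coordinate process is a true submartingale before \<open>T\<close>, so the constant
  sequence \<open>T\<close> localises it.\<close>

lemma local_submartingale_coordinate:
  "local_submartingale_on Q (path_filtration T) T (\<lambda>t \<omega>. \<omega> t)"
  unfolding local_submartingale_on_def
proof (intro conjI ballI exI[of _ "\<lambda>n \<omega>. T"])
  fix t assume "t \<in> {0..<T}"
  then show "(\<lambda>\<omega>. \<omega> t) \<in> borel_measurable (path_filtration T t)"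
    by (intro coordinate_measurable_filtration) auto
next
  show "\<forall>n. stopping_time (path_filtration T) (\<lambda>\<omega>. T)"
    by (simp add: stopping_time_def)
  show "\<forall>n. submartingale_on Q (path_filtration T) T (\<lambda>t \<omega>. \<omega> (min t T))"
    using submartingale_coordinate by (simp add: submartingale_on_def min_def)
qed (use T in auto)

end

theorem proposition5p5:
  fixes T \<mu> :: real and P Q :: "(real \<Rightarrow> real) measure"
  assumes T: "0 < T"
    and P: "drifted_brownian_law T \<mu> P"
    and Q: "prob_space Q" "space Q = path_space T" "sets Q = sets (path_algebra T)"
    and dQ_dP: "\<And>t. t \<in> {0..<T} \<Longrightarrow>
      restr_to_subalg Q (path_filtration T t) =
      density (restr_to_subalg P (path_filtration T t)) (\<lambda>\<omega>. ennreal (L_proc T \<mu> t \<omega>))"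
  shows "(\<forall>\<tau>>0. \<forall>z\<ge>0. 0 \<le> G_mu \<mu> \<tau> z) \<and>
    (\<forall>w>0. ereal w \<le> Liminf (at_right 0) (\<lambda>\<tau>. INF z\<in>{w..}. ereal (\<tau> * G_mu \<mu> \<tau> z))) \<and>
    local_submartingale_on Q (path_filtration T) T (\<lambda>t \<omega>. \<omega> t) \<and>
    \<P>(\<omega> in Q. Liminf (at_left T) (\<lambda>t. ereal (running_max t \<omega> - \<omega> t)) = 0) = 1"
proof -
  interpret brownian_change_of_measure T \<mu> P Q
    by (intro brownian_change_of_measure.intro drifted_brownian.intro brownian_change_of_measure_axioms.intro T P Q dQ_dP)
  show ?thesis
    by (intro conjI allI impI G_mu_nonneg G_mu_Liminf local_submartingale_coordinate prob_Liminf_drawdown_eq_0)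
qed

end
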